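(* Let $A=A(\mathbf q,\mathbf a)$ be a quantum complete intersection over a field $\mathbb K$. Then $A$ admits a bi-Frobenius algebra structure with permutation antipode if and only if there are a compatible permutation $\pi\in S_n$ with $\pi^2=\mathrm{Id}$ and elements $c_i\in\mathbb K$, $1\le i\le n$, such that $$c_ic_{\pi(i)}=h_{\mathbf e_i}\quad(1\le i\le n),\qquad q_\pi\prod_{1\le i\le n}c_i^{a_i-1}=1.$$ If this is the case, then, for such $\pi$ and $c_1,\dots,c_n$, the quadruple $(A,\ x_{\mathbf a-\mathbf 1}^*,\ x_{\mathbf a-\mathbf 1},\ S)$ is a bi-Frobenius algebra, where the coalgebra structure $(\Delta,\varepsilon)$ on $A$ and the map $S$ are those attached to $(\pi,c_1,\dots,c_n)$ as defined in the context. In particular $S(x_i)=c_ix_{\pi(i)}$ for $1\le i\le n$.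
   Context: **Quantum complete intersections.** Let $\mathbb K$ be a field, $n\ge 2$ an integer, $\mathbf a=(a_1,\dots,a_n)$ an integer vector with all $a_i\ge 2$, and $\mathbf q=(q_{ij})$ an $n\times n$ matrix over $\mathbb K$ with $q_{ii}=1$ and $q_{ij}q_{ji}=1$ for all $i,j$. The quantum complete intersection $A=A(\mathbf q,\mathbf a)$ is the $\mathbb K$-algebra $\mathbb K\langle x_1,\dots,x_n\rangle/\langle x_i^{a_i},\ x_jx_i-q_{ij}x_ix_j,\ 1\le i,j\le n\rangle$. Put $V=\{\mathbf v=(v_1,\dots,v_n)\in\mathbb N_0^n: v_i\le a_i-1,\ 1\le i\le n\}$ and $x_{\mathbf v}=x_1^{v_1}\cdots x_n^{v_n}$. Then $\{x_{\mathbf v}:\mathbf v\in V\}$ is a $\mathbb K$-basis of $A$ (the standard basis); $\{x_{\mathbf v}^*\}$ denotes the dual basis of $A^*=\mathrm{Hom}_{\mathbb K}(A,\mathbb K)$. Write $\mathbf 0=(0,\dots,0)$, $\mathbf 1=(1,\dots,1)$, and $\mathbf e_i$ for the $i$-th unit vector. **Structure coefficients.** For $\mathbf u,\mathbf v\in\mathbb Z^n$: $\mathbf q^{\langle\mathbf u|\mathbf v\rangle}=\prod_{1\le i<j\le n}q_{ij}^{u_jv_i}$ and $h_{\mathbf v}=\mathbf q^{\langle\mathbf a-\mathbf 1-\mathbf v|\mathbf v\rangle}/\mathbf q^{\langle\mathbf v|\mathbf a-\mathbf 1-\mathbf v\rangle}$; in particular $h_{\mathbf e_i}=\prod_{1\le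 j\le n}q_{ij}^{a_j-1}$. **Permutations.** $\pi\in S_n$ acts on $\mathbb Z^n$ by $\pi(\mathbf v)=(v_{\pi^{-1}(1)},\dots,v_{\pi^{-1}(n)})$, so $\pi(\mathbf e_i)=\mathbf e_{\pi(i)}$. It is compatible (with $A$) if $a_{\pi(i)}=a_i$ and $q_{\pi(i)\pi(j)}=q_{ji}$ for all $1\le i,j\le n$ (then $\pi$ maps $V$ to $V$). Put $q_\pi=\prod_{1\le j<k\le n}(\mathbf q^{\langle\pi(\mathbf e_k)|\pi(\mathbf e_j)\rangle})^{(a_k-1)(a_j-1)}$. **Bi-Frobenius algebras.** Let $A$ be a finite-dimensional algebra which is also a coalgebra $(A,\Delta,\varepsilon)$ over $\mathbb K$, let $t\in A$, $\phi\in A^*$, and let $S:A\to A$ be the linear map $S(a)=\sum\phi(t_1a)t_2$ (Sweedler notation $\Delta(t)=\sum t_1\otimes t_2$). $(A,\phi,t,S)$ is a bi-Frobenius algebra (with antipode $S$) if: (i) $\varepsilon$ is an algebra homomorphism and $\Delta(1_A)=1_A\otimes 1_A$; (ii) $(A,\phi)$ is a Frobenius algebra, i.e. every element of $A^*$ has the form $x\mapsto\phi(bx)$ for some $b\in A$, and $(A,t)$ is a Frobenius coalgebra, i.e. $A=\{\sum f(t_1)t_2: f\in A^*\}$; (iii) $S$ is an algebra anti-homomorphism ($S(1)=1$, $S(ab)=S(b)S(a)$) and a coalgebra anti-homomorphism ($\varepsilon\circ S=\varepsilon$, $\Delta(S(a))=\sum S(a_2)\otimes S(a_1)$). A bi-Frobenius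 algebra structure on the algebra $A$ is a choice of coalgebra structure, $\phi$, $t$ making $(A,\phi,t,S)$ a bi-Frobenius algebra. **Permutation antipode.** For a bi-Frobenius algebra structure on $A(\mathbf q,\mathbf a)$, $S$ is a permutation antipode if there are a permutation $\pi$ of the set $V$ and $c_{\mathbf v}\in\mathbb K$ ($\mathbf v\in V$) with $S(x_{\mathbf v})=c_{\mathbf v}x_{\pi(\mathbf v)}$ for all $\mathbf v\in V$. **Structure attached to $(\pi,c_1,\dots,c_n)$.** Let $\pi\in S_n$ be compatible with $\pi^2=\mathrm{Id}$ and $c_i\in\mathbb K$ with $c_ic_{\pi(i)}=h_{\mathbf e_i}$ for all $i$ and $q_\pi\prod_ic_i^{a_i-1}=1$. For $\mathbf v\in V$ put $$g_{\mathbf a-\mathbf 1-\mathbf v,\pi(\mathbf v)}=\frac{1}{\mathbf q^{\langle\mathbf a-\mathbf 1-\mathbf v|\mathbf v\rangle}}\prod_{1\le i\le n}c_i^{v_i}\prod_{1\le j<k\le n}(\mathbf q^{\langle\pi(\mathbf e_k)|\pi(\mathbf e_j)\rangle})^{v_jv_k}.$$ Define linear maps: $\varepsilon(x_{\mathbf v})=\delta_{\mathbf v,\mathbf 0}$; $\Delta(1_A)=1_A\otimes1_A$; $\Delta(x_{\mathbf v})=1_A\otimes x_{\mathbf v}+x_{\mathbf v}\otimes1_A$ for $\mathbf v\in V\setminus\{\mathbf 0,\mathbf a-\mathbf 1\}$; $\Delta(x_{\mathbf a-\mathbf 1})=\sum_{\mathbf v\in V}g_{\mathbf a-\mathbf 1-\mathbf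 v,\pi(\mathbf v)}\,x_{\mathbf a-\mathbf 1-\mathbf v}\otimes x_{\pi(\mathbf v)}$; and $$S(x_{\mathbf v})=\prod_{1\le i\le n}c_i^{v_i}\prod_{1\le j<k\le n}(\mathbf q^{\langle\pi(\mathbf e_k)|\pi(\mathbf e_j)\rangle})^{v_jv_k}\,x_{\pi(\mathbf v)},\quad\mathbf v\in V.$$ *)

theory Defs
  imports
    "HOL-Algebra.QuotRing"
    "HOL-Combinatorics.Permutations"
    "HOL-Library.Poly_Mapping"
    "Jordan_Normal_Form.VS_Connect"
begin

section \<open>Vector spaces over a type-class field\<close>

text \<open>
  Throughout, the base field is a type \<open>'k\<close> of class \<^class>\<open>field\<close>, seen as the ring record
  \<^term>\<open>class_ring\<close>.  Vector spaces and algebras are HOL-Algebra \<open>module\<close> records; for a mere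
  vector space the fields \<open>mult\<close> and \<open>one\<close> are irrelevant and filled arbitrarily.
\<close>

definition scalar_module :: "('k::field, 'k) module" where
  "scalar_module =
    \<lparr>carrier = UNIV, mult = (*), one = 1, zero = 0, add = (+), smult = (*)\<rparr>"

definition dual_space :: "('k::field, 'v) module \<Rightarrow> ('v \<Rightarrow> 'k) set" where
  "dual_space V = LinearCombinations.module_hom class_ring V scalar_module"

definition free_space :: "'s set \<Rightarrow> ('k::field, 's \<Rightarrow>\<^sub>0 'k) module" where
  "free_space B =
    \<lparr>carrier = {p. Poly_Mapping.keys p \<subseteq> B}, mult = (\<lambda>_ _. 0), one = 0, zero = 0, add = (+),
     smult = (\<lambda>c. Poly_Mapping.map ((*) c))\<rparr>"

text \<open>
  The quotient of a vector space by a subspace, or of an algebra by a two-sided ideal: the ring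
  \<^term>\<open>V Quot N\<close> together with the induced scalar multiplication.
\<close>

definition quot_space :: "('k::field, 'v) module \<Rightarrow> 'v set \<Rightarrow> ('k, 'v set) module" where
  "quot_space V N =
    \<lparr>carrier = carrier (V Quot N), mult = mult (V Quot N), one = one (V Quot N),
     zero = zero (V Quot N), add = add (V Quot N),
     smult = (\<lambda>c X. \<Union>x\<in>X. N +>\<^bsub>V\<^esub> (c \<odot>\<^bsub>V\<^esub> x))\<rparr>"


section \<open>Tensor products\<close>

definition tensor_relators ::
    "('k::field, 'v) module \<Rightarrow> ('k, 'w) module \<Rightarrow> (('v \<times> 'w) \<Rightarrow>\<^sub>0 'k) set" where
  "tensor_relators V W =
     {Poly_Mapping.single (v \<oplus>\<^bsub>V\<^esub> v', w) 1 - Poly_Mapping.single (v, w) 1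
        - Poly_Mapping.single (v', w) 1 | v v' w.
        v \<in> carrier V \<and> v' \<in> carrier V \<and> w \<in> carrier W}
   \<union> {Poly_Mapping.single (v, w \<oplus>\<^bsub>W\<^esub> w') 1 - Poly_Mapping.single (v, w) 1
        - Poly_Mapping.single (v, w') 1 | v w w'.
        v \<in> carrier V \<and> w \<in> carrier W \<and> w' \<in> carrier W}
   \<union> {Poly_Mapping.single (c \<odot>\<^bsub>V\<^esub> v, w) 1 - Poly_Mapping.single (v, w) c | c v w.
        v \<in> carrier V \<and> w \<in> carrier W}
   \<union> {Poly_Mapping.single (v, c \<odot>\<^bsub>W\<^esub> w) 1 - Poly_Mapping.single (v, w) c | c v w.
        v \<in> carrier V \<and> w \<in> carrier W}"

definition tensor_kernel ::
    "('k::field, 'v) module \<Rightarrow> ('k, 'w) module \<Rightarrow> (('v \<times> 'w) \<Rightarrow>\<^sub>0 'k) set" where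
  "tensor_kernel V W = LinearCombinations.module.span class_ring
     (free_space (carrier V \<times> carrier W)) (tensor_relators V W)"

definition tensor ::
    "('k::field, 'v) module \<Rightarrow> ('k, 'w) module \<Rightarrow> ('k, (('v \<times> 'w) \<Rightarrow>\<^sub>0 'k) set) module" where
  "tensor V W = quot_space (free_space (carrier V \<times> carrier W)) (tensor_kernel V W)"

definition pure_tensor ::
    "('k::field, 'v) module \<Rightarrow> ('k, 'w) module \<Rightarrow> 'v \<Rightarrow> 'w \<Rightarrow> (('v \<times> 'w) \<Rightarrow>\<^sub>0 'k) set" where
  "pure_tensor V W v w =
     tensor_kernel V W +>\<^bsub>free_space (carrier V \<times> carrier W)\<^esub> Poly_Mapping.single (v, w) 1"

text \<open>
  For a bilinear map \<open>\<beta>\<close> into \<open>U\<close>, \<open>tensor_lift U \<beta>\<close> is the induced linear map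
  \<open>v \<otimes> w \<mapsto> \<beta> v w\<close> on the tensor product: the value does not depend on the chosen
  representative of the coset.  In Sweedler notation, \<open>tensor_lift U \<beta> (\<Delta> a)\<close> is
  the sum of \<open>\<beta> a\<^sub>1 a\<^sub>2\<close>.
\<close>

definition tensor_lift ::
    "('k::field, 'u) module \<Rightarrow> ('v \<Rightarrow> 'w \<Rightarrow> 'u) \<Rightarrow> (('v \<times> 'w) \<Rightarrow>\<^sub>0 'k) set \<Rightarrow> 'u" where
  "tensor_lift U \<beta> X = (let p = (SOME p. p \<in> X) in
     \<Oplus>\<^bsub>U\<^esub> z \<in> Poly_Mapping.keys p. Poly_Mapping.lookup p z \<odot>\<^bsub>U\<^esub> \<beta> (fst z) (snd z))"


section \<open>Algebras, coalgebras and bi-Frobenius algebras\<close>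

text \<open>The locale \<open>algebra\<close> of HOL-Algebra is restricted to commutative algebras.\<close>

definition fin_dim_algebra :: "('k::field, 'a) module \<Rightarrow> bool" where
  "fin_dim_algebra A \<longleftrightarrow>
     ring A \<and> vectorspace class_ring A \<and> vectorspace.fin_dim class_ring A \<and>
     (\<forall>c. \<forall>x\<in>carrier A. \<forall>y\<in>carrier A.
        (c \<odot>\<^bsub>A\<^esub> x) \<otimes>\<^bsub>A\<^esub> y = c \<odot>\<^bsub>A\<^esub> (x \<otimes>\<^bsub>A\<^esub> y) \<and>
        x \<otimes>\<^bsub>A\<^esub> (c \<odot>\<^bsub>A\<^esub> y) = c \<odot>\<^bsub>A\<^esub> (x \<otimes>\<^bsub>A\<^esub> y))"

text \<open>
  Coassociativity is stated in the tensor product of \<open>C\<close> with \<open>tensor C C\<close>, the left-hand side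
  being the image of \<open>\<Sum> (a\<^sub>1\<^sub>1 \<otimes> a\<^sub>1\<^sub>2) \<otimes> a\<^sub>2\<close> under the canonical associativity isomorphism.
\<close>

definition coalgebra ::
    "('k::field, 'a) module \<Rightarrow> ('a \<Rightarrow> (('a \<times> 'a) \<Rightarrow>\<^sub>0 'k) set) \<Rightarrow> ('a \<Rightarrow> 'k) \<Rightarrow> bool" where
  "coalgebra C \<Delta> \<epsilon> \<longleftrightarrow>
     vectorspace class_ring C \<and>
     \<Delta> \<in> LinearCombinations.module_hom class_ring C (tensor C C) \<and>
     \<epsilon> \<in> dual_space C \<and>
     (\<forall>a\<in>carrier C.
        tensor_lift (tensor C (tensor C C))
          (\<lambda>a1 a2. tensor_lift (tensor C (tensor C C))
             (\<lambda>b c. pure_tensor C (tensor C C) b (pure_tensor C C c a2)) (\<Delta> a1)) (\<Delta> a)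
      = tensor_lift (tensor C (tensor C C))
          (\<lambda>a1 a2. pure_tensor C (tensor C C) a1 (\<Delta> a2)) (\<Delta> a)) \<and>
     (\<forall>a\<in>carrier C.
        tensor_lift C (\<lambda>a1 a2. \<epsilon> a1 \<odot>\<^bsub>C\<^esub> a2) (\<Delta> a) = a \<and>
        tensor_lift C (\<lambda>a1 a2. \<epsilon> a2 \<odot>\<^bsub>C\<^esub> a1) (\<Delta> a) = a)"

definition frobenius_algebra :: "('k::field, 'a) module \<Rightarrow> ('a \<Rightarrow> 'k) \<Rightarrow> bool" where
  "frobenius_algebra A \<phi> \<longleftrightarrow>
     \<phi> \<in> dual_space A \<and>
     (\<forall>f\<in>dual_space A. \<exists>b\<in>carrier A. \<forall>x\<in>carrier A. f x = \<phi> (b \<otimes>\<^bsub>A\<^esub> x))"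

definition frobenius_coalgebra ::
    "('k::field, 'a) module \<Rightarrow> ('a \<Rightarrow> (('a \<times> 'a) \<Rightarrow>\<^sub>0 'k) set) \<Rightarrow> 'a \<Rightarrow> bool" where
  "frobenius_coalgebra C \<Delta> t \<longleftrightarrow>
     t \<in> carrier C \<and>
     carrier C = {tensor_lift C (\<lambda>t1 t2. f t1 \<odot>\<^bsub>C\<^esub> t2) (\<Delta> t) | f. f \<in> dual_space C}"

definition bi_frobenius ::
    "('k::field, 'a) module \<Rightarrow> ('a \<Rightarrow> (('a \<times> 'a) \<Rightarrow>\<^sub>0 'k) set) \<Rightarrow> ('a \<Rightarrow> 'k) \<Rightarrow>
     ('a \<Rightarrow> 'k) \<Rightarrow> 'a \<Rightarrow> ('a \<Rightarrow> 'a) \<Rightarrow> bool" where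
  "bi_frobenius A \<Delta> \<epsilon> \<phi> t S \<longleftrightarrow>
     fin_dim_algebra A \<and> coalgebra A \<Delta> \<epsilon> \<and>
     (\<forall>a\<in>carrier A. S a = tensor_lift A (\<lambda>t1 t2. \<phi> (t1 \<otimes>\<^bsub>A\<^esub> a) \<odot>\<^bsub>A\<^esub> t2) (\<Delta> t)) \<and>
     \<epsilon> \<in> Ring.ring_hom A class_ring \<and> \<Delta> \<one>\<^bsub>A\<^esub> = pure_tensor A A \<one>\<^bsub>A\<^esub> \<one>\<^bsub>A\<^esub> \<and>
     frobenius_algebra A \<phi> \<and> frobenius_coalgebra A \<Delta> t \<and>
     S \<one>\<^bsub>A\<^esub> = \<one>\<^bsub>A\<^esub> \<and>
     (\<forall>a\<in>carrier A. \<forall>b\<in>carrier A. S (a \<otimes>\<^bsub>A\<^esub> b) = S b \<otimes>\<^bsub>A\<^esub> S a) \<and>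
     (\<forall>a\<in>carrier A. \<epsilon> (S a) = \<epsilon> a) \<and>
     (\<forall>a\<in>carrier A.
        \<Delta> (S a) = tensor_lift (tensor A A) (\<lambda>a1 a2. pure_tensor A A (S a2) (S a1)) (\<Delta> a))"


section \<open>Quantum complete intersections\<close>

text \<open>
  Words under concatenation, written additively so that the finitely supported functions on them
  carry the convolution product of \<^theory>\<open>HOL-Library.Poly_Mapping\<close>.
\<close>

datatype 'i free_word = FWord (letters: "'i list")

instantiation free_word :: (type) monoid_add
begin

definition zero_free_word :: "'a free_word" where
  "zero_free_word = FWord []"

definition plus_free_word :: "'a free_word \<Rightarrow> 'a free_word \<Rightarrow> 'a free_word" where
  "plus_free_word u v = FWord (letters u @ letters v)"

instance
  by standard (simp_all add: zero_free_word_def plus_free_word_def)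

end

definition free_algebra :: "nat \<Rightarrow> ('k::field, nat free_word \<Rightarrow>\<^sub>0 'k) module" where
  "free_algebra n =
    \<lparr>carrier = {p. \<forall>w\<in>Poly_Mapping.keys p. set (letters w) \<subseteq> {1..n}},
     mult = (*), one = 1, zero = 0, add = (+),
     smult = (\<lambda>c. Poly_Mapping.map ((*) c))\<rparr>"

definition free_gen :: "nat \<Rightarrow> (nat free_word \<Rightarrow>\<^sub>0 'k::field)" where
  "free_gen i = Poly_Mapping.single (FWord [i]) 1"

definition qci_relators ::
    "nat \<Rightarrow> (nat \<Rightarrow> nat \<Rightarrow> 'k::field) \<Rightarrow> (nat \<Rightarrow> nat) \<Rightarrow> (nat free_word \<Rightarrow>\<^sub>0 'k) set" where
  "qci_relators n q a =
     {free_gen i ^ a i | i. i \<in> {1..n}}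
   \<union> {free_gen j * free_gen i - Poly_Mapping.map ((*) (q i j)) (free_gen i * free_gen j) | i j.
        i \<in> {1..n} \<and> j \<in> {1..n}}"

definition qci_ideal ::
    "nat \<Rightarrow> (nat \<Rightarrow> nat \<Rightarrow> 'k::field) \<Rightarrow> (nat \<Rightarrow> nat) \<Rightarrow> (nat free_word \<Rightarrow>\<^sub>0 'k) set" where
  "qci_ideal n q a = Idl\<^bsub>free_algebra n\<^esub> (qci_relators n q a)"

definition qci ::
    "nat \<Rightarrow> (nat \<Rightarrow> nat \<Rightarrow> 'k::field) \<Rightarrow> (nat \<Rightarrow> nat) \<Rightarrow>
     ('k, (nat free_word \<Rightarrow>\<^sub>0 'k) set) module" where
  "qci n q a = quot_space (free_algebra n) (qci_ideal n q a)"

definition qci_gen ::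
    "nat \<Rightarrow> (nat \<Rightarrow> nat \<Rightarrow> 'k::field) \<Rightarrow> (nat \<Rightarrow> nat) \<Rightarrow> nat \<Rightarrow> (nat free_word \<Rightarrow>\<^sub>0 'k) set" where
  "qci_gen n q a i = qci_ideal n q a +>\<^bsub>free_algebra n\<^esub> free_gen i"

text \<open>Exponent vectors are functions on \<^typ>\<open>nat\<close> vanishing outside the index set \<open>{1..n}\<close>.\<close>

definition exponents :: "nat \<Rightarrow> (nat \<Rightarrow> nat) \<Rightarrow> (nat \<Rightarrow> nat) set" where
  "exponents n a =
     {v. (\<forall>i\<in>{1..n}. v i \<le> a i - 1) \<and> (\<forall>i. i \<notin> {1..n} \<longrightarrow> v i = 0)}"

definition top_exponent :: "nat \<Rightarrow> (nat \<Rightarrow> nat) \<Rightarrow> nat \<Rightarrow> nat" where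
  "top_exponent n a = (\<lambda>i. if i \<in> {1..n} then a i - 1 else 0)"

definition unit_exponent :: "nat \<Rightarrow> nat \<Rightarrow> nat" where
  "unit_exponent i = (\<lambda>j. if j = i then 1 else 0)"

definition qci_mon ::
    "nat \<Rightarrow> (nat \<Rightarrow> nat \<Rightarrow> 'k::field) \<Rightarrow> (nat \<Rightarrow> nat) \<Rightarrow> (nat \<Rightarrow> nat) \<Rightarrow>
     (nat free_word \<Rightarrow>\<^sub>0 'k) set" where
  "qci_mon n q a v =
     foldr (\<lambda>i y. (qci_gen n q a i [^]\<^bsub>qci n q a\<^esub> v i) \<otimes>\<^bsub>qci n q a\<^esub> y) [1..<Suc n]
       \<one>\<^bsub>qci n q a\<^esub>"

text \<open>
  The dual basis of the standard basis.  Linear forms are functions on the whole type, so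
  \<^const>\<open>extensional\<close> pins down the irrelevant values outside the carrier.
\<close>

definition qci_dual ::
    "nat \<Rightarrow> (nat \<Rightarrow> nat \<Rightarrow> 'k::field) \<Rightarrow> (nat \<Rightarrow> nat) \<Rightarrow> (nat \<Rightarrow> nat) \<Rightarrow>
     (nat free_word \<Rightarrow>\<^sub>0 'k) set \<Rightarrow> 'k" where
  "qci_dual n q a v =
     (THE f. f \<in> dual_space (qci n q a) \<and> f \<in> extensional (carrier (qci n q a)) \<and>
        (\<forall>u\<in>exponents n a. f (qci_mon n q a u) = (if u = v then 1 else 0)))"

text \<open>The linear map into \<open>U\<close> with prescribed values \<open>f v\<close> on the standard basis.\<close>

definition qci_extend ::
    "nat \<Rightarrow> (nat \<Rightarrow> nat \<Rightarrow> 'k::field) \<Rightarrow> (nat \<Rightarrow> nat) \<Rightarrow> ('k, 'u) module \<Rightarrow>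
     ((nat \<Rightarrow> nat) \<Rightarrow> 'u) \<Rightarrow> (nat free_word \<Rightarrow>\<^sub>0 'k) set \<Rightarrow> 'u" where
  "qci_extend n q a U f x =
     (\<Oplus>\<^bsub>U\<^esub> v \<in> exponents n a. qci_dual n q a v x \<odot>\<^bsub>U\<^esub> f v)"

definition permutation_antipode ::
    "nat \<Rightarrow> (nat \<Rightarrow> nat \<Rightarrow> 'k::field) \<Rightarrow> (nat \<Rightarrow> nat) \<Rightarrow>
     ((nat free_word \<Rightarrow>\<^sub>0 'k) set \<Rightarrow> (nat free_word \<Rightarrow>\<^sub>0 'k) set) \<Rightarrow> bool" where
  "permutation_antipode n q a S \<longleftrightarrow>
     (\<exists>p c. bij_betw p (exponents n a) (exponents n a) \<and>
        (\<forall>v\<in>exponents n a. S (qci_mon n q a v) = c v \<odot>\<^bsub>qci n q a\<^esub> qci_mon n q a (p v)))"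


section \<open>Structure coefficients\<close>

text \<open>
  \<open>q_form n q u v\<close> is \<open>\<Prod>\<^sub>i\<^sub><\<^sub>j q\<^sub>i\<^sub>j^(u\<^sub>j v\<^sub>i)\<close>, so that \<open>x\<^sub>u x\<^sub>v = q_form n q u v x\<^sub>u\<^sub>+\<^sub>v\<close>.  It is only
  needed for vectors of natural numbers: in every difference \<open>top_exponent n a - v\<close> below, \<open>v\<close>
  is bounded by \<open>top_exponent n a\<close>, so the pointwise subtraction does not truncate.
\<close>

definition q_form ::
    "nat \<Rightarrow> (nat \<Rightarrow> nat \<Rightarrow> 'k::field) \<Rightarrow> (nat \<Rightarrow> nat) \<Rightarrow> (nat \<Rightarrow> nat) \<Rightarrow> 'k" where
  "q_form n q u v = (\<Prod>j = 1..n. \<Prod>i = 1..<j. q i j ^ (u j * v i))"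

definition h_coeff ::
    "nat \<Rightarrow> (nat \<Rightarrow> nat \<Rightarrow> 'k::field) \<Rightarrow> (nat \<Rightarrow> nat) \<Rightarrow> (nat \<Rightarrow> nat) \<Rightarrow> 'k" where
  "h_coeff n q a v =
     q_form n q (top_exponent n a - v) v / q_form n q v (top_exponent n a - v)"

definition perm_exponent :: "(nat \<Rightarrow> nat) \<Rightarrow> (nat \<Rightarrow> nat) \<Rightarrow> nat \<Rightarrow> nat" where
  "perm_exponent \<pi> v = (\<lambda>i. v (inv_into UNIV \<pi> i))"

definition compatible ::
    "nat \<Rightarrow> (nat \<Rightarrow> nat \<Rightarrow> 'k::field) \<Rightarrow> (nat \<Rightarrow> nat) \<Rightarrow> (nat \<Rightarrow> nat) \<Rightarrow> bool" where
  "compatible n q a \<pi> \<longleftrightarrow>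
     \<pi> permutes {1..n} \<and> (\<forall>i\<in>{1..n}. a (\<pi> i) = a i) \<and>
     (\<forall>i\<in>{1..n}. \<forall>j\<in>{1..n}. q (\<pi> i) (\<pi> j) = q j i)"

definition q_perm ::
    "nat \<Rightarrow> (nat \<Rightarrow> nat \<Rightarrow> 'k::field) \<Rightarrow> (nat \<Rightarrow> nat) \<Rightarrow> (nat \<Rightarrow> nat) \<Rightarrow> 'k" where
  "q_perm n q a \<pi> =
     (\<Prod>k = 1..n. \<Prod>j = 1..<k.
        q_form n q (perm_exponent \<pi> (unit_exponent k)) (perm_exponent \<pi> (unit_exponent j))
          ^ ((a k - 1) * (a j - 1)))"

definition S_coeff ::
    "nat \<Rightarrow> (nat \<Rightarrow> nat \<Rightarrow> 'k::field) \<Rightarrow> (nat \<Rightarrow> nat) \<Rightarrow> (nat \<Rightarrow> 'k) \<Rightarrow> (nat \<Rightarrow> nat) \<Rightarrow> 'k" where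
  "S_coeff n q \<pi> c v =
     (\<Prod>i = 1..n. c i ^ v i) *
     (\<Prod>k = 1..n. \<Prod>j = 1..<k.
        q_form n q (perm_exponent \<pi> (unit_exponent k)) (perm_exponent \<pi> (unit_exponent j))
          ^ (v j * v k))"

definition g_coeff ::
    "nat \<Rightarrow> (nat \<Rightarrow> nat \<Rightarrow> 'k::field) \<Rightarrow> (nat \<Rightarrow> nat) \<Rightarrow> (nat \<Rightarrow> nat) \<Rightarrow> (nat \<Rightarrow> 'k) \<Rightarrow>
     (nat \<Rightarrow> nat) \<Rightarrow> 'k" where
  "g_coeff n q a \<pi> c v = 1 / q_form n q (top_exponent n a - v) v * S_coeff n q \<pi> c v"


section \<open>The bi-Frobenius structure attached to a permutation and scalars\<close>

definition qci_counit ::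
    "nat \<Rightarrow> (nat \<Rightarrow> nat \<Rightarrow> 'k::field) \<Rightarrow> (nat \<Rightarrow> nat) \<Rightarrow> (nat free_word \<Rightarrow>\<^sub>0 'k) set \<Rightarrow> 'k" where
  "qci_counit n q a =
     qci_extend n q a scalar_module (\<lambda>v. if v = (\<lambda>_. 0) then 1 else 0)"

definition qci_comult ::
    "nat \<Rightarrow> (nat \<Rightarrow> nat \<Rightarrow> 'k::field) \<Rightarrow> (nat \<Rightarrow> nat) \<Rightarrow> (nat \<Rightarrow> nat) \<Rightarrow> (nat \<Rightarrow> 'k) \<Rightarrow>
     (nat free_word \<Rightarrow>\<^sub>0 'k) set \<Rightarrow>
     (((nat free_word \<Rightarrow>\<^sub>0 'k) set \<times> (nat free_word \<Rightarrow>\<^sub>0 'k) set) \<Rightarrow>\<^sub>0 'k) set" where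
  "qci_comult n q a \<pi> c =
     (let A = qci n q a; x = qci_mon n q a; T = tensor A A in
      qci_extend n q a T
        (\<lambda>v. if v = (\<lambda>_. 0) then pure_tensor A A \<one>\<^bsub>A\<^esub> \<one>\<^bsub>A\<^esub>
             else if v = top_exponent n a then
               (\<Oplus>\<^bsub>T\<^esub> u \<in> exponents n a. g_coeff n q a \<pi> c u \<odot>\<^bsub>T\<^esub>
                  pure_tensor A A (x (top_exponent n a - u)) (x (perm_exponent \<pi> u)))
             else pure_tensor A A \<one>\<^bsub>A\<^esub> (x v) \<oplus>\<^bsub>T\<^esub> pure_tensor A A (x v) \<one>\<^bsub>A\<^esub>))"

definition qci_antipode ::
    "nat \<Rightarrow> (nat \<Rightarrow> nat \<Rightarrow> 'k::field) \<Rightarrow> (nat \<Rightarrow> nat) \<Rightarrow> (nat \<Rightarrow> nat) \<Rightarrow> (nat \<Rightarrow> 'k) \<Rightarrow>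
     (nat free_word \<Rightarrow>\<^sub>0 'k) set \<Rightarrow> (nat free_word \<Rightarrow>\<^sub>0 'k) set" where
  "qci_antipode n q a \<pi> c =
     qci_extend n q a (qci n q a)
       (\<lambda>v. S_coeff n q \<pi> c v \<odot>\<^bsub>qci n q a\<^esub> qci_mon n q a (perm_exponent \<pi> v))"

end

theory Submission
  imports Defs
begin

text \<open>
  Write \<open>\<tau>\<close> for the exponent of the top monomial.  Two monomials multiply to \<open>x\<^sub>\<tau>\<close>, up to a nonzero
  scalar, exactly if their exponents are complementary in \<open>\<tau>\<close>.  Hence \<open>\<phi> = x\<^sub>\<tau>\<^sup>*\<close> is a Frobenius
  form, and \<open>h\<^sub>v\<close> compares the two orders in which \<open>x\<^sub>v\<close> and its complement can be multiplied.

  \<^bold>\<open>From scalars to a structure.\<close>  For a compatible \<open>\<pi>\<close> the rule \<open>x\<^sub>i \<mapsto> c\<^sub>i x\<^sub>\<pi>\<^sub>i\<close> respects the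
  defining relations with the order of factors reversed, so it extends to an anti-homomorphism \<open>S\<close>
  (\<open>S_coeff_add\<close>).  The coefficients \<open>g\<close> are chosen such that \<open>S a = \<Sum> \<phi> (t\<^sub>1 a) t\<^sub>2\<close> for \<open>t = x\<^sub>\<tau>\<close>.  The
  condition \<open>q\<^sub>\<pi> \<Prod> c\<^sub>i\<^bsup>a\<^sub>i-1\<^esup> = 1\<close> says \<open>S x\<^sub>\<tau> = x\<^sub>\<tau>\<close>; it makes \<open>x\<^sub>\<tau> \<otimes> 1\<close> and \<open>1 \<otimes> x\<^sub>\<tau>\<close> occur in \<open>\<Delta> x\<^sub>\<tau>\<close> with
  coefficient \<open>1\<close>, and as the remaining monomials are primitive, \<open>\<Delta>\<close> is coassociative and counital.
  The conditions \<open>c\<^sub>i c\<^sub>\<pi>\<^sub>i = h\<^sub>i\<close> propagate to \<open>S\<^sup>2 x\<^sub>v = h\<^sub>v x\<^sub>v\<close> for all \<open>v\<close> (\<open>s_s_act\<close>), which is what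
  compatibility of \<open>\<Delta>\<close> with \<open>S\<close> amounts to at \<open>x\<^sub>\<tau>\<close>.

  \<^bold>\<open>From a structure to scalars.\<close>  Let \<open>S x\<^sub>v = k\<^sub>v x\<^bsub>p v\<^esub>\<close> be the antipode of any bi-Frobenius structure.
  The Frobenius conditions make \<open>S\<close> bijective (\<open>S_surjective\<close>), so all \<open>k\<^sub>v\<close> are nonzero.  Comparing
  \<open>S (x\<^sub>u x\<^sub>v)\<close> with \<open>S x\<^sub>v S x\<^sub>u\<close> shows that \<open>p\<close> is additive.  Unit vectors are the indecomposable
  exponents, so \<open>p\<close> is induced by a permutation \<open>\<pi>\<close> of the generators, and the relations make \<open>\<pi>\<close>
  compatible.  Next, \<open>\<epsilon> \<circ> S = \<epsilon>\<close> gives \<open>\<phi> (t a) = \<epsilon> a\<close>, so \<open>t\<close> is killed by the generators and is a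
  multiple of \<open>x\<^sub>\<tau>\<close>.  Finally \<open>\<Delta> (S t) = \<Sum> S t\<^sub>2 \<otimes> S t\<^sub>1\<close> yields \<open>k\<^sub>\<tau> \<phi> (y z) = \<phi> (S\<^sup>2 z y)\<close>
  (\<open>nakayama\<close>).  With \<open>y = 1\<close>, \<open>z = t\<close> this gives \<open>k\<^sub>\<tau> = 1\<close>, the product condition; with \<open>z = x\<^sub>i\<close> and \<open>y\<close>
  its complement it gives \<open>\<pi>\<^sup>2 = id\<close> and \<open>c\<^sub>i c\<^sub>\<pi>\<^sub>i = h\<^sub>i\<close>.

  The first sections provide the linear algebra.  A finite-dimensional space is handled through a
  basis with coordinate functionals; quotients, tensor products and the algebra itself are all
  presented in this way.  For the algebra, the coordinate of a word is the scalar picked up when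
  sorting it, which is compatible with the relations.
\<close>


section \<open>Linear maps and coordinates\<close>

abbreviation linear_maps :: "('k::field, 'v) module \<Rightarrow> ('k, 'u) module \<Rightarrow> ('v \<Rightarrow> 'u) set" where
  "linear_maps V U \<equiv> LinearCombinations.module_hom class_ring V U"

lemma vectorspaceI:
  "Module.module class_ring V \<Longrightarrow> vectorspace (class_ring :: 'k::field ring) V"
  by (simp add: vectorspace_def class_field)

lemma linear_mapsI:
  assumes "\<And>x. x \<in> carrier V \<Longrightarrow> f x \<in> carrier U"
    and "\<And>x y. x \<in> carrier V \<Longrightarrow> y \<in> carrier V \<Longrightarrow> f (x \<oplus>\<^bsub>V\<^esub> y) = f x \<oplus>\<^bsub>U\<^esub> f y"
    and "\<And>c x. x \<in> carrier V \<Longrightarrow> f (c \<odot>\<^bsub>V\<^esub> x) = c \<odot>\<^bsub>U\<^esub> f x"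
  shows "f \<in> linear_maps V U"
  using assms by (auto simp: LinearCombinations.module_hom_def)

lemma
  assumes "f \<in> linear_maps V U"
  shows linear_maps_closed: "\<And>x. x \<in> carrier V \<Longrightarrow> f x \<in> carrier U"
    and linear_maps_add: "\<And>x y. x \<in> carrier V \<Longrightarrow> y \<in> carrier V \<Longrightarrow> f (x \<oplus>\<^bsub>V\<^esub> y) = f x \<oplus>\<^bsub>U\<^esub> f y"
    and linear_maps_smult: "\<And>c x. x \<in> carrier V \<Longrightarrow> f (c \<odot>\<^bsub>V\<^esub> x) = c \<odot>\<^bsub>U\<^esub> f x"
  using assms by (auto simp: LinearCombinations.module_hom_def)

lemma linear_maps_comp:
  "f \<in> linear_maps V U \<Longrightarrow> g \<in> linear_maps U W \<Longrightarrow> (\<lambda>x. g (f x)) \<in> linear_maps V W"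
  by (rule linear_mapsI) (metis linear_maps_closed linear_maps_add linear_maps_smult)+

lemma vectorspace_scalar_module: "vectorspace class_ring (scalar_module :: ('k::field, 'k) module)"
proof (rule vectorspaceI, rule module_criteria)
  show "cring (class_ring :: 'k ring)" by (rule class_cring.is_cring)
  show "\<forall>v\<in>carrier (scalar_module :: ('k, 'k) module). \<exists>w\<in>carrier scalar_module.
          v \<oplus>\<^bsub>scalar_module\<^esub> w = \<zero>\<^bsub>scalar_module\<^esub>"
    by (auto simp: scalar_module_def intro: exI[of _ "- _"])
qed (auto simp: scalar_module_def algebra_simps)

lemma smult_scalar_module: "c \<odot>\<^bsub>scalar_module\<^esub> x = c * x"
  by (simp add: scalar_module_def)

lemma dual_spaceI:
  assumes "\<And>x y. x \<in> carrier V \<Longrightarrow> y \<in> carrier V \<Longrightarrow> f (x \<oplus>\<^bsub>V\<^esub> y) = f x + f y"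
    and "\<And>c x. x \<in> carrier V \<Longrightarrow> f (c \<odot>\<^bsub>V\<^esub> x) = c * f x"
  shows "f \<in> dual_space V"
  unfolding dual_space_def using assms by (intro linear_mapsI) (auto simp: scalar_module_def)

lemma
  assumes "f \<in> dual_space V"
  shows dual_add: "\<And>x y. x \<in> carrier V \<Longrightarrow> y \<in> carrier V \<Longrightarrow> f (x \<oplus>\<^bsub>V\<^esub> y) = f x + f y"
    and dual_smult: "\<And>c x. x \<in> carrier V \<Longrightarrow> f (c \<odot>\<^bsub>V\<^esub> x) = c * f x"
  using assms[unfolded dual_space_def]
  by (auto simp: linear_maps_add linear_maps_smult scalar_module_def)

lemma dual_scale: "f \<in> dual_space V \<Longrightarrow> (\<lambda>x. c * f x) \<in> dual_space V"
  by (rule dual_spaceI) (simp_all add: dual_add dual_smult algebra_simps)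

lemma dual_comp:
  "f \<in> linear_maps V U \<Longrightarrow> g \<in> dual_space U \<Longrightarrow> (\<lambda>x. g (f x)) \<in> dual_space V"
  unfolding dual_space_def by (rule linear_maps_comp)

lemma finsum_scalar_module: "finsum scalar_module f A = sum f A"
proof -
  interpret vectorspace class_ring "scalar_module :: ('a, 'a) module"
    by (rule vectorspace_scalar_module)
  show ?thesis
  proof (induction A rule: infinite_finite_induct)
    case (insert x A)
    then have "finsum scalar_module f (insert x A) = f x \<oplus>\<^bsub>scalar_module\<^esub> finsum scalar_module f A"
      by (subst M.finsum_insert) (auto simp: scalar_module_def)
    then show ?case using insert by (simp add: scalar_module_def)
  qed (auto simp: M.finsum_infinite scalar_module_def finsum_def finprod_def)
qed

text \<open>
  Most identities below are proved by applying linear functionals, which turn the sums of a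
  module into sums of scalars.
\<close>

context
  fixes V :: "('k::field, 'v) module"
  assumes V: "vectorspace class_ring V"
begin

interpretation V: vectorspace class_ring V by (rule V)

lemma vs_add_closed: "x \<in> carrier V \<Longrightarrow> y \<in> carrier V \<Longrightarrow> x \<oplus>\<^bsub>V\<^esub> y \<in> carrier V"
  by simp

lemma vs_smult_closed: "x \<in> carrier V \<Longrightarrow> c \<odot>\<^bsub>V\<^esub> x \<in> carrier V"
  by simp

lemma vs_smult_one: "x \<in> carrier V \<Longrightarrow> 1 \<odot>\<^bsub>V\<^esub> x = x"
  using V.smult_one[of x] by simp

lemma vs_smult_zero: "x \<in> carrier V \<Longrightarrow> 0 \<odot>\<^bsub>V\<^esub> x = \<zero>\<^bsub>V\<^esub>"
  using V.lmult_0[of x] by simp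

lemma vs_zero_closed: "\<zero>\<^bsub>V\<^esub> \<in> carrier V"
  by simp

lemma vs_finsum_closed: "(\<And>i. i \<in> A \<Longrightarrow> f i \<in> carrier V) \<Longrightarrow> finsum V f A \<in> carrier V"
  by (rule V.finsum_closed) auto

lemma vs_minus: "x \<in> carrier V \<Longrightarrow> y \<in> carrier V \<Longrightarrow> x \<ominus>\<^bsub>V\<^esub> y = x \<oplus>\<^bsub>V\<^esub> (- 1) \<odot>\<^bsub>V\<^esub> y"
  using V.smult_minus_1[of y] by (simp add: a_minus_def class_ring_simps)

lemma vs_minus_zero: "x \<in> carrier V \<Longrightarrow> x \<ominus>\<^bsub>V\<^esub> \<zero>\<^bsub>V\<^esub> = x"
  by (simp add: a_minus_def V.minus_equality[of "\<zero>\<^bsub>V\<^esub>" "\<zero>\<^bsub>V\<^esub>"])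

lemma linear_maps_zero:
  assumes U: "vectorspace class_ring U" and f: "f \<in> linear_maps V U"
  shows "f \<zero>\<^bsub>V\<^esub> = \<zero>\<^bsub>U\<^esub>"
proof -
  interpret U: vectorspace class_ring U by (rule U)
  interpret mod_hom class_ring V U f by unfold_locales (rule f)
  show ?thesis by simp
qed

lemma linear_maps_finsum:
  assumes U: "vectorspace class_ring U" and f: "f \<in> linear_maps V U"
    and g: "\<And>i. i \<in> A \<Longrightarrow> g i \<in> carrier V"
  shows "f (finsum V g A) = finsum U (\<lambda>i. f (g i)) A"
proof -
  interpret U: vectorspace class_ring U by (rule U)
  interpret mod_hom class_ring V U f by unfold_locales (rule f)
  show ?thesis using g
  proof (induction A rule: infinite_finite_induct)
    case (insert i A)
    then show ?case
      by (subst V.finsum_insert) (auto simp: U.finsum_insert Pi_def intro!: V.finsum_closed)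
  qed (auto simp: V.finsum_infinite U.finsum_infinite)
qed

lemma dual_zero: "f \<in> dual_space V \<Longrightarrow> f \<zero>\<^bsub>V\<^esub> = 0"
  using linear_maps_zero[OF vectorspace_scalar_module] by (simp add: dual_space_def scalar_module_def)

lemma dual_minus:
  "f \<in> dual_space V \<Longrightarrow> x \<in> carrier V \<Longrightarrow> y \<in> carrier V \<Longrightarrow> f (x \<ominus>\<^bsub>V\<^esub> y) = f x - f y"
  by (simp add: vs_minus dual_add dual_smult)

lemma dual_finsum:
  "f \<in> dual_space V \<Longrightarrow> (\<And>i. i \<in> A \<Longrightarrow> g i \<in> carrier V) \<Longrightarrow>
     f (finsum V g A) = (\<Sum>i\<in>A. f (g i))"
  unfolding finsum_scalar_module[symmetric] dual_space_def
  by (rule linear_maps_finsum[OF vectorspace_scalar_module])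

end

lemma finsum_functionals_linear:
  assumes U: "vectorspace class_ring U" and c: "\<And>i. i \<in> I \<Longrightarrow> c i \<in> carrier U"
    and co_dual: "\<And>i. i \<in> I \<Longrightarrow> co i \<in> dual_space V"
  shows "(\<lambda>x. finsum U (\<lambda>i. co i x \<odot>\<^bsub>U\<^esub> c i) I) \<in> linear_maps V U" (is "?f \<in> _")
proof -
  interpret U: vectorspace class_ring U by fact
  show "?f \<in> linear_maps V U"
  proof (rule linear_mapsI)
    show "?f x \<in> carrier U" for x
      by (rule vs_finsum_closed[OF U]) (simp add: c)
    show "?f (x \<oplus>\<^bsub>V\<^esub> y) = ?f x \<oplus>\<^bsub>U\<^esub> ?f y" if "x \<in> carrier V" "y \<in> carrier V" for x y
    proof -
      have "?f (x \<oplus>\<^bsub>V\<^esub> y) = finsum U (\<lambda>i. co i x \<odot>\<^bsub>U\<^esub> c i \<oplus>\<^bsub>U\<^esub> co i y \<odot>\<^bsub>U\<^esub> c i) I"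
        using U.smult_l_distr
        by (intro U.finsum_cong2) (auto simp: that c co_dual dual_add)
      then show ?thesis by (simp add: U.finsum_addf c Pi_def)
    qed
    show "?f (d \<odot>\<^bsub>V\<^esub> x) = d \<odot>\<^bsub>U\<^esub> ?f x" if "x \<in> carrier V" for d x
    proof -
      have "?f (d \<odot>\<^bsub>V\<^esub> x) = finsum U (\<lambda>i. d \<odot>\<^bsub>U\<^esub> (co i x \<odot>\<^bsub>U\<^esub> c i)) I"
        using U.smult_assoc1
        by (intro U.finsum_cong2) (auto simp: that c co_dual dual_smult)
      then show ?thesis by (simp add: U.finsum_smult c Pi_def)
    qed
  qed
qed

text \<open>
  A finite basis \<open>e\<close> given together with its coordinate functionals \<open>co\<close>.  Instead of asking that
  \<open>e\<close> spans, the last axiom asks that the coordinates separate points: this is the property that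
  can be checked directly on a quotient, and it is also how equations are proved.
\<close>

locale based_space =
  fixes V :: "('k::field, 'v) module" and I :: "'i set" and e :: "'i \<Rightarrow> 'v" and co :: "'i \<Rightarrow> 'v \<Rightarrow> 'k"
  assumes vs: "vectorspace class_ring V"
    and finite_index: "finite I"
    and basis_closed: "\<And>i. i \<in> I \<Longrightarrow> e i \<in> carrier V"
    and co_dual: "\<And>i. i \<in> I \<Longrightarrow> co i \<in> dual_space V"
    and co_basis: "\<And>i j. i \<in> I \<Longrightarrow> j \<in> I \<Longrightarrow> co i (e j) = (if i = j then 1 else 0)"
    and separate: "\<And>x. x \<in> carrier V \<Longrightarrow> (\<And>i. i \<in> I \<Longrightarrow> co i x = 0) \<Longrightarrow> x = \<zero>\<^bsub>V\<^esub>"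
begin

sublocale V: vectorspace class_ring V by (rule vs)

lemma coords_eqI:
  assumes "x \<in> carrier V" "y \<in> carrier V" "\<And>i. i \<in> I \<Longrightarrow> co i x = co i y"
  shows "x = y"
proof -
  have "x \<ominus>\<^bsub>V\<^esub> y = \<zero>\<^bsub>V\<^esub>"
    using assms by (intro separate) (auto simp: dual_minus[OF vs] co_dual)
  moreover have "x = (x \<ominus>\<^bsub>V\<^esub> y) \<oplus>\<^bsub>V\<^esub> y"
    using assms by (simp add: a_minus_def V.a_assoc V.l_neg)
  ultimately show ?thesis using assms by simp
qed

lemma functionals_eqI:
  assumes "x \<in> carrier V" "y \<in> carrier V" "\<And>f. f \<in> dual_space V \<Longrightarrow> f x = f y"
  shows "x = y"
  using assms by (intro coords_eqI) (auto simp: co_dual)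

definition comb :: "('i \<Rightarrow> 'k) \<Rightarrow> 'v" where
  "comb c = finsum V (\<lambda>i. c i \<odot>\<^bsub>V\<^esub> e i) I"

lemma comb_closed: "comb c \<in> carrier V"
  unfolding comb_def by (rule vs_finsum_closed[OF vs]) (simp add: basis_closed)

lemma dual_comb: "f \<in> dual_space V \<Longrightarrow> f (comb c) = (\<Sum>i\<in>I. c i * f (e i))"
  unfolding comb_def by (subst dual_finsum[OF vs]) (auto simp: basis_closed dual_smult)

lemma co_comb: "i \<in> I \<Longrightarrow> co i (comb c) = c i"
  by (simp add: dual_comb co_dual co_basis if_distrib finite_index cong: if_cong)

lemma comb_co: "x \<in> carrier V \<Longrightarrow> comb (\<lambda>i. co i x) = x"
  by (rule coords_eqI) (auto simp: comb_closed co_comb)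

lemma dual_expand: "f \<in> dual_space V \<Longrightarrow> x \<in> carrier V \<Longrightarrow> f x = (\<Sum>i\<in>I. co i x * f (e i))"
  using dual_comb[of f "\<lambda>i. co i x"] by (simp add: comb_co)

lemma dual_eqI:
  "f \<in> dual_space V \<Longrightarrow> g \<in> dual_space V \<Longrightarrow> (\<And>i. i \<in> I \<Longrightarrow> f (e i) = g (e i)) \<Longrightarrow>
     x \<in> carrier V \<Longrightarrow> f x = g x"
  using dual_expand[of f x] dual_expand[of g x] by simp

lemma linear_maps_expand:
  assumes "vectorspace class_ring U" "f \<in> linear_maps V U" "x \<in> carrier V"
  shows "f x = finsum U (\<lambda>i. co i x \<odot>\<^bsub>U\<^esub> f (e i)) I"
proof -
  interpret U: vectorspace class_ring U by fact
  have "f x = f (comb (\<lambda>i. co i x))" by (simp add: comb_co assms)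
  also have "\<dots> = finsum U (\<lambda>i. f (co i x \<odot>\<^bsub>V\<^esub> e i)) I"
    unfolding comb_def by (rule linear_maps_finsum[OF vs assms(1,2)]) (simp add: basis_closed)
  also have "\<dots> = finsum U (\<lambda>i. co i x \<odot>\<^bsub>U\<^esub> f (e i)) I"
    using assms by (intro U.finsum_cong2)
      (auto simp: basis_closed linear_maps_smult linear_maps_closed[OF assms(2)])
  finally show ?thesis .
qed

lemma linear_maps_eqI:
  assumes "vectorspace class_ring U" "f \<in> linear_maps V U" "g \<in> linear_maps V U"
    "\<And>i. i \<in> I \<Longrightarrow> f (e i) = g (e i)" "x \<in> carrier V"
  shows "f x = g x"
proof -
  interpret U: vectorspace class_ring U by fact
  show ?thesis
    unfolding linear_maps_expand[OF assms(1,2,5)] linear_maps_expand[OF assms(1,3,5)]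
    by (intro U.finsum_cong2) (auto simp: assms basis_closed linear_maps_closed[OF assms(3)])
qed

lemma dual_of_values: "(\<lambda>x. \<Sum>i\<in>I. co i x * c i) \<in> dual_space V"
  by (rule dual_spaceI)
    (auto simp: co_dual dual_add dual_smult algebra_simps sum.distrib sum_distrib_left)

lemma dual_of_values_basis: "j \<in> I \<Longrightarrow> (\<Sum>i\<in>I. co i (e j) * c i) = c j"
  by (simp add: co_basis finite_index if_distrib[of "\<lambda>x. x * _"] cong: if_cong)

lemma linear_map_of_values:
  assumes U: "vectorspace class_ring U" and c: "\<And>i. i \<in> I \<Longrightarrow> c i \<in> carrier U"
  shows "(\<lambda>x. finsum U (\<lambda>i. co i x \<odot>\<^bsub>U\<^esub> c i) I) \<in> linear_maps V U"
    and "\<And>j. j \<in> I \<Longrightarrow> finsum U (\<lambda>i. co i (e j) \<odot>\<^bsub>U\<^esub> c i) I = c j"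
proof -
  interpret U: vectorspace class_ring U by fact
  show "(\<lambda>x. finsum U (\<lambda>i. co i x \<odot>\<^bsub>U\<^esub> c i) I) \<in> linear_maps V U"
    by (rule finsum_functionals_linear[OF U]) (auto simp: co_dual c)
  show "finsum U (\<lambda>i. co i (e j) \<odot>\<^bsub>U\<^esub> c i) I = c j" if j: "j \<in> I" for j
  proof -
    have "finsum U (\<lambda>i. co i (e j) \<odot>\<^bsub>U\<^esub> c i) I = finsum U (\<lambda>i. if j = i then c i else \<zero>\<^bsub>U\<^esub>) I"
      using j by (intro U.finsum_cong2) (auto simp: co_basis c vs_smult_one[OF U] vs_smult_zero[OF U])
    then show ?thesis using j by (simp add: U.add.finprod_singleton finite_index c)
  qed
qed

lemma fin_dim: "vectorspace.fin_dim class_ring V"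
proof -
  have "x \<in> V.span (e ` I)" if x: "x \<in> carrier V" for x
  proof -
    have sub: "submodule class_ring (V.span (e ` I)) V"
      by (rule V.span_is_submodule) (auto simp: basis_closed)
    have mem: "e i \<in> V.span (e ` I)" if "i \<in> I" for i
      using V.in_own_span[of "e ` I"] that basis_closed by blast
    have "finsum V (\<lambda>i. co i x \<odot>\<^bsub>V\<^esub> e i) J \<in> V.span (e ` I)" if "J \<subseteq> I" for J
      using finite_subset[OF that finite_index] that
    proof (induction J rule: finite_induct)
      case empty
      then show ?case using submodule.zero_closed[OF sub] by simp
    next
      case (insert i J)
      then show ?case
        by (subst V.finsum_insert)
          (auto simp: basis_closed subset_iff Pi_def intro!: submodule.m_closed[OF sub] submodule.smult_closed[OF sub] mem)
    qed
    from this[of I] show ?thesis using comb_co[OF x] by (simp add: comb_def)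
  qed
  moreover have "V.span (e ` I) \<subseteq> carrier V"
    by (rule V.span_is_subset2) (auto simp: basis_closed)
  ultimately show ?thesis unfolding V.fin_dim_def
    by (intro exI[of _ "e ` I"]) (auto simp: finite_index basis_closed)
qed

end

section \<open>Quotients of vector spaces\<close>

locale quotient_space =
  fixes V :: "('k::field, 'v) module" and N :: "'v set"
  assumes vs: "vectorspace class_ring V"
    and sub: "submodule class_ring N V"
begin

sublocale V: vectorspace class_ring V by (rule vs)

lemma subset: "N \<subseteq> carrier V"
  using sub by (rule submodule.subset)

lemma in_carrier: "x \<in> N \<Longrightarrow> x \<in> carrier V"
  using subset by auto

sublocale N: abelian_subgroup N V
proof (rule abelian_subgroupI3)
  show "abelian_group V" by (rule V.abelian_group_axioms)
  show "additive_subgroup N V"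
  proof (rule additive_subgroup.intro, rule V.add.subgroupI)
    show "N \<noteq> {}" using submodule.zero_closed[OF sub] by auto
    show "\<ominus>\<^bsub>V\<^esub> x \<in> N" if "x \<in> N" for x
      using submodule.smult_closed[OF sub, of "-1" x] that V.smult_minus_1[of x]
      by (simp add: in_carrier class_ring_simps)
  qed (auto simp: in_carrier intro: submodule.m_closed[OF sub])
qed

definition proj :: "'v \<Rightarrow> 'v set" where
  "proj x = N +>\<^bsub>V\<^esub> x"

lemma carrier_quot: "carrier (quot_space V N) = proj ` carrier V"
  by (auto simp: quot_space_def FactRing_def A_RCOSETS_def' proj_def)

lemma mem_proj: "x \<in> carrier V \<Longrightarrow> x \<in> proj x"
  unfolding proj_def by (rule N.a_rcos_self)

lemma mem_proj_carrier: "y \<in> proj x \<Longrightarrow> x \<in> carrier V \<Longrightarrow> y \<in> carrier V"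
  unfolding proj_def using V.a_r_coset_subset_G[OF subset, of x] by auto

lemma proj_eqI: "y \<in> proj x \<Longrightarrow> x \<in> carrier V \<Longrightarrow> proj y = proj x"
  unfolding proj_def by (rule V.a_repr_independence[symmetric]) (auto intro: N.a_subgroup)

lemma proj_eq_iff:
  assumes xy: "x \<in> carrier V" "y \<in> carrier V"
  shows "proj x = proj y \<longleftrightarrow> x \<ominus>\<^bsub>V\<^esub> y \<in> N"
proof -
  have "proj x = proj y \<longleftrightarrow> x \<in> proj y"
    using xy mem_proj[of x] proj_eqI[of x y] by auto
  also have "\<dots> \<longleftrightarrow> x \<ominus>\<^bsub>V\<^esub> y \<in> N"
    unfolding proj_def a_minus_def by (rule N.a_rcos_module) (rule xy)+
  finally show ?thesis .
qed

lemma zero_quot: "\<zero>\<^bsub>quot_space V N\<^esub> = proj \<zero>\<^bsub>V\<^esub>"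
  using V.a_coset_add_zero[OF subset] by (simp add: quot_space_def FactRing_def proj_def)

lemma proj_zero_iff: "x \<in> carrier V \<Longrightarrow> proj x = \<zero>\<^bsub>quot_space V N\<^esub> \<longleftrightarrow> x \<in> N"
  by (simp add: zero_quot proj_eq_iff vs_minus_zero[OF vs])

lemma proj_add: "x \<in> carrier V \<Longrightarrow> y \<in> carrier V \<Longrightarrow>
    proj x \<oplus>\<^bsub>quot_space V N\<^esub> proj y = proj (x \<oplus>\<^bsub>V\<^esub> y)"
  by (simp add: quot_space_def FactRing_def proj_def N.a_rcos_sum)

lemma proj_smult:
  assumes "x \<in> carrier V"
  shows "c \<odot>\<^bsub>quot_space V N\<^esub> proj x = proj (c \<odot>\<^bsub>V\<^esub> x)"
proof -
  have "proj (c \<odot>\<^bsub>V\<^esub> y) = proj (c \<odot>\<^bsub>V\<^esub> x)" if "y \<in> proj x" for y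
  proof -
    have y: "y \<in> carrier V" using that assms mem_proj_carrier by blast
    have "y \<ominus>\<^bsub>V\<^esub> x \<in> N" using proj_eqI[OF that assms] proj_eq_iff[OF y assms] by simp
    then have "c \<odot>\<^bsub>V\<^esub> (y \<ominus>\<^bsub>V\<^esub> x) \<in> N" by (rule submodule.smult_closed[OF sub, rotated]) simp
    moreover have "c \<odot>\<^bsub>V\<^esub> (y \<ominus>\<^bsub>V\<^esub> x) = c \<odot>\<^bsub>V\<^esub> y \<ominus>\<^bsub>V\<^esub> c \<odot>\<^bsub>V\<^esub> x"
      using y assms V.smult_r_minus[of c x] by (simp add: a_minus_def V.smult_r_distr)
    ultimately show ?thesis using y assms by (simp add: proj_eq_iff)
  qed
  then have "(\<Union>y\<in>proj x. proj (c \<odot>\<^bsub>V\<^esub> y)) = proj (c \<odot>\<^bsub>V\<^esub> x)"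
    using mem_proj[OF assms] by blast
  then show ?thesis by (simp add: quot_space_def proj_def)
qed

lemma quot_vs: "vectorspace class_ring (quot_space V N)"
proof (rule vectorspaceI, rule module_criteria)
  show "cring (class_ring :: 'k ring)" by (rule class_cring.is_cring)
  show "\<forall>v\<in>carrier (quot_space V N). \<exists>w\<in>carrier (quot_space V N).
          v \<oplus>\<^bsub>quot_space V N\<^esub> w = \<zero>\<^bsub>quot_space V N\<^esub>"
  proof
    fix v assume "v \<in> carrier (quot_space V N)"
    then obtain x where "x \<in> carrier V" "v = proj x" by (auto simp: carrier_quot)
    then show "\<exists>w\<in>carrier (quot_space V N). v \<oplus>\<^bsub>quot_space V N\<^esub> w = \<zero>\<^bsub>quot_space V N\<^esub>"
      by (intro bexI[of _ "proj (\<ominus>\<^bsub>V\<^esub> x)"]) (auto simp: proj_add carrier_quot zero_quot V.r_neg)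
  qed
qed (use V.smult_assoc1 V.smult_l_distr in
    \<open>auto simp: carrier_quot proj_add proj_smult zero_quot V.a_ac V.smult_r_distr vs_smult_one[OF vs]\<close>)

lemma proj_linear: "proj \<in> linear_maps V (quot_space V N)"
  by (rule linear_mapsI) (auto simp: carrier_quot proj_add proj_smult)

text \<open>
  The value at a coset is read off from an arbitrarily chosen element of it, which is how
  maps out of a tensor product are given.
\<close>

lemma chosen_representative:
  assumes "x \<in> carrier V"
  shows "(SOME y. y \<in> proj x) \<in> carrier V" "(SOME y. y \<in> proj x) \<ominus>\<^bsub>V\<^esub> x \<in> N"
proof -
  have *: "(SOME y. y \<in> proj x) \<in> proj x"
    using mem_proj[OF assms] by (rule someI)
  then show c: "(SOME y. y \<in> proj x) \<in> carrier V"
    using assms mem_proj_carrier by blast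
  show "(SOME y. y \<in> proj x) \<ominus>\<^bsub>V\<^esub> x \<in> N"
    using proj_eqI[OF * assms] proj_eq_iff[OF c assms] by simp
qed

end


section \<open>Tensor products\<close>

abbreviation "single \<equiv> Poly_Mapping.single"
abbreviation "keys \<equiv> Poly_Mapping.keys"
abbreviation "lookup \<equiv> Poly_Mapping.lookup"

definition extend_linearly :: "('s \<Rightarrow> 'k::field) \<Rightarrow> ('s \<Rightarrow>\<^sub>0 'k) \<Rightarrow> 'k" where
  "extend_linearly f p = (\<Sum>z\<in>keys p. lookup p z * f z)"

lemma lookup_scale: "lookup (Poly_Mapping.map ((*) c) p) z = c * lookup p z"
  for c :: "'k::field"
  by (simp add: Poly_Mapping.map.rep_eq when_def)

lemma keys_scale: "keys (Poly_Mapping.map ((*) c) p) \<subseteq> keys p"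
  for c :: "'k::field"
  by (auto simp: in_keys_iff lookup_scale)

lemma extend_linearly_superset:
  "finite S \<Longrightarrow> keys p \<subseteq> S \<Longrightarrow>
     extend_linearly f p = (\<Sum>z\<in>S. lookup p z * f z)"
  unfolding extend_linearly_def by (rule sum.mono_neutral_left) (auto simp: in_keys_iff)

lemma extend_linearly_add: "extend_linearly f (p + p') = extend_linearly f p + extend_linearly f p'"
proof -
  let ?S = "keys p \<union> keys p'"
  have "keys (p + p') \<subseteq> ?S" by (rule Poly_Mapping.keys_add)
  then show ?thesis
    by (simp add: extend_linearly_superset[of ?S] lookup_add algebra_simps sum.distrib)
qed

lemma extend_linearly_scale: "extend_linearly f (Poly_Mapping.map ((*) c) p) = c * extend_linearly f p"
  using keys_scale[of c p]
  by (simp add: extend_linearly_superset[of "keys p"] lookup_scale sum_distrib_left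
      mult.assoc)

lemma extend_linearly_single [simp]: "extend_linearly f (single z c) = c * f z"
  by (simp add: extend_linearly_def)

lemma extend_linearly_zero [simp]: "extend_linearly f 0 = 0"
  by (simp add: extend_linearly_def)

lemma extend_linearly_minus: "extend_linearly f (p - p') = extend_linearly f p - extend_linearly f p'"
  using extend_linearly_add[of f "p - p'" p'] by simp

lemma scale_single: "Poly_Mapping.map ((*) c) (single z d) = single z (c * d)"
  for c :: "'k::field"
  by (rule poly_mapping_eqI) (simp add: lookup_scale lookup_single when_def)

lemma free_space_vs: "vectorspace class_ring (free_space B :: ('k::field, 's \<Rightarrow>\<^sub>0 'k) module)"
proof (rule vectorspaceI, rule module_criteria)
  show "cring (class_ring :: 'k ring)" by (rule class_cring.is_cring)
  let ?F = "free_space B :: ('k, 's \<Rightarrow>\<^sub>0 'k) module"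
  show "\<forall>v w. v \<in> carrier ?F \<and> w \<in> carrier ?F \<longrightarrow> v \<oplus>\<^bsub>?F\<^esub> w \<in> carrier ?F"
    using Poly_Mapping.keys_add by (fastforce simp: free_space_def)
  show "\<forall>v\<in>carrier ?F. \<exists>w\<in>carrier ?F. v \<oplus>\<^bsub>?F\<^esub> w = \<zero>\<^bsub>?F\<^esub>"
  proof
    fix v assume v: "v \<in> carrier ?F"
    show "\<exists>w\<in>carrier ?F. v \<oplus>\<^bsub>?F\<^esub> w = \<zero>\<^bsub>?F\<^esub>"
      using v by (intro bexI[of _ "- v"]) (auto simp: free_space_def in_keys_iff)
  qed
  show "\<forall>c v. c \<in> carrier class_ring \<and> v \<in> carrier ?F \<longrightarrow> c \<odot>\<^bsub>?F\<^esub> v \<in> carrier ?F"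
    using keys_scale by (fastforce simp: free_space_def)
qed (auto simp: free_space_def poly_mapping_eq_iff fun_eq_iff lookup_add lookup_scale algebra_simps)

lemma extend_linearly_dual: "extend_linearly f \<in> dual_space (free_space B)"
  by (rule dual_spaceI) (simp_all add: free_space_def extend_linearly_add extend_linearly_scale)

lemma free_space_linear_eqI:
  fixes U :: "('k::field, 'u) module" and B :: "'s set"
  assumes U: "vectorspace class_ring U"
    and f: "f \<in> linear_maps (free_space B) U" and g: "g \<in> linear_maps (free_space B) U"
    and eq: "\<And>z. z \<in> B \<Longrightarrow> f (single z 1) = g (single z 1)"
    and p: "keys p \<subseteq> B"
  shows "f p = g p"
  using p
proof (induction p rule: update_induct)
  case const
  then show ?case
    using linear_maps_zero[OF free_space_vs U f] linear_maps_zero[OF free_space_vs U g]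
    by (simp add: free_space_def)
next
  case (update p z c)
  have decomp: "Poly_Mapping.update z c p = p + Poly_Mapping.map ((*) c) (single z 1)"
    using update.hyps by (intro poly_mapping_eqI) (auto simp: lookup_add lookup_update lookup_scale lookup_single when_def in_keys_iff)
  have keys: "keys (Poly_Mapping.update z c p) = insert z (keys p)"
    using update.hyps by (simp add: keys_update)
  have fg: "f p = g p" using update keys by auto
  have c: "p \<in> carrier (free_space B)" "single z 1 \<in> carrier (free_space B :: ('k, 's \<Rightarrow>\<^sub>0 'k) module)" "z \<in> B"
    using update.prems keys by (auto simp: free_space_def)
  have "h (Poly_Mapping.update z c p) = h p \<oplus>\<^bsub>U\<^esub> c \<odot>\<^bsub>U\<^esub> h (single z 1)"
    if "h \<in> linear_maps (free_space B) U" for h :: "('s \<Rightarrow>\<^sub>0 'k) \<Rightarrow> 'u"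
    using linear_maps_add[OF that, of p "c \<odot>\<^bsub>free_space B\<^esub> single z 1"]
      linear_maps_smult[OF that, of "single z 1" c]
      c vs_smult_closed[OF free_space_vs c(2)] unfolding decomp by (simp add: free_space_def)
  from this[OF f] this[OF g] show ?case using eq fg c by simp
qed

definition bilinear_maps :: "('k::field, 'v) module \<Rightarrow> ('k, 'w) module \<Rightarrow> ('k, 'u) module \<Rightarrow>
    ('v \<Rightarrow> 'w \<Rightarrow> 'u) set" where
  "bilinear_maps V W U =
     {\<beta>. (\<forall>w\<in>carrier W. (\<lambda>v. \<beta> v w) \<in> linear_maps V U) \<and> (\<forall>v\<in>carrier V. \<beta> v \<in> linear_maps W U)}"

abbreviation bilinear_forms :: "('k::field, 'v) module \<Rightarrow> ('k, 'w) module \<Rightarrow> ('v \<Rightarrow> 'w \<Rightarrow> 'k) set" where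
  "bilinear_forms V W \<equiv> bilinear_maps V W scalar_module"

lemma bilinear_mapsI:
  "(\<And>w. w \<in> carrier W \<Longrightarrow> (\<lambda>v. \<beta> v w) \<in> linear_maps V U) \<Longrightarrow>
   (\<And>v. v \<in> carrier V \<Longrightarrow> (\<lambda>w. \<beta> v w) \<in> linear_maps W U) \<Longrightarrow> \<beta> \<in> bilinear_maps V W U"
  by (simp add: bilinear_maps_def)

lemma
  assumes "\<beta> \<in> bilinear_maps V W U"
  shows bilinear_left: "w \<in> carrier W \<Longrightarrow> (\<lambda>v. \<beta> v w) \<in> linear_maps V U"
    and bilinear_right: "v \<in> carrier V \<Longrightarrow> \<beta> v \<in> linear_maps W U"
    and bilinear_closed: "v \<in> carrier V \<Longrightarrow> w \<in> carrier W \<Longrightarrow> \<beta> v w \<in> carrier U"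
  using assms by (auto simp: bilinear_maps_def linear_maps_closed[of "\<beta> v" W U])

lemma bilinear_formsI:
  "(\<And>w. w \<in> carrier W \<Longrightarrow> (\<lambda>v. \<beta> v w) \<in> dual_space V) \<Longrightarrow>
   (\<And>v. v \<in> carrier V \<Longrightarrow> (\<lambda>w. \<beta> v w) \<in> dual_space W) \<Longrightarrow> \<beta> \<in> bilinear_forms V W"
  by (simp add: bilinear_maps_def dual_space_def)

lemma
  assumes "\<beta> \<in> bilinear_forms V W"
  shows bilinear_form_left: "w \<in> carrier W \<Longrightarrow> (\<lambda>v. \<beta> v w) \<in> dual_space V"
    and bilinear_form_right: "v \<in> carrier V \<Longrightarrow> \<beta> v \<in> dual_space W"
  using assms by (auto simp: bilinear_maps_def dual_space_def)

lemma bilinear_forms_comp: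
  "\<beta> \<in> bilinear_maps V W U \<Longrightarrow> g \<in> dual_space U \<Longrightarrow> (\<lambda>v w. g (\<beta> v w)) \<in> bilinear_forms V W"
  by (rule bilinear_formsI) (auto intro: dual_comp bilinear_left bilinear_right)

lemma product_bilinear_form:
  "f \<in> dual_space V \<Longrightarrow> g \<in> dual_space W \<Longrightarrow> (\<lambda>v w. f v * g w) \<in> bilinear_forms V W"
  by (intro bilinear_formsI dual_spaceI) (simp_all add: dual_add dual_smult algebra_simps)

abbreviation lift :: "('v \<Rightarrow> 'w \<Rightarrow> 'k) \<Rightarrow> (('v \<times> 'w) \<Rightarrow>\<^sub>0 'k::field) set \<Rightarrow> 'k" where
  "lift \<equiv> tensor_lift scalar_module"

locale tensor_product =
  fixes V :: "('k::field, 'v) module" and W :: "('k, 'w) module"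
  assumes left_vs: "vectorspace class_ring V" and right_vs: "vectorspace class_ring W"
begin

abbreviation "T \<equiv> tensor V W"

abbreviation "F \<equiv> free_space (carrier V \<times> carrier W) :: ('k, ('v \<times> 'w) \<Rightarrow>\<^sub>0 'k) module"

abbreviation "form \<beta> \<equiv> (\<lambda>z :: 'v \<times> 'w. \<beta> (fst z) (snd z))"

sublocale F: vectorspace class_ring F by (rule free_space_vs)

lemma relators_closed: "tensor_relators V W \<subseteq> carrier F"
proof -
  have s: "single (v, w) c \<in> carrier F" if "v \<in> carrier V" "w \<in> carrier W" for v w c
    using that by (simp add: free_space_def)
  have m: "p - p' \<in> carrier F" if "p \<in> carrier F" "p' \<in> carrier F" for p p'
  proof -
    have "keys (p - p') \<subseteq> keys p \<union> keys p'"
      by (auto simp: in_keys_iff lookup_minus)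
    then show ?thesis using that by (simp add: free_space_def) blast
  qed
  show ?thesis
    unfolding tensor_relators_def
    by (auto intro!: s m simp: vs_add_closed[OF left_vs] vs_add_closed[OF right_vs]
        vs_smult_closed[OF left_vs] vs_smult_closed[OF right_vs])
qed

sublocale Q: quotient_space F "tensor_kernel V W"
  by (rule quotient_space.intro)
    (auto simp: tensor_kernel_def intro!: free_space_vs F.span_is_submodule relators_closed)

lemma tensor_eq: "tensor V W = quot_space F (tensor_kernel V W)"
  by (simp add: tensor_def)

lemma pure_eq: "pure_tensor V W v w = Q.proj (single (v, w) 1)"
  by (simp add: pure_tensor_def Q.proj_def)

lemma tensor_vs: "vectorspace class_ring T"
  unfolding tensor_eq by (rule Q.quot_vs)

lemma single_closed: "v \<in> carrier V \<Longrightarrow> w \<in> carrier W \<Longrightarrow> single (v, w) c \<in> carrier F"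
  by (simp add: free_space_def)

lemma pure_closed: "v \<in> carrier V \<Longrightarrow> w \<in> carrier W \<Longrightarrow> pure_tensor V W v w \<in> carrier T"
  by (simp add: tensor_eq pure_eq Q.carrier_quot single_closed)

lemma relator_in_kernel: "r \<in> tensor_relators V W \<Longrightarrow> r \<in> tensor_kernel V W"
  unfolding tensor_kernel_def using F.in_own_span[OF relators_closed] by auto

lemma proj_eq_relator:
  assumes "p \<in> carrier F" "p' \<in> carrier F" "p - p' \<in> tensor_relators V W"
  shows "Q.proj p = Q.proj p'"
proof -
  have "p \<ominus>\<^bsub>F\<^esub> p' = p - p'"
    unfolding vs_minus[OF free_space_vs assms(1,2)]
    by (rule poly_mapping_eqI) (simp add: free_space_def lookup_add lookup_minus lookup_scale)
  then show ?thesis using assms by (simp add: Q.proj_eq_iff relator_in_kernel)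
qed

lemmas closed_rules = single_closed vs_add_closed[OF left_vs] vs_add_closed[OF right_vs]
    vs_smult_closed[OF left_vs] vs_smult_closed[OF right_vs]

lemma pure_bilinear: "pure_tensor V W \<in> bilinear_maps V W T"
proof (intro bilinear_mapsI linear_mapsI)
  fix v v' w assume *: "v \<in> carrier V" "v' \<in> carrier V" "w \<in> carrier W"
  have "single (v \<oplus>\<^bsub>V\<^esub> v', w) 1 - (single (v, w) 1 \<oplus>\<^bsub>F\<^esub> single (v', w) 1)
      \<in> tensor_relators V W"
    unfolding tensor_relators_def using * by (fastforce simp: free_space_def diff_diff_eq)
  then have "Q.proj (single (v \<oplus>\<^bsub>V\<^esub> v', w) 1)
      = Q.proj (single (v, w) 1 \<oplus>\<^bsub>F\<^esub> single (v', w) 1)"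
    using * by (intro proj_eq_relator vs_add_closed[OF free_space_vs]) (auto simp: closed_rules)
  then show "pure_tensor V W (v \<oplus>\<^bsub>V\<^esub> v') w = pure_tensor V W v w \<oplus>\<^bsub>T\<^esub> pure_tensor V W v' w"
    using * by (simp add: tensor_eq pure_eq Q.proj_add closed_rules)
next
  fix v w w' assume *: "v \<in> carrier V" "w \<in> carrier W" "w' \<in> carrier W"
  have "single (v, w \<oplus>\<^bsub>W\<^esub> w') 1 - (single (v, w) 1 \<oplus>\<^bsub>F\<^esub> single (v, w') 1)
      \<in> tensor_relators V W"
    unfolding tensor_relators_def using * by (fastforce simp: free_space_def diff_diff_eq)
  then have "Q.proj (single (v, w \<oplus>\<^bsub>W\<^esub> w') 1)
      = Q.proj (single (v, w) 1 \<oplus>\<^bsub>F\<^esub> single (v, w') 1)"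
    using * by (intro proj_eq_relator vs_add_closed[OF free_space_vs]) (auto simp: closed_rules)
  then show "pure_tensor V W v (w \<oplus>\<^bsub>W\<^esub> w') = pure_tensor V W v w \<oplus>\<^bsub>T\<^esub> pure_tensor V W v w'"
    using * by (simp add: tensor_eq pure_eq Q.proj_add closed_rules)
next
  fix c v w assume *: "v \<in> carrier V" "w \<in> carrier W"
  have "single (c \<odot>\<^bsub>V\<^esub> v, w) 1 - c \<odot>\<^bsub>F\<^esub> single (v, w) 1
      \<in> tensor_relators V W"
    unfolding tensor_relators_def using * by (auto simp: free_space_def scale_single)
  then have "Q.proj (single (c \<odot>\<^bsub>V\<^esub> v, w) 1) = Q.proj (c \<odot>\<^bsub>F\<^esub> single (v, w) 1)"
    using * by (intro proj_eq_relator vs_smult_closed[OF free_space_vs]) (auto simp: closed_rules)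
  then show "pure_tensor V W (c \<odot>\<^bsub>V\<^esub> v) w = c \<odot>\<^bsub>T\<^esub> pure_tensor V W v w"
    using * by (simp add: tensor_eq pure_eq Q.proj_smult closed_rules)
next
  fix c v w assume *: "v \<in> carrier V" "w \<in> carrier W"
  have "single (v, c \<odot>\<^bsub>W\<^esub> w) 1 - c \<odot>\<^bsub>F\<^esub> single (v, w) 1
      \<in> tensor_relators V W"
    unfolding tensor_relators_def using * by (auto simp: free_space_def scale_single)
  then have "Q.proj (single (v, c \<odot>\<^bsub>W\<^esub> w) 1) = Q.proj (c \<odot>\<^bsub>F\<^esub> single (v, w) 1)"
    using * by (intro proj_eq_relator vs_smult_closed[OF free_space_vs]) (auto simp: closed_rules)
  then show "pure_tensor V W v (c \<odot>\<^bsub>W\<^esub> w) = c \<odot>\<^bsub>T\<^esub> pure_tensor V W v w"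
    using * by (simp add: tensor_eq pure_eq Q.proj_smult closed_rules)
qed (auto intro: pure_closed)

text \<open>
  The relators are the bilinearity identities, so the linear extension of a bilinear form
  vanishes on them.  This makes lifts independent of the representative.
\<close>

lemma form_kernel:
  assumes \<beta>: "\<beta> \<in> bilinear_forms V W" and p: "p \<in> tensor_kernel V W"
  shows "extend_linearly (form \<beta>) p = 0"
proof -
  let ?f = "extend_linearly (form \<beta>)"
  let ?N = "{p \<in> carrier F. ?f p = 0}"
  have l: "\<And>w. w \<in> carrier W \<Longrightarrow> (\<lambda>v. \<beta> v w) \<in> dual_space V"
    and r: "\<And>v. v \<in> carrier V \<Longrightarrow> \<beta> v \<in> dual_space W"
    using \<beta> by (auto simp: bilinear_form_left bilinear_form_right)
  note dual = extend_linearly_dual[of "form \<beta>" "carrier V \<times> carrier W"]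
  have "submodule class_ring ?N F"
    unfolding submodule_def
    by (auto simp: dual_add[OF dual] dual_smult[OF dual] dual_zero[OF free_space_vs dual] F.is_module F.module_axioms)
  moreover have "?f x = 0" if "x \<in> tensor_relators V W" for x
    using that unfolding tensor_relators_def
    by (auto simp: extend_linearly_minus dual_add[OF l] dual_add[OF r] dual_smult[OF l] dual_smult[OF r])
  then have "tensor_relators V W \<subseteq> ?N" using relators_closed by auto
  ultimately have "tensor_kernel V W \<subseteq> ?N"
    unfolding tensor_kernel_def by (intro F.span_is_subset)
  then show ?thesis using p by auto
qed

lemma lift_proj:
  assumes \<beta>: "\<beta> \<in> bilinear_forms V W" and p: "p \<in> carrier F"
  shows "lift \<beta> (Q.proj p) = extend_linearly (form \<beta>) p"
proof -
  let ?p = "SOME p'. p' \<in> Q.proj p"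
  note rep = Q.chosen_representative[OF p]
  note dual = extend_linearly_dual[of "form \<beta>" "carrier V \<times> carrier W"]
  have "extend_linearly (form \<beta>) ?p - extend_linearly (form \<beta>) p = 0"
    using form_kernel[OF \<beta> rep(2)] dual_minus[OF free_space_vs dual rep(1) p] by simp
  then show ?thesis
    by (simp add: tensor_lift_def finsum_scalar_module extend_linearly_def smult_scalar_module)
qed

lemma lift_dual:
  "\<beta> \<in> bilinear_forms V W \<Longrightarrow> lift \<beta> \<in> dual_space T"
  by (rule dual_spaceI)
    (auto simp: tensor_eq Q.carrier_quot Q.proj_add Q.proj_smult lift_proj
      dual_add[OF extend_linearly_dual] dual_smult[OF extend_linearly_dual] F.smult_closed)

lemma lift_pure:
  "\<beta> \<in> bilinear_forms V W \<Longrightarrow> v \<in> carrier V \<Longrightarrow> w \<in> carrier W \<Longrightarrow>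
     lift \<beta> (pure_tensor V W v w) = \<beta> v w"
  by (simp add: pure_eq lift_proj single_closed)

lemma linear_maps_tensor_eqI:
  assumes U: "vectorspace class_ring U"
    and f: "f \<in> linear_maps T U" and g: "g \<in> linear_maps T U"
    and eq: "\<And>v w. v \<in> carrier V \<Longrightarrow> w \<in> carrier W \<Longrightarrow> f (pure_tensor V W v w) = g (pure_tensor V W v w)"
    and X: "X \<in> carrier T"
  shows "f X = g X"
proof -
  obtain p where p: "p \<in> carrier F" "X = Q.proj p"
    using X by (auto simp: tensor_eq Q.carrier_quot)
  have "(\<lambda>p. h (Q.proj p)) \<in> linear_maps F U" if "h \<in> linear_maps T U" for h
    using that Q.proj_linear linear_maps_comp unfolding tensor_eq by blast
  from free_space_linear_eqI[OF U this[OF f] this[OF g], of p]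
  show ?thesis using eq p by (auto simp: pure_eq free_space_def)
qed

text \<open>
  A functional moves inside a lift because both lifts are evaluated on the same representative.
  Lifts into any space are thereby reduced to lifts of bilinear forms.
\<close>

lemma
  assumes U: "vectorspace class_ring U"
    and \<beta>: "\<And>v w. v \<in> carrier V \<Longrightarrow> w \<in> carrier W \<Longrightarrow> \<beta> v w \<in> carrier U"
    and X: "X \<in> carrier T"
  shows tensor_lift_closed: "tensor_lift U \<beta> X \<in> carrier U"
    and dual_tensor_lift: "g \<in> dual_space U \<Longrightarrow>
          g (tensor_lift U \<beta> X) = lift (\<lambda>v w. g (\<beta> v w)) X"
proof -
  obtain p where p: "p \<in> carrier F" "X = Q.proj p"
    using X by (auto simp: tensor_eq Q.carrier_quot)
  define p' where "p' = (SOME p. p \<in> X)"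
  have "p' \<in> carrier F" using Q.chosen_representative(1)[OF p(1)] p(2) by (simp add: p'_def)
  then have closed: "\<beta> (fst z) (snd z) \<in> carrier U" if "z \<in> keys p'" for z
    using that \<beta> by (auto simp: free_space_def)
  show "tensor_lift U \<beta> X \<in> carrier U"
    unfolding tensor_lift_def Let_def p'_def[symmetric]
    using closed by (auto intro!: vs_finsum_closed[OF U] vs_smult_closed[OF U])
  show "g (tensor_lift U \<beta> X) = lift (\<lambda>v w. g (\<beta> v w)) X"
    if "g \<in> dual_space U"
    unfolding tensor_lift_def Let_def p'_def[symmetric]
    using closed that
    by (subst dual_finsum[OF U]) (auto simp: dual_smult finsum_scalar_module smult_scalar_module
        intro!: vs_smult_closed[OF U])
qed

end

locale tensor_of_based = V: based_space V I e co + W: based_space W J d cp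
  for V :: "('k::field, 'v) module" and I :: "'i set" and e co
    and W :: "('k, 'w) module" and J :: "'j set" and d cp
begin

sublocale tensor_product V W
  by (rule tensor_product.intro) (rule V.vs W.vs)+

definition "tensor_basis = (\<lambda>(i, j). pure_tensor V W (e i) (d j))"

definition "tensor_co = (\<lambda>(i, j). lift (\<lambda>v w. co i v * cp j w))"

lemma tensor_co_pure:
  "i \<in> I \<Longrightarrow> j \<in> J \<Longrightarrow> v \<in> carrier V \<Longrightarrow> w \<in> carrier W \<Longrightarrow>
     tensor_co (i, j) (pure_tensor V W v w) = co i v * cp j w"
  by (simp add: tensor_co_def lift_pure product_bilinear_form V.co_dual W.co_dual)

sublocale T: based_space "T" "I \<times> J" tensor_basis tensor_co
proof (rule based_space.intro)
  show "finite (I \<times> J)" using V.finite_index W.finite_index by simp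
  show closed: "tensor_basis z \<in> carrier T" if "z \<in> I \<times> J" for z
    using that by (auto simp: tensor_basis_def intro!: pure_closed V.basis_closed W.basis_closed)
  show dual: "tensor_co z \<in> dual_space T" if "z \<in> I \<times> J" for z
    using that by (auto simp: tensor_co_def intro!: lift_dual product_bilinear_form V.co_dual W.co_dual)
  show co_basis: "tensor_co z (tensor_basis z') = (if z = z' then 1 else 0)" if "z \<in> I \<times> J" "z' \<in> I \<times> J" for z z'
    using that by (auto simp: tensor_basis_def tensor_co_pure V.basis_closed W.basis_closed V.co_basis W.co_basis split: if_splits)
  show "vectorspace class_ring T" by (rule tensor_vs)
  interpret U: vectorspace class_ring "T" by (rule tensor_vs)
  let ?\<Phi> = "\<lambda>X. finsum T (\<lambda>z. tensor_co z X \<odot>\<^bsub>T\<^esub> tensor_basis z) (I \<times> J)"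
  have lin: "?\<Phi> \<in> linear_maps T T"
    by (rule finsum_functionals_linear[OF tensor_vs closed dual])
  \<comment> \<open>The expansion holds for pure tensors of basis vectors, hence for all pure tensors.\<close>
  have "?\<Phi> (tensor_basis z) = tensor_basis z" if z: "z \<in> I \<times> J" for z
  proof -
    have "?\<Phi> (tensor_basis z) = finsum T (\<lambda>z'. if z = z' then tensor_basis z' else \<zero>\<^bsub>T\<^esub>) (I \<times> J)"
      using z by (intro U.finsum_cong2)
        (auto simp: co_basis closed vs_smult_one[OF tensor_vs] vs_smult_zero[OF tensor_vs])
    then show ?thesis using z by (simp add: U.add.finprod_singleton V.finite_index W.finite_index closed)
  qed
  from this[of "(_, _)"] have basis: "?\<Phi> (pure_tensor V W (e i) (d j)) = pure_tensor V W (e i) (d j)"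
    if "i \<in> I" "j \<in> J" for i j
    using that unfolding tensor_basis_def[THEN fun_cong, of "(_, _)", unfolded prod.case] by simp
  have half: "?\<Phi> (pure_tensor V W (e i) w) = pure_tensor V W (e i) w" if i: "i \<in> I" and w: "w \<in> carrier W" for i w
  proof (rule W.linear_maps_eqI[where f = "\<lambda>w. ?\<Phi> (pure_tensor V W (e i) w)"
        and g = "pure_tensor V W (e i)" and x = w and U = "T"])
    show *: "pure_tensor V W (e i) \<in> linear_maps W T"
      by (rule bilinear_right[OF pure_bilinear V.basis_closed[OF i]])
    show "(\<lambda>w. ?\<Phi> (pure_tensor V W (e i) w)) \<in> linear_maps W T"
      by (rule linear_maps_comp[OF * lin])
  qed (rule tensor_vs w basis[OF i]; assumption)+
  have pure: "?\<Phi> (pure_tensor V W v w) = pure_tensor V W v w" if v: "v \<in> carrier V" and w: "w \<in> carrier W" for v w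
  proof (rule V.linear_maps_eqI[where f = "\<lambda>v. ?\<Phi> (pure_tensor V W v w)"
        and g = "\<lambda>v. pure_tensor V W v w" and x = v and U = "T"])
    show *: "(\<lambda>v. pure_tensor V W v w) \<in> linear_maps V T"
      by (rule bilinear_left[OF pure_bilinear w])
    show "(\<lambda>v. ?\<Phi> (pure_tensor V W v w)) \<in> linear_maps V T"
      by (rule linear_maps_comp[OF * lin])
  qed (rule tensor_vs v half[OF _ w]; assumption)+
  have "?\<Phi> X = X" if "X \<in> carrier T" for X
    by (rule linear_maps_tensor_eqI[OF tensor_vs lin _ pure that])
      (auto intro: linear_mapsI)
  then show "X = \<zero>\<^bsub>T\<^esub>"
    if X: "X \<in> carrier T" and 0: "\<And>z. z \<in> I \<times> J \<Longrightarrow> tensor_co z X = 0" for X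
  proof -
    have "?\<Phi> X = \<zero>\<^bsub>T\<^esub>"
      using closed by (intro U.add.finprod_one_eqI) (simp add: 0 vs_smult_zero[OF tensor_vs])
    then show ?thesis using \<open>\<And>X. X \<in> carrier T \<Longrightarrow> ?\<Phi> X = X\<close>[OF X] by simp
  qed
qed

end

text \<open>All lifts are evaluated on the same representative, so a lift is linear in the form as well.\<close>

lemma (in tensor_product)
  assumes "X \<in> carrier T"
  shows lift_cong: "(\<And>v w. v \<in> carrier V \<Longrightarrow> w \<in> carrier W \<Longrightarrow> f v w = g v w) \<Longrightarrow>
      lift f X = lift g X"
    and lift_add: "lift (\<lambda>v w. f v w + g v w) X =
      lift f X + lift g X"
    and lift_scale: "lift (\<lambda>v w. c * f v w) X = c * lift f X"
proof -
  obtain p where p: "p \<in> carrier F" "X = Q.proj p"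
    using assms by (auto simp: tensor_eq Q.carrier_quot)
  define p' where "p' = (SOME p. p \<in> X)"
  have "p' \<in> carrier F" using Q.chosen_representative(1)[OF p(1)] p(2) by (simp add: p'_def)
  then have keys: "fst z \<in> carrier V" "snd z \<in> carrier W" if "z \<in> keys p'" for z
    using that by (auto simp: free_space_def)
  have lift: "lift f X = (\<Sum>z\<in>keys p'. lookup p' z * f (fst z) (snd z))" for f
    by (simp add: tensor_lift_def p'_def finsum_scalar_module smult_scalar_module Let_def)
  show "lift f X = lift g X"
    if "\<And>v w. v \<in> carrier V \<Longrightarrow> w \<in> carrier W \<Longrightarrow> f v w = g v w"
    unfolding lift by (intro sum.cong refl) (simp add: that keys)
  show "lift (\<lambda>v w. f v w + g v w) X = lift f X + lift g X"
    unfolding lift by (simp add: algebra_simps sum.distrib)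
  show "lift (\<lambda>v w. c * f v w) X = c * lift f X"
    unfolding lift by (simp add: algebra_simps sum_distrib_left)
qed

lemma (in tensor_product) dual_tensor_eq_lift:
  assumes f: "f \<in> dual_space T" and X: "X \<in> carrier T"
  shows "f X = lift (\<lambda>v w. f (pure_tensor V W v w)) X"
proof -
  note form = bilinear_forms_comp[OF pure_bilinear f]
  show ?thesis
    by (rule linear_maps_tensor_eqI[OF vectorspace_scalar_module _ _ _ X])
      (use f lift_dual[OF form] in \<open>simp_all add: dual_space_def lift_pure[OF form]\<close>)
qed

text \<open>
  The universal property, for targets with enough functionals to reduce it to bilinear forms.
\<close>

lemma (in tensor_product) tensor_lift_linear:
  assumes U: "based_space U K u cu" and \<beta>: "\<beta> \<in> bilinear_maps V W U"
  shows "tensor_lift U \<beta> \<in> linear_maps T U"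
proof -
  interpret U: based_space U K u cu by (rule U)
  have ev: "g (tensor_lift U \<beta> X) = lift (\<lambda>v w. g (\<beta> v w)) X"
    if "X \<in> carrier T" "g \<in> dual_space U" for X g
    using that by (intro dual_tensor_lift[OF U.vs] bilinear_closed[OF \<beta>])
  have closed: "tensor_lift U \<beta> X \<in> carrier U" if "X \<in> carrier T" for X
    using that by (intro tensor_lift_closed[OF U.vs] bilinear_closed[OF \<beta>])
  note dual = lift_dual[OF bilinear_forms_comp[OF \<beta>]]
  note [simp] = closed ev vs_add_closed[OF tensor_vs] vs_smult_closed[OF tensor_vs] vs_add_closed[OF U.vs] vs_smult_closed[OF U.vs]
  show ?thesis
  proof (rule linear_mapsI)
    show "tensor_lift U \<beta> (X \<oplus>\<^bsub>T\<^esub> Y) = tensor_lift U \<beta> X \<oplus>\<^bsub>U\<^esub> tensor_lift U \<beta> Y"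
      if "X \<in> carrier T" "Y \<in> carrier T" for X Y
      using that by (intro U.functionals_eqI) (simp_all add: dual_add dual_add[OF dual])
    show "tensor_lift U \<beta> (c \<odot>\<^bsub>T\<^esub> X) = c \<odot>\<^bsub>U\<^esub> tensor_lift U \<beta> X"
      if "X \<in> carrier T" for c X
      using that by (intro U.functionals_eqI) (simp_all add: dual_smult dual_smult[OF dual])
  qed (rule closed)
qed


section \<open>Quotient algebras\<close>

text \<open>
  The clause of \<^const>\<open>fin_dim_algebra\<close> that the free algebra satisfies too, and that passes to
  quotients.
\<close>

definition scalar_compatible :: "('k::field, 'a) module \<Rightarrow> bool" where
  "scalar_compatible A \<longleftrightarrow> (\<forall>c. \<forall>x\<in>carrier A. \<forall>y\<in>carrier A.
        (c \<odot>\<^bsub>A\<^esub> x) \<otimes>\<^bsub>A\<^esub> y = c \<odot>\<^bsub>A\<^esub> (x \<otimes>\<^bsub>A\<^esub> y) \<and>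
        x \<otimes>\<^bsub>A\<^esub> (c \<odot>\<^bsub>A\<^esub> y) = c \<odot>\<^bsub>A\<^esub> (x \<otimes>\<^bsub>A\<^esub> y))"

lemma mult_bilinear:
  assumes "ring A" "scalar_compatible A"
  shows "mult A \<in> bilinear_maps A A A"
proof -
  interpret ring A by fact
  show ?thesis using assms(2)
    by (intro bilinear_mapsI linear_mapsI) (auto simp: l_distr r_distr scalar_compatible_def)
qed

locale quotient_algebra = quotient_space V N for V :: "('k::field, 'v) module" and N +
  assumes ring: "ring V" and ideal: "ideal N V" and compatible: "scalar_compatible V"
begin

sublocale R: ring V by (rule ring)

lemma proj_mult: "x \<in> carrier V \<Longrightarrow> y \<in> carrier V \<Longrightarrow>
    proj x \<otimes>\<^bsub>quot_space V N\<^esub> proj y = proj (x \<otimes>\<^bsub>V\<^esub> y)"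
  by (simp add: quot_space_def FactRing_def proj_def ideal.rcoset_mult_add[OF ideal])

lemma proj_one: "\<one>\<^bsub>quot_space V N\<^esub> = proj \<one>\<^bsub>V\<^esub>"
  by (simp add: quot_space_def FactRing_def proj_def)

lemma quot_ring: "ring (quot_space V N)"
proof (rule ringI)
  interpret Q: vectorspace class_ring "quot_space V N" by (rule quot_vs)
  show "abelian_group (quot_space V N)" by (rule Q.abelian_group_axioms)
  show "Group.monoid (quot_space V N)"
    by (rule Group.monoidI) (auto simp: carrier_quot proj_mult proj_one R.m_assoc)
qed (auto simp: carrier_quot proj_mult proj_add R.l_distr R.r_distr)

lemma quot_compatible: "scalar_compatible (quot_space V N)"
  using compatible by (auto simp: scalar_compatible_def carrier_quot proj_mult proj_smult)

end


section \<open>Words and inversions\<close>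

text \<open>
  Sorting a word with the relations \<open>x\<^sub>j x\<^sub>i = q\<^sub>i\<^sub>j x\<^sub>i x\<^sub>j\<close> costs a factor \<open>q\<^sub>i\<^sub>j\<close> for every
  occurrence of \<open>j\<close> before a smaller letter \<open>i\<close>.
\<close>

definition crossing :: "(nat \<Rightarrow> nat \<Rightarrow> 'k::field) \<Rightarrow> nat \<Rightarrow> nat list \<Rightarrow> 'k" where
  "crossing q i w = (\<Prod>j\<leftarrow>w. if j < i then q j i else 1)"

fun word_coeff :: "(nat \<Rightarrow> nat \<Rightarrow> 'k::field) \<Rightarrow> nat list \<Rightarrow> 'k" where
  "word_coeff q [] = 1"
| "word_coeff q (i # w) = crossing q i w * word_coeff q w"

lemma crossing_append: "crossing q i (u @ w) = crossing q i u * crossing q i w"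
  by (simp add: crossing_def)

lemma crossing_simps [simp]:
  "crossing q i [] = 1" "crossing q i (j # w) = (if j < i then q j i else 1) * crossing q i w"
  by (simp_all add: crossing_def)

text \<open>
  Exchanging neighbours changes the relative order of no other pair of letters.
\<close>

lemma word_coeff_swap:
  assumes "q i j * q j i = 1" "i = j \<Longrightarrow> q i j = 1"
  shows "word_coeff q (u @ j # i # w) = q i j * word_coeff q (u @ i # j # w)"
proof (induction u)
  case Nil
  then show ?case using assms by (cases i j rule: linorder_cases) (auto simp: field_simps)
next
  case (Cons k u)
  then show ?case by (simp add: crossing_append mult.commute mult.left_commute)
qed

lemma word_coeff_append:
  "word_coeff q (u @ w) = word_coeff q u * word_coeff q w * (\<Prod>i\<leftarrow>u. crossing q i w)"
  by (induction u) (simp_all add: crossing_append)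

lemma word_coeff_sorted: "sorted w \<Longrightarrow> word_coeff q w = 1"
proof (induction w)
  case (Cons i w)
  have "crossing q i w = 1"
    using Cons.prems by (induction w) auto
  then show ?case using Cons by simp
qed simp

lemma prod_list_count_interval:
  fixes f :: "nat \<Rightarrow> 'k::field"
  assumes "set w \<subseteq> {1..n}"
  shows "(\<Prod>j\<leftarrow>w. f j) = (\<Prod>j = 1..n. f j ^ count_list w j)"
  using assms
proof (induction w)
  case (Cons i w)
  have "(\<Prod>j = 1..n. f j ^ count_list (i # w) j) = (\<Prod>j = 1..n. f j ^ count_list w j * (if j = i then f j else 1))"
    by (intro prod.cong) auto
  also have "\<dots> = (\<Prod>j\<leftarrow>w. f j) * f i"
    using Cons by (simp add: prod.distrib)
  finally show ?case by (simp add: mult.commute)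
qed simp

lemma crossing_count:
  assumes "set w \<subseteq> {1..n}" "j \<in> {1..n}"
  shows "crossing q j w = (\<Prod>i = 1..<j. q i j ^ count_list w i)"
proof -
  have "crossing q j w = (\<Prod>i = 1..n. (if i < j then q i j else 1) ^ count_list w i)"
    unfolding crossing_def by (rule prod_list_count_interval[OF assms(1)])
  also have "\<dots> = (\<Prod>i = 1..<j. q i j ^ count_list w i)"
    using assms(2) by (intro prod.mono_neutral_cong_right) auto
  finally show ?thesis .
qed

lemma crossings_q_form:
  assumes "set u \<subseteq> {1..n}" "set w \<subseteq> {1..n}"
  shows "(\<Prod>j\<leftarrow>u. crossing q j w) = q_form n q (count_list u) (count_list w)"
proof -
  have "(\<Prod>j\<leftarrow>u. crossing q j w) = (\<Prod>j = 1..n. crossing q j w ^ count_list u j)"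
    by (rule prod_list_count_interval[OF assms(1)])
  also have "\<dots> = q_form n q (count_list u) (count_list w)"
    unfolding q_form_def
    by (intro prod.cong) (simp_all add: crossing_count[OF assms(2)] prod_power_distrib power_mult[symmetric] mult.commute)
  finally show ?thesis .
qed

definition std_word :: "nat \<Rightarrow> (nat \<Rightarrow> nat) \<Rightarrow> nat list" where
  "std_word n v = concat (map (\<lambda>i. replicate (v i) i) [1..<Suc n])"

lemma set_std_word: "set (std_word n v) \<subseteq> {1..n}"
  by (auto simp: std_word_def)

lemma count_replicate: "count_list (replicate k i) j = (if i = j then k else 0)"
  by (induction k) auto

lemma count_concat_replicate:
  "distinct is \<Longrightarrow> count_list (concat (map (\<lambda>i. replicate (v i) i) is)) j = (if j \<in> set is then v j else 0)"
  by (induction "is") (auto simp: count_replicate)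

lemma count_std_word: "(\<And>i. i \<notin> {1..n} \<Longrightarrow> v i = 0) \<Longrightarrow> count_list (std_word n v) = v"
  by (rule ext) (auto simp: std_word_def count_concat_replicate simp del: upt_Suc)

lemma sorted_concat_replicate:
  "sorted is \<Longrightarrow> sorted (concat (map (\<lambda>i. replicate (v i) i) is))"
  by (induction "is") (auto simp: sorted_append)

lemma sorted_std_word: "sorted (std_word n v)"
  unfolding std_word_def by (rule sorted_concat_replicate) (simp del: upt_Suc)

lemma sort_eq_std_word:
  assumes "set w \<subseteq> {1..n}"
  shows "sort w = std_word n (count_list w)"
proof (rule properties_for_sort)
  have "count_list w i = 0" if "i \<notin> {1..n}" for i
    using that assms by (auto simp: count_list_0_iff)
  then have "count_list (std_word n (count_list w)) = count_list w" by (rule count_std_word)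
  then show "mset (std_word n (count_list w)) = mset w"
    by (intro multiset_eqI) (metis count_mset)
qed (rule sorted_std_word)


section \<open>The standard basis of a quantum complete intersection\<close>

lemma poly_mapping_add_induct [case_names zero add]:
  assumes "P 0" "\<And>p z c. P p \<Longrightarrow> P (p + single z c)"
  shows "P (p :: 's \<Rightarrow>\<^sub>0 'k::field)"
proof (induction p rule: update_induct)
  case const
  then show ?case by (rule assms(1))
next
  case (update p z c)
  have "Poly_Mapping.update z c p = p + single z c"
    using update by (intro poly_mapping_eqI) (auto simp: lookup_add lookup_update lookup_single when_def in_keys_iff)
  then show ?case using assms(2) update by simp
qed

lemma single_zero_commute: "single 0 c * p = p * single 0 c"
  for p :: "'s::monoid_add \<Rightarrow>\<^sub>0 'k::field"
  by (induction p rule: poly_mapping_add_induct) (simp_all add: algebra_simps mult_single)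

lemma scale_mult_left: "Poly_Mapping.map ((*) c) (p * p') = Poly_Mapping.map ((*) c) p * p'"
  and scale_mult_right: "Poly_Mapping.map ((*) c) (p * p') = p * Poly_Mapping.map ((*) c) p'"
  for p p' :: "'s::monoid_add \<Rightarrow>\<^sub>0 'k::field"
  unfolding mult_map_scale_conv_mult by (metis mult.assoc single_zero_commute)+

abbreviation word :: "nat list \<Rightarrow> nat free_word \<Rightarrow>\<^sub>0 'k::field" where
  "word w \<equiv> single (FWord w) 1"

lemma letters_plus [simp]: "letters (u + w) = letters u @ letters w"
  by (simp add: plus_free_word_def)

lemma letters_zero [simp]: "letters 0 = []"
  by (simp add: zero_free_word_def)

lemma FWord_plus [simp]: "FWord u + FWord w = FWord (u @ w)"
  by (simp add: plus_free_word_def)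

lemma word_append: "word (u @ w) = word u * word w"
  by (simp add: mult_single)

lemma word_replicate: "word (replicate k i) = free_gen i ^ k"
proof (induction k)
  case (Suc k)
  have "word (replicate (Suc k) i) = (word ([i] @ replicate k i) :: nat free_word \<Rightarrow>\<^sub>0 'a)" by simp
  then show ?case unfolding word_append using Suc by (simp add: free_gen_def)
qed (simp flip: zero_free_word_def)

lemma free_algebra_simps [simp]:
  "mult (free_algebra n) = (*)" "one (free_algebra n) = 1" "zero (free_algebra n) = 0"
  "add (free_algebra n) = (+)" "smult (free_algebra n) = (\<lambda>c. Poly_Mapping.map ((*) c))"
  by (simp_all add: free_algebra_def)

definition words :: "nat \<Rightarrow> nat free_word set" where
  "words n = {w. set (letters w) \<subseteq> {1..n}}"

lemma carrier_free_algebra: "carrier (free_algebra n) = {p. keys p \<subseteq> words n}"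
  by (auto simp: free_algebra_def words_def)

lemma linear_maps_free_algebra: "linear_maps (free_algebra n) U = linear_maps (free_space (words n)) U"
  by (simp add: LinearCombinations.module_hom_def carrier_free_algebra free_space_def)

lemma free_algebra_vs: "vectorspace class_ring (free_algebra n :: ('k::field, nat free_word \<Rightarrow>\<^sub>0 'k) module)"
proof (rule vectorspaceI, rule module_criteria)
  interpret F: vectorspace class_ring "free_space (words n) :: ('k::field, nat free_word \<Rightarrow>\<^sub>0 'k) module"
    by (rule free_space_vs)
  show "cring (class_ring :: 'k ring)" by (rule class_cring.is_cring)
  let ?F = "free_algebra n :: ('k, nat free_word \<Rightarrow>\<^sub>0 'k) module"
  show "\<forall>v w. v \<in> carrier ?F \<and> w \<in> carrier ?F \<longrightarrow> v \<oplus>\<^bsub>?F\<^esub> w \<in> carrier ?F"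
    using F.M.add.m_closed by (simp add: carrier_free_algebra free_space_def)
  show "\<forall>c v. c \<in> carrier class_ring \<and> v \<in> carrier ?F \<longrightarrow> c \<odot>\<^bsub>?F\<^esub> v \<in> carrier ?F"
    using F.smult_closed by (simp add: carrier_free_algebra free_space_def)
  show "\<forall>v\<in>carrier ?F. \<exists>w\<in>carrier ?F. v \<oplus>\<^bsub>?F\<^esub> w = \<zero>\<^bsub>?F\<^esub>"
  proof
    fix v assume v: "v \<in> carrier ?F"
    show "\<exists>w\<in>carrier ?F. v \<oplus>\<^bsub>?F\<^esub> w = \<zero>\<^bsub>?F\<^esub>"
      using v by (intro bexI[of _ "- v"]) (auto simp: carrier_free_algebra in_keys_iff)
  qed
qed (auto simp: carrier_free_algebra poly_mapping_eq_iff fun_eq_iff lookup_add lookup_scale algebra_simps)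

lemma free_algebra_mult_closed:
  assumes "p \<in> carrier (free_algebra n)" "p' \<in> carrier (free_algebra n)"
  shows "p * p' \<in> carrier (free_algebra n)"
  using assms Poly_Mapping.keys_mult[of p p'] by (fastforce simp: carrier_free_algebra words_def)

lemma free_algebra_ring: "ring (free_algebra n :: ('k::field, nat free_word \<Rightarrow>\<^sub>0 'k) module)"
proof (rule ringI)
  let ?F = "free_algebra n :: ('k::field, nat free_word \<Rightarrow>\<^sub>0 'k) module"
  interpret F: vectorspace class_ring ?F by (rule free_algebra_vs)
  show "abelian_group ?F" by (rule F.abelian_group_axioms)
  show "Group.monoid ?F"
    by (rule Group.monoidI) (auto simp: free_algebra_mult_closed mult.assoc, auto simp: carrier_free_algebra words_def)
qed (auto simp: algebra_simps)

lemma free_algebra_compatible: "scalar_compatible (free_algebra n)"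
  by (auto simp: scalar_compatible_def scale_mult_left scale_mult_right[symmetric])

lemma word_closed: "set w \<subseteq> {1..n} \<Longrightarrow> word w \<in> carrier (free_algebra n)"
  by (simp add: carrier_free_algebra words_def)

locale quantum_complete_intersection =
  fixes n :: nat and q :: "nat \<Rightarrow> nat \<Rightarrow> 'k::field" and a :: "nat \<Rightarrow> nat"
  assumes n_pos: "n \<ge> 1"
    and a_ge_2: "i \<in> {1..n} \<Longrightarrow> a i \<ge> 2"
    and q_diag: "i \<in> {1..n} \<Longrightarrow> q i i = 1"
    and q_inverse: "i \<in> {1..n} \<Longrightarrow> j \<in> {1..n} \<Longrightarrow> q i j * q j i = 1"
begin

abbreviation F :: "('k, nat free_word \<Rightarrow>\<^sub>0 'k) module" where "F \<equiv> free_algebra n"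
abbreviation A :: "('k, (nat free_word \<Rightarrow>\<^sub>0 'k) set) module" where "A \<equiv> qci n q a"
abbreviation V :: "(nat \<Rightarrow> nat) set" where "V \<equiv> exponents n a"
abbreviation product (infixl "\<cdot>" 70) where "y \<cdot> z \<equiv> y \<otimes>\<^bsub>A\<^esub> z"
abbreviation scale (infixl "*\<^sub>A" 70) where "c *\<^sub>A y \<equiv> c \<odot>\<^bsub>A\<^esub> y"
abbreviation one_A ("\<one>\<^sub>A") where "\<one>\<^sub>A \<equiv> \<one>\<^bsub>A\<^esub>"
abbreviation x :: "(nat \<Rightarrow> nat) \<Rightarrow> (nat free_word \<Rightarrow>\<^sub>0 'k) set" where "x \<equiv> qci_mon n q a"

lemma relators_closed: "qci_relators n q a \<subseteq> carrier F"
proof -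
  have g: "free_gen i \<in> carrier F" if "i \<in> {1..n}" for i
    unfolding free_gen_def using that by (intro word_closed) auto
  have p: "free_gen i ^ k \<in> carrier F" if "i \<in> {1..n}" for i k
    unfolding word_replicate[symmetric] using that by (intro word_closed) auto
  have m: "p - p' \<in> carrier F" if "p \<in> carrier F" "p' \<in> carrier F" for p p'
  proof -
    have "keys (p - p') \<subseteq> keys p \<union> keys p'"
      by (auto simp: in_keys_iff lookup_minus)
    then show ?thesis using that by (simp add: carrier_free_algebra) blast
  qed
  have s: "Poly_Mapping.map ((*) c) p \<in> carrier F" if "p \<in> carrier F" for c p
    using keys_scale[of c p] that by (auto simp: carrier_free_algebra)
  show ?thesis
    unfolding qci_relators_def by (auto intro!: g p m s free_algebra_mult_closed)
qed

lemma ideal: "ideal (qci_ideal n q a) F"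
  unfolding qci_ideal_def by (rule ring.genideal_ideal[OF free_algebra_ring relators_closed])

lemma ideal_submodule: "submodule class_ring (qci_ideal n q a) F"
proof -
  interpret ideal "qci_ideal n q a" F by (rule ideal)
  interpret F: vectorspace class_ring F by (rule free_algebra_vs)
  have "single 0 c \<in> carrier F" for c
    by (simp add: carrier_free_algebra words_def)
  then have "Poly_Mapping.map ((*) c) p \<in> qci_ideal n q a" if "p \<in> qci_ideal n q a" for c p
    using I_l_closed[OF that, of "single 0 c"] by (simp add: mult_map_scale_conv_mult)
  then show ?thesis
    unfolding submodule_def
    using F.module_axioms a_Hcarr additive_subgroup.a_closed[OF is_additive_subgroup]
      additive_subgroup.zero_closed[OF is_additive_subgroup] by auto
qed

sublocale Q: quotient_algebra F "qci_ideal n q a"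
  by (intro quotient_algebra.intro quotient_space.intro quotient_algebra_axioms.intro
      free_algebra_vs ideal_submodule free_algebra_ring ideal free_algebra_compatible)

lemma A_eq: "A = quot_space F (qci_ideal n q a)"
  by (simp add: qci_def)

lemma A_vs: "vectorspace class_ring A"
  unfolding A_eq by (rule Q.quot_vs)

lemma smult_closed: "y \<in> carrier A \<Longrightarrow> d *\<^sub>A y \<in> carrier A"
  by (rule vs_smult_closed[OF A_vs])

lemma smult_zero: "d *\<^sub>A \<zero>\<^bsub>A\<^esub> = \<zero>\<^bsub>A\<^esub>"
  by (rule module.smult_r_null[OF vectorspace.axioms(1)[OF A_vs]]) simp

lemma A_ring: "ring A"
  unfolding A_eq by (rule Q.quot_ring)

lemma A_compatible: "scalar_compatible A"
  unfolding A_eq by (rule Q.quot_compatible)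

sublocale A: ring A by (rule A_ring)

definition cls :: "nat list \<Rightarrow> (nat free_word \<Rightarrow>\<^sub>0 'k) set" where
  "cls w = Q.proj (word w)"

lemma cls_closed: "set w \<subseteq> {1..n} \<Longrightarrow> cls w \<in> carrier A"
  by (simp add: cls_def A_eq Q.carrier_quot word_closed)

lemma cls_append: "set u \<subseteq> {1..n} \<Longrightarrow> set w \<subseteq> {1..n} \<Longrightarrow> cls (u @ w) = cls u \<cdot> cls w"
  unfolding cls_def A_eq word_append by (simp add: Q.proj_mult word_closed)

lemma cls_Nil: "cls [] = \<one>\<^sub>A"
  by (simp add: cls_def A_eq Q.proj_one flip: zero_free_word_def)

lemma cls_gen: "cls [i] = qci_gen n q a i"
  by (simp add: cls_def Q.proj_def qci_gen_def free_gen_def)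

lemma relator_ideal: "r \<in> qci_relators n q a \<Longrightarrow> r \<in> qci_ideal n q a"
  unfolding qci_ideal_def using ring.genideal_self[OF free_algebra_ring relators_closed] by auto

lemma F_minus: "p \<in> carrier F \<Longrightarrow> p' \<in> carrier F \<Longrightarrow> p \<ominus>\<^bsub>F\<^esub> p' = p - p'"
  by (subst vs_minus[OF free_algebra_vs]) (auto intro!: poly_mapping_eqI simp: lookup_add lookup_minus lookup_scale)

lemma cls_power_zero:
  assumes "i \<in> {1..n}"
  shows "cls (replicate (a i) i) = \<zero>\<^bsub>A\<^esub>"
proof -
  have "word (replicate (a i) i) \<in> qci_ideal n q a"
    unfolding word_replicate using assms by (intro relator_ideal) (auto simp: qci_relators_def)
  moreover have "word (replicate (a i) i) \<in> carrier F"
    using assms by (intro word_closed) auto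
  ultimately show ?thesis unfolding cls_def A_eq by (simp add: Q.proj_zero_iff)
qed

lemma cls_swap2:
  assumes i: "i \<in> {1..n}" and j: "j \<in> {1..n}"
  shows "cls [j, i] = q i j *\<^sub>A cls [i, j]"
proof -
  define r where "r = Poly_Mapping.map ((*) (q i j)) (word [i, j])"
  have c: "word [j, i] \<in> carrier F" "word [i, j] \<in> carrier F"
    using i j by (auto intro!: word_closed)
  have rc: "r \<in> carrier F"
    using vs_smult_closed[OF free_algebra_vs c(2), of "q i j"] by (simp only: r_def free_algebra_simps)
  have gg: "free_gen k * free_gen l = word [k, l]" for k l
    by (simp add: free_gen_def mult_single)
  have "word [j, i] - r \<in> qci_ideal n q a"
    using i j unfolding r_def gg[symmetric] by (intro relator_ideal) (auto simp: qci_relators_def)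
  then have "Q.proj (word [j, i]) = Q.proj r"
    using c rc by (simp add: Q.proj_eq_iff F_minus)
  then show ?thesis unfolding cls_def A_eq Q.proj_smult[OF c(2)] r_def by simp
qed

lemma smult_mult_left: "y \<in> carrier A \<Longrightarrow> z \<in> carrier A \<Longrightarrow> (c *\<^sub>A y) \<cdot> z = c *\<^sub>A (y \<cdot> z)"
  and smult_mult_right: "y \<in> carrier A \<Longrightarrow> z \<in> carrier A \<Longrightarrow> y \<cdot> (c *\<^sub>A z) = c *\<^sub>A (y \<cdot> z)"
  using A_compatible by (auto simp: scalar_compatible_def)

lemma A_smult_smult: "y \<in> carrier A \<Longrightarrow> c *\<^sub>A (d *\<^sub>A y) = (c * d) *\<^sub>A y"
  using module.smult_assoc1[OF vectorspace.axioms(1)[OF A_vs], of c d y] by simp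

text \<open>
  Insertion sort with the commutation relations.  The scalar is left unspecified here: once the
  coordinate functionals are known to be well defined, they determine it (lemma \<open>cls_eq\<close>).
\<close>

lemma cls_insort:
  assumes "i \<in> {1..n}" "set w \<subseteq> {1..n}"
  shows "\<exists>c. cls (i # w) = c *\<^sub>A cls (insort i w)"
  using assms(2)
proof (induction w)
  case Nil
  then show ?case using assms(1) by (intro exI[of _ 1]) (simp add: vs_smult_one[OF A_vs] cls_closed)
next
  case (Cons j w)
  show ?case
  proof (cases "i \<le> j")
    case True
    then show ?thesis using Cons.prems assms(1)
      by (intro exI[of _ 1]) (simp add: vs_smult_one[OF A_vs] cls_closed)
  next
    case False
    obtain c where c: "cls (i # w) = c *\<^sub>A cls (insort i w)" using Cons by auto
    have s: "set (insort i w) \<subseteq> {1..n}" using Cons.prems assms(1) by (simp add: set_insort_key)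
    have j: "j \<in> {1..n}" and w: "set w \<subseteq> {1..n}" using Cons.prems by auto
    have "cls (i # j # w) = cls [i, j] \<cdot> cls w"
      using cls_append[of "[i, j]" w] j w assms(1) by simp
    also have "\<dots> = q j i *\<^sub>A (cls [j, i] \<cdot> cls w)"
      using j w assms(1) by (simp add: cls_swap2[of j i] smult_mult_left cls_closed)
    also have "cls [j, i] \<cdot> cls w = cls [j] \<cdot> cls (i # w)"
      using cls_append[of "[j, i]" w] cls_append[of "[j]" "i # w"] j w assms(1) by simp
    also have "\<dots> = c *\<^sub>A cls (j # insort i w)"
      using cls_append[of "[j]" "insort i w"] j s by (simp add: c smult_mult_right cls_closed)
    finally show ?thesis using False j s by (auto simp: A_smult_smult cls_closed)
  qed
qed

lemma cls_sort: "set w \<subseteq> {1..n} \<Longrightarrow> \<exists>c. cls w = c *\<^sub>A cls (sort w)"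
proof (induction w)
  case Nil
  then show ?case by (intro exI[of _ 1]) (simp add: vs_smult_one[OF A_vs] cls_closed)
next
  case (Cons i w)
  then obtain c where c: "cls w = c *\<^sub>A cls (sort w)" by auto
  have i: "i \<in> {1..n}" and w: "set w \<subseteq> {1..n}" using Cons.prems by auto
  obtain d where d: "cls (i # sort w) = d *\<^sub>A cls (insort i (sort w))"
    using cls_insort[of i "sort w"] i w by auto
  have s: "set (insort i (sort w)) \<subseteq> {1..n}" using i w by (simp add: set_insort_key)
  have "cls (i # w) = cls [i] \<cdot> cls w" using cls_append[of "[i]" w] i w by simp
  also have "\<dots> = c *\<^sub>A cls (i # sort w)"
    using cls_append[of "[i]" "sort w"] i w by (simp add: c smult_mult_right cls_closed)
  finally show ?case using s by (auto simp: d A_smult_smult cls_closed)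
qed

lemma cls_replicate: "i \<in> {1..n} \<Longrightarrow> cls (replicate k i) = qci_gen n q a i [^]\<^bsub>A\<^esub> k"
proof (induction k)
  case (Suc k)
  have "set (replicate k i) \<subseteq> {1..n}" using Suc.prems by auto
  then have "cls (replicate (Suc k) i) = cls (replicate k i) \<cdot> cls [i]"
    using Suc.prems cls_append[of "replicate k i" "[i]"] by (simp add: replicate_append_same)
  then show ?case using Suc by (simp add: cls_gen)
qed (simp add: cls_Nil)

lemma mon_eq_cls: "x v = cls (std_word n v)"
proof -
  have "set is \<subseteq> {1..n} \<Longrightarrow> foldr (\<lambda>i y. (qci_gen n q a i [^]\<^bsub>A\<^esub> v i) \<cdot> y) is \<one>\<^sub>A
      = cls (concat (map (\<lambda>i. replicate (v i) i) is))" for "is"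
  proof (induction "is")
    case (Cons i "is")
    have "set (concat (map (\<lambda>i. replicate (v i) i) is)) \<subseteq> {1..n}" using Cons.prems by auto
    moreover have "set (replicate (v i) i) \<subseteq> {1..n}" using Cons.prems by auto
    ultimately show ?case using Cons by (simp add: cls_append cls_replicate)
  qed (simp add: cls_Nil)
  then show ?thesis by (simp add: qci_mon_def std_word_def atLeastLessThanSuc_atLeastAtMost del: upt_Suc)
qed

text \<open>
  After sorting, equal letters are adjacent, and a power \<open>x\<^sub>i\<^sup>k\<close> with \<open>k \<ge> a\<^sub>i\<close> is zero.
\<close>

lemma cls_zero:
  assumes w: "set w \<subseteq> {1..n}" and nV: "count_list w \<notin> V"
  shows "cls w = \<zero>\<^bsub>A\<^esub>"
proof -
  have "count_list w i = 0" if "i \<notin> {1..n}" for i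
    using that w by (auto simp: count_list_0_iff)
  then obtain i where i: "i \<in> {1..n}" "count_list w i \<ge> a i"
    using nV a_ge_2 by (force simp: exponents_def)
  define v where "v = count_list w"
  define u1 where "u1 = concat (map (\<lambda>i. replicate (v i) i) [1..<i]) @ replicate (v i - a i) i"
  define u2 where "u2 = concat (map (\<lambda>i. replicate (v i) i) [Suc i..<Suc n])"
  have "[1..<Suc n] = [1..<i] @ i # [Suc i..<Suc n]"
    using i(1) upt_add_eq_append[of 1 i "Suc n - i"] upt_conv_Cons[of i "Suc n"]
    by (simp del: upt_Suc)
  then have "std_word n v = concat (map (\<lambda>i. replicate (v i) i) [1..<i]) @ replicate (v i) i @ u2"
    by (simp add: std_word_def u2_def del: upt_Suc)
  also have "replicate (v i) i = replicate (v i - a i) i @ replicate (a i) i"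
    using i(2) by (simp add: v_def flip: replicate_add)
  finally have std: "std_word n v = u1 @ replicate (a i) i @ u2" by (simp add: u1_def)
  have s: "set u1 \<subseteq> {1..n}" "set u2 \<subseteq> {1..n}" "set (replicate (a i) i) \<subseteq> {1..n}"
    using set_std_word[of n v] unfolding std by auto
  then have "cls (std_word n v) = cls u1 \<cdot> (cls (replicate (a i) i) \<cdot> cls u2)"
    unfolding std by (simp add: cls_append)
  then have 0: "cls (std_word n v) = \<zero>\<^bsub>A\<^esub>"
    using s by (simp add: cls_power_zero[OF i(1)] cls_closed)
  obtain c where "cls w = c *\<^sub>A cls (sort w)" using cls_sort[OF w] by auto
  then show ?thesis
    using 0 smult_zero by (simp add: sort_eq_std_word[OF w] v_def)
qed

definition word_co :: "(nat \<Rightarrow> nat) \<Rightarrow> nat free_word \<Rightarrow> 'k" where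
  "word_co v w = (if count_list (letters w) = v then word_coeff q (letters w) else 0)"

text \<open>
  The coordinate functionals vanish on the ideal: multiplying a relator by words on both sides
  gives words with too many equal letters, or two words that differ by a transposition.
\<close>

lemma word_co_ideal:
  assumes v: "v \<in> V" and p: "p \<in> qci_ideal n q a"
  shows "extend_linearly (word_co v) p = 0"
proof -
  let ?e = "extend_linearly (word_co v)"
  let ?N = "{p \<in> carrier F. \<forall>u c w d. ?e (single u c * p * single w d) = 0}"
  have N_ideal: "ideal ?N F"
  proof (rule idealI[OF free_algebra_ring])
    show "subgroup ?N (add_monoid F)"
    proof (rule Q.V.add.subgroupI)
      show "?N \<noteq> {}" by (auto intro!: exI[of _ 0] simp: carrier_free_algebra)
      fix p assume p: "p \<in> ?N"
      have "\<ominus>\<^bsub>F\<^esub> p = - p" using p by (intro Q.V.minus_equality) (auto simp: carrier_free_algebra in_keys_iff subset_iff)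
      moreover have "?e (- r) = - ?e r" for r using extend_linearly_minus[of "word_co v" 0 r] by simp
      ultimately show "\<ominus>\<^bsub>F\<^esub> p \<in> ?N" using p Q.V.a_inv_closed[of p] by simp
    next
      fix p p' assume "p \<in> ?N" "p' \<in> ?N"
      then show "p \<oplus>\<^bsub>F\<^esub> p' \<in> ?N"
        using Q.V.a_closed[of p p'] by (simp add: algebra_simps extend_linearly_add)
    qed auto
    fix p r assume p: "p \<in> ?N" and r: "r \<in> carrier F"
    have l: "?e (single u c * (r * p) * single w d) = 0" for u c w d
    proof (induction r rule: poly_mapping_add_induct)
      case (add r z b)
      have "single u c * ((r + single z b) * p) * single w d
          = single u c * (r * p) * single w d
            + single (u + z) (c * b) * p * single w d"
        unfolding mult_single[symmetric] by (simp only: algebra_simps)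
      then show ?case using add p by (simp add: extend_linearly_add)
    qed simp
    have r': "?e (single u c * (p * r) * single w d) = 0" for u c w d
    proof (induction r rule: poly_mapping_add_induct)
      case (add r z b)
      have "single u c * (p * (r + single z b)) * single w d
          = single u c * (p * r) * single w d
            + single u c * p * single (z + w) (b * d)"
        unfolding mult_single[symmetric] by (simp only: algebra_simps)
      then show ?case using add p by (simp add: extend_linearly_add)
    qed simp
    show "r \<otimes>\<^bsub>F\<^esub> p \<in> ?N" "p \<otimes>\<^bsub>F\<^esub> r \<in> ?N"
      using p r l r' by (auto simp: free_algebra_mult_closed)
  qed
  have "?e (single u c * r * single w d) = 0"
    if r: "r \<in> qci_relators n q a" for r u c w d
  proof -
    consider i where "i \<in> {1..n}" "r = free_gen i ^ a i"
      | i j where "i \<in> {1..n}" "j \<in> {1..n}"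
          "r = free_gen j * free_gen i - Poly_Mapping.map ((*) (q i j)) (free_gen i * free_gen j)"
      using r by (auto simp: qci_relators_def)
    then show ?thesis
    proof cases
      case 1
      have "count_list (letters u @ replicate (a i) i @ letters w) i > v i"
      proof -
        have "v i \<le> a i - 1" using v 1(1) by (auto simp: exponents_def)
        then show ?thesis using a_ge_2[OF 1(1)] by (simp add: count_replicate)
      qed
      then have "word_co v (u + FWord (replicate (a i) i) + w) = 0"
        by (auto simp: word_co_def)
      then show ?thesis by (simp add: 1(2) word_replicate[symmetric] mult_single)
    next
      case 2
      have "word_co v (u + FWord [j, i] + w) = q i j * word_co v (u + FWord [i, j] + w)"
      proof -
        have "count_list (letters u @ [j, i] @ letters w) = count_list (letters u @ [i, j] @ letters w)"
          by (rule ext) simp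
        moreover have "word_coeff q (letters u @ j # i # letters w) = q i j * word_coeff q (letters u @ i # j # letters w)"
          using 2 by (intro word_coeff_swap q_inverse) (auto simp: q_diag)
        ultimately show ?thesis by (simp add: word_co_def)
      qed
      moreover have "single u c * r * single w d =
          single (u + FWord [j, i] + w) (c * d) - single (u + FWord [i, j] + w) (c * q i j * d)"
        unfolding 2(3) free_gen_def by (simp add: algebra_simps mult_single scale_single)
      ultimately show ?thesis by (simp add: extend_linearly_minus)
    qed
  qed
  then have "qci_relators n q a \<subseteq> ?N" using relators_closed by auto
  then have "qci_ideal n q a \<subseteq> ?N"
    unfolding qci_ideal_def by (rule ring.genideal_minimal[OF free_algebra_ring N_ideal])
  then have "p \<in> ?N" using p by (rule subsetD)
  then have "?e (single 0 1 * p * single 0 1) = 0"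
    unfolding mem_Collect_eq by (elim conjE allE)
  then show ?thesis by simp
qed

definition co :: "(nat \<Rightarrow> nat) \<Rightarrow> (nat free_word \<Rightarrow>\<^sub>0 'k) set \<Rightarrow> 'k" where
  "co v Y = extend_linearly (word_co v) (SOME p. p \<in> Y)"

lemma co_proj:
  assumes v: "v \<in> V" and p: "p \<in> carrier F"
  shows "co v (Q.proj p) = extend_linearly (word_co v) p"
proof -
  note rep = Q.chosen_representative[OF p]
  have dual: "extend_linearly (word_co v) \<in> dual_space F"
    by (rule dual_spaceI) (simp_all add: extend_linearly_add extend_linearly_scale)
  have "extend_linearly (word_co v) (SOME r. r \<in> Q.proj p) - extend_linearly (word_co v) p = 0"
    using word_co_ideal[OF v rep(2)] dual_minus[OF free_algebra_vs dual rep(1) p] by simp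
  then show ?thesis by (simp add: co_def)
qed

lemma co_cls: "v \<in> V \<Longrightarrow> set w \<subseteq> {1..n} \<Longrightarrow> co v (cls w) = (if count_list w = v then word_coeff q w else 0)"
  by (simp add: cls_def co_proj word_closed word_co_def)

lemma co_dual: "v \<in> V \<Longrightarrow> co v \<in> dual_space A"
  by (rule dual_spaceI)
    (auto simp: A_eq Q.carrier_quot Q.proj_add[simplified] Q.proj_smult[simplified] co_proj extend_linearly_add extend_linearly_scale
      vs_add_closed[OF free_algebra_vs, simplified] vs_smult_closed[OF free_algebra_vs, simplified])

lemma count_mon: "v \<in> V \<Longrightarrow> count_list (std_word n v) = v"
  by (rule count_std_word) (simp add: exponents_def)

lemma mon_closed: "x v \<in> carrier A"
  unfolding mon_eq_cls by (rule cls_closed[OF set_std_word])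

lemma co_mon: "u \<in> V \<Longrightarrow> v \<in> V \<Longrightarrow> co u (x v) = (if u = v then 1 else 0)"
  unfolding mon_eq_cls by (subst co_cls[OF _ set_std_word]) (auto simp: count_mon word_coeff_sorted sorted_std_word)

lemma cls_eq:
  assumes w: "set w \<subseteq> {1..n}" and v: "count_list w \<in> V"
  shows "cls w = word_coeff q w *\<^sub>A x (count_list w)"
proof -
  obtain c where c: "cls w = c *\<^sub>A x (count_list w)"
    using cls_sort[OF w] by (auto simp: mon_eq_cls sort_eq_std_word[OF w])
  have "word_coeff q w = co (count_list w) (cls w)" by (simp add: co_cls[OF v w])
  also have "\<dots> = c" by (simp add: c dual_smult[OF co_dual[OF v]] mon_closed co_mon v)
  finally show ?thesis using c by simp
qed

lemma finite_V: "finite V"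
proof (rule finite_subset)
  define B where "B = (\<Union>i\<in>{1..n}. {..a i - 1})"
  have "v i \<in> B" if "v \<in> V" "i \<in> {1..n}" for v i
    unfolding B_def using that by (intro UN_I[of i]) (simp_all add: exponents_def)
  then show "V \<subseteq> {v. \<forall>i. (i \<in> {1..n} \<longrightarrow> v i \<in> B) \<and> (i \<notin> {1..n} \<longrightarrow> v i = 0)}"
    unfolding exponents_def by blast
  have "finite B" by (simp add: B_def)
  then show "finite {v. \<forall>i. (i \<in> {1..n} \<longrightarrow> v i \<in> B) \<and> (i \<notin> {1..n} \<longrightarrow> v i = 0)}"
    by (intro finite_set_of_finite_funs finite_atLeastAtMost)
qed

lemma zero_closed_A: "\<zero>\<^bsub>A\<^esub> \<in> carrier A"
  by (rule vs_zero_closed[OF A_vs])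

text \<open>
  The expansion in monomials is linear, and it holds for classes of words, which span.
\<close>

lemma A_based: "based_space A V x co"
proof (rule based_space.intro)
  let ?\<Phi> = "\<lambda>y. finsum A (\<lambda>v. co v y *\<^sub>A x v) V"
  have lin: "?\<Phi> \<in> linear_maps A A"
    by (rule finsum_functionals_linear[OF A_vs]) (auto simp: mon_closed co_dual)
  have proj_lin: "Q.proj \<in> linear_maps (free_space (words n)) A"
    using Q.proj_linear by (simp add: A_eq linear_maps_free_algebra)
  have "?\<Phi> (cls w) = cls w" if w: "set w \<subseteq> {1..n}" for w
  proof (cases "count_list w \<in> V")
    case True
    have "?\<Phi> (cls w) = finsum A (\<lambda>v. if count_list w = v then word_coeff q w *\<^sub>A x v else \<zero>\<^bsub>A\<^esub>) V"
      using w by (intro A.add.finprod_cong')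
        (auto simp: co_cls vs_smult_zero[OF A_vs] mon_closed smult_closed zero_closed_A)
    also have "\<dots> = word_coeff q w *\<^sub>A x (count_list w)"
      using True by (simp add: A.add.finprod_singleton finite_V mon_closed smult_closed)
    finally show ?thesis unfolding cls_eq[OF w True, symmetric] .
  next
    case False
    have "?\<Phi> \<zero>\<^bsub>A\<^esub> = \<zero>\<^bsub>A\<^esub>" by (rule linear_maps_zero[OF A_vs A_vs lin])
    then show ?thesis by (simp add: cls_zero[OF w False])
  qed
  then have word: "?\<Phi> (Q.proj (single w 1)) = Q.proj (single w 1)" if "w \<in> words n" for w
    using that by (cases w) (simp add: cls_def words_def)
  have expand: "?\<Phi> y = y" if y: "y \<in> carrier A" for y
  proof -
    obtain p where p: "p \<in> carrier F" "y = Q.proj p" using y by (auto simp: A_eq Q.carrier_quot)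
    have keys: "keys p \<subseteq> words n" using p(1) by (simp add: carrier_free_algebra)
    have "(\<lambda>p. ?\<Phi> (Q.proj p)) p = Q.proj p"
      by (rule free_space_linear_eqI[where f = "\<lambda>p. ?\<Phi> (Q.proj p)" and g = Q.proj and p = p and U = A and B = "words n"])
        (rule A_vs, rule linear_maps_comp[OF proj_lin lin], rule proj_lin, erule word, rule keys)
    then show ?thesis unfolding p(2) .
  qed
  show "y = \<zero>\<^bsub>A\<^esub>" if "y \<in> carrier A" "\<And>v. v \<in> V \<Longrightarrow> co v y = 0" for y
  proof -
    have "?\<Phi> y = \<zero>\<^bsub>A\<^esub>"
      by (intro A.add.finprod_one_eqI) (simp add: that vs_smult_zero[OF A_vs] mon_closed)
    then show ?thesis using expand[OF that(1)] by simp
  qed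
qed (auto simp: A_vs finite_V mon_closed co_dual co_mon)

text \<open>
  The description of the dual basis by its values on monomials determines it, because the
  monomials span.
\<close>

lemma qci_dual_eq:
  assumes v: "v \<in> V"
  shows "qci_dual n q a v = restrict (co v) (carrier A)"
  unfolding qci_dual_def
proof (rule the_equality)
  interpret B: based_space A V x co by (rule A_based)
  have r: "restrict (co v) (carrier A) \<in> dual_space A"
    by (rule dual_spaceI) (simp_all add: dual_add[OF co_dual[OF v]] dual_smult[OF co_dual[OF v]]
        vs_add_closed[OF A_vs] smult_closed)
  then show "restrict (co v) (carrier A) \<in> dual_space A \<and> restrict (co v) (carrier A) \<in> extensional (carrier A) \<and>
    (\<forall>u\<in>V. restrict (co v) (carrier A) (x u) = (if u = v then 1 else 0))"
    using v by (auto simp: mon_closed co_mon)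
  fix f assume f: "f \<in> dual_space A \<and> f \<in> extensional (carrier A) \<and> (\<forall>u\<in>V. f (x u) = (if u = v then 1 else 0))"
  show "f = restrict (co v) (carrier A)"
  proof (rule extensionalityI)
    show "f y = restrict (co v) (carrier A) y" if "y \<in> carrier A" for y
      using f by (intro B.dual_eqI[OF _ r _ that]) (auto simp: mon_closed co_mon v)
  qed (use f in auto)
qed

sublocale B: based_space A V x "qci_dual n q a"
proof (rule based_space.intro)
  interpret C: based_space A V x co by (rule A_based)
  show "qci_dual n q a v \<in> dual_space A" if v: "v \<in> V" for v
    unfolding qci_dual_eq[OF v]
    by (rule dual_spaceI) (simp_all add: dual_add[OF co_dual[OF v]] dual_smult[OF co_dual[OF v]]
        vs_add_closed[OF A_vs] smult_closed)
  show "y = \<zero>\<^bsub>A\<^esub>" if "y \<in> carrier A" "\<And>v. v \<in> V \<Longrightarrow> qci_dual n q a v y = 0" for y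
    using that by (intro C.separate) (auto simp: qci_dual_eq)
qed (auto simp: A_vs finite_V mon_closed qci_dual_eq co_mon)

lemma mon_mult:
  assumes u: "u \<in> V" and v: "v \<in> V"
  shows "x u \<cdot> x v = (if (\<lambda>i. u i + v i) \<in> V
      then q_form n q u v *\<^sub>A x (\<lambda>i. u i + v i) else \<zero>\<^bsub>A\<^esub>)"
proof -
  let ?w = "std_word n u @ std_word n v"
  have w: "set ?w \<subseteq> {1..n}" using set_std_word by auto
  have count: "count_list ?w = (\<lambda>i. u i + v i)" by (simp add: fun_eq_iff count_mon u v)
  have "word_coeff q ?w = q_form n q u v"
    by (simp add: word_coeff_append word_coeff_sorted sorted_std_word crossings_q_form[OF set_std_word set_std_word] count_mon u v)
  moreover have "x u \<cdot> x v = cls ?w" unfolding mon_eq_cls by (rule cls_append[OF set_std_word set_std_word, symmetric])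
  ultimately show ?thesis using cls_eq[OF w] cls_zero[OF w] by (auto simp: count)
qed

lemma mon_zero: "x (\<lambda>_. 0) = \<one>\<^sub>A"
proof -
  have "std_word n (\<lambda>_. 0) = []" by (auto simp: std_word_def)
  then show ?thesis by (simp add: mon_eq_cls cls_Nil)
qed

lemma mon_unit:
  assumes "i \<in> {1..n}"
  shows "x (unit_exponent i) = qci_gen n q a i"
proof -
  have "std_word n (count_list [i]) = [i]" using sort_eq_std_word[of "[i]" n] assms by simp
  moreover have "count_list [i] = unit_exponent i" by (auto simp: unit_exponent_def fun_eq_iff)
  ultimately show ?thesis by (simp add: mon_eq_cls cls_gen)
qed

lemma A_fin_dim_algebra: "fin_dim_algebra A"
  unfolding fin_dim_algebra_def using A_ring A_vs B.fin_dim A_compatible by (simp add: scalar_compatible_def)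

end


section \<open>Identities between the structure coefficients\<close>

text \<open>The factor in \<open>x\<^sub>j x\<^sub>i = swap_coeff q j i x\<^sub>e\<close> with \<open>e\<close> the sum of the unit vectors at \<open>i\<close> and \<open>j\<close>.\<close>

definition swap_coeff :: "(nat \<Rightarrow> nat \<Rightarrow> 'k::field) \<Rightarrow> nat \<Rightarrow> nat \<Rightarrow> 'k" where
  "swap_coeff q j i = (if i < j then q i j else 1)"

lemma q_form_swap_coeff:
  "q_form n q u v = (\<Prod>j = 1..n. \<Prod>i = 1..n. swap_coeff q j i ^ (u j * v i))"
  unfolding q_form_def
proof (rule prod.cong[OF refl])
  fix j assume "j \<in> {1..n}"
  then show "(\<Prod>i = 1..<j. q i j ^ (u j * v i)) = (\<Prod>i = 1..n. swap_coeff q j i ^ (u j * v i))"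
    by (intro prod.mono_neutral_cong_left) (auto simp: swap_coeff_def)
qed

lemma q_form_add_left: "q_form n q (\<lambda>i. u i + u' i) v = q_form n q u v * q_form n q u' v"
  by (simp add: q_form_def algebra_simps power_add prod.distrib)

lemma q_form_add_right: "q_form n q u (\<lambda>i. v i + v' i) = q_form n q u v * q_form n q u v'"
  by (simp add: q_form_def algebra_simps power_add prod.distrib)

lemma q_form_zero [simp]: "q_form n q (\<lambda>_. 0) v = 1" "q_form n q v (\<lambda>_. 0) = 1"
  by (simp_all add: q_form_def)

lemma q_form_unit:
  assumes "k \<in> {1..n}" "l \<in> {1..n}"
  shows "q_form n q (unit_exponent k) (unit_exponent l) = swap_coeff q k l"
proof -
  have "swap_coeff q j i ^ (unit_exponent k j * unit_exponent l i) =
      (if i = l then if j = k then swap_coeff q k l else 1 else 1)" for i j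
    by (simp add: unit_exponent_def)
  then show ?thesis using assms by (simp add: q_form_swap_coeff)
qed

lemma prod_square_split:
  fixes f :: "nat \<Rightarrow> nat \<Rightarrow> 'k::field"
  shows "(\<Prod>k = 1..n. \<Prod>j = 1..n. f k j)
    = (\<Prod>k = 1..n. \<Prod>j = 1..<k. f k j * f j k) * (\<Prod>k = 1..n. f k k)"
proof (induction n)
  case (Suc n)
  have "{1..<Suc n} = {1..n}" by auto
  then show ?case using Suc by (simp add: prod.distrib mult_ac)
qed simp

lemma exponent_induct [consumes 1, case_names zero add]:
  assumes "\<forall>i. i \<notin> {1..n} \<longrightarrow> v i = 0"
    and "P (\<lambda>_. 0)"
    and "\<And>v i. i \<in> {1..n} \<Longrightarrow> \<forall>i. i \<notin> {1..n} \<longrightarrow> v i = 0 \<Longrightarrow> P v \<Longrightarrow> P (\<lambda>j. v j + unit_exponent i j)"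
  shows "P (v :: nat \<Rightarrow> nat)"
  using assms(1)
proof (induction "\<Sum>i = 1..n. v i" arbitrary: v)
  case 0
  then have "v = (\<lambda>_. 0)" by (intro ext) (metis finite_atLeastAtMost sum_eq_0_iff)
  then show ?case using assms(2) by simp
next
  case (Suc k)
  then obtain i where i: "i \<in> {1..n}" "v i > 0"
    by (metis Suc_neq_Zero gr0I sum.neutral)
  define w where "w = (\<lambda>j. v j - unit_exponent i j)"
  have v: "v = (\<lambda>j. w j + unit_exponent i j)"
    using i by (auto simp: w_def unit_exponent_def fun_eq_iff)
  have "(\<Sum>j = 1..n. unit_exponent i j) = 1" using i by (simp add: unit_exponent_def)
  then have "(\<Sum>j = 1..n. v j) = (\<Sum>j = 1..n. w j) + 1" by (subst v) (simp add: sum.distrib)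
  then have "k = (\<Sum>j = 1..n. w j)" using Suc(2) by simp
  moreover have w0: "\<forall>j. j \<notin> {1..n} \<longrightarrow> w j = 0" using Suc.prems by (simp add: w_def)
  ultimately have "P w" using Suc(1) by blast
  then show ?case using assms(3)[OF i(1) w0] v by simp
qed

context quantum_complete_intersection
begin

abbreviation \<tau> :: "nat \<Rightarrow> nat" where "\<tau> \<equiv> top_exponent n a"
abbreviation co_x :: "(nat \<Rightarrow> nat) \<Rightarrow> (nat free_word \<Rightarrow>\<^sub>0 'k) set \<Rightarrow> 'k" ("x\<^sup>*") where
  "x\<^sup>* \<equiv> qci_dual n q a"
abbreviation unit :: "nat \<Rightarrow> nat \<Rightarrow> nat" where "unit \<equiv> unit_exponent"
abbreviation form :: "(nat \<Rightarrow> nat) \<Rightarrow> (nat \<Rightarrow> nat) \<Rightarrow> 'k" where "form \<equiv> q_form n q"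

lemma V_D: "v \<in> V \<Longrightarrow> \<forall>i. i \<notin> {1..n} \<longrightarrow> v i = 0" "v \<in> V \<Longrightarrow> v i \<le> \<tau> i"
  by (auto simp: exponents_def top_exponent_def)

lemma V_iff: "v \<in> V \<longleftrightarrow> (\<forall>i. v i \<le> \<tau> i)"
  by (force simp: exponents_def top_exponent_def)

lemma zero_V: "(\<lambda>_. 0) \<in> V"
  by (simp add: V_iff)

lemma top_V: "\<tau> \<in> V"
  by (simp add: V_iff)

lemma top_pos: "i \<in> {1..n} \<Longrightarrow> \<tau> i \<ge> 1"
  using a_ge_2[of i] by (simp add: top_exponent_def)

lemma unit_V: "i \<in> {1..n} \<Longrightarrow> unit i \<in> V"
  using top_pos[of i] by (simp add: V_iff unit_exponent_def)

lemma compl_V: "\<tau> - v \<in> V"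
  by (simp add: V_iff)

lemma compl_compl: "v \<in> V \<Longrightarrow> \<tau> - (\<tau> - v) = v"
  by (auto simp: V_iff fun_eq_iff)

lemma compl_add: "v \<in> V \<Longrightarrow> (\<lambda>i. (\<tau> - v) i + v i) = \<tau>" "v \<in> V \<Longrightarrow> (\<lambda>i. v i + (\<tau> - v) i) = \<tau>"
  by (auto simp: V_iff fun_eq_iff)

lemma V_add_D: "(\<lambda>i. u i + v i) \<in> V \<Longrightarrow> u \<in> V" "(\<lambda>i. u i + v i) \<in> V \<Longrightarrow> v \<in> V"
  unfolding V_iff by (meson add_leD1 add_leD2)+

lemma q_nonzero: "i \<in> {1..n} \<Longrightarrow> j \<in> {1..n} \<Longrightarrow> q i j \<noteq> 0"
  using q_inverse[of i j] by auto

lemma form_nonzero: "form u v \<noteq> 0"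
  unfolding q_form_def by (auto simp: q_nonzero)

lemma swap_coeff_swap:
  "i \<in> {1..n} \<Longrightarrow> j \<in> {1..n} \<Longrightarrow> swap_coeff q j i = q i j * swap_coeff q i j"
  by (cases i j rule: linorder_cases) (simp_all add: swap_coeff_def q_diag q_inverse)

lemma swap_coeff_nonzero: "i \<in> {1..n} \<Longrightarrow> j \<in> {1..n} \<Longrightarrow> swap_coeff q j i \<noteq> 0"
  by (simp add: swap_coeff_def q_nonzero)

text \<open>The quadratic part cancels, so \<open>h\<close> is multiplicative.\<close>

lemma h_coeff_eq:
  assumes "v \<in> V"
  shows "h_coeff n q a v = form \<tau> v / form v \<tau>"
proof -
  have "form \<tau> v = form (\<tau> - v) v * form v v" "form v \<tau> = form v (\<tau> - v) * form v v"
    using q_form_add_left[of n q "\<tau> - v" v v] q_form_add_right[of n q v "\<tau> - v" v]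
    unfolding compl_add(1)[OF assms] by simp_all
  then show ?thesis by (simp add: h_coeff_def form_nonzero)
qed

end

locale compatible_permutation = quantum_complete_intersection n q a
  for n and q :: "nat \<Rightarrow> nat \<Rightarrow> 'k::field" and a +
  fixes \<pi> :: "nat \<Rightarrow> nat"
  assumes compatible: "compatible n q a \<pi>"
begin

lemma \<pi>_permutes: "\<pi> permutes {1..n}"
  and \<pi>_a: "i \<in> {1..n} \<Longrightarrow> a (\<pi> i) = a i"
  and \<pi>_q: "i \<in> {1..n} \<Longrightarrow> j \<in> {1..n} \<Longrightarrow> q (\<pi> i) (\<pi> j) = q j i"
  using compatible by (auto simp: compatible_def)

lemma \<pi>_in: "\<pi> i \<in> {1..n} \<longleftrightarrow> i \<in> {1..n}"
  by (rule permutes_in_image[OF \<pi>_permutes])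

abbreviation act :: "(nat \<Rightarrow> nat) \<Rightarrow> nat \<Rightarrow> nat" where "act \<equiv> perm_exponent \<pi>"

lemma act_\<pi>: "act v (\<pi> i) = v i"
  by (simp add: perm_exponent_def permutes_inverses(2)[OF \<pi>_permutes])

lemma act_unit: "act (unit k) = unit (\<pi> k)"
  using permutes_inv_eq[OF \<pi>_permutes] by (auto simp: perm_exponent_def unit_exponent_def fun_eq_iff)

lemma act_zero: "act (\<lambda>_. 0) = (\<lambda>_. 0)"
  by (simp add: perm_exponent_def)

lemma act_add: "act (\<lambda>i. u i + v i) = (\<lambda>i. act u i + act v i)"
  by (simp add: perm_exponent_def)

lemma act_top: "act \<tau> = \<tau>"
proof
  fix i
  obtain j where j: "i = \<pi> j" using permutes_surj[OF \<pi>_permutes] by (metis surjD)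
  show "act \<tau> i = \<tau> i"
    using \<pi>_a[of j] by (simp only: j act_\<pi> top_exponent_def \<pi>_in) simp
qed

lemma act_V: "act v \<in> V \<longleftrightarrow> v \<in> V"
proof -
  have "act v \<in> V \<longleftrightarrow> (\<forall>i. act v i \<le> act \<tau> i)" by (simp add: V_iff act_top)
  also have "\<dots> \<longleftrightarrow> (\<forall>i. v i \<le> \<tau> i)"
    using bij_is_surj[OF permutes_bij[OF \<pi>_permutes]] by (metis act_\<pi> surjD)
  finally show ?thesis by (simp add: V_iff)
qed

lemma act_inj: "act u = act v \<longleftrightarrow> u = v"
  by (metis act_\<pi> ext)

lemma act_bij: "bij_betw act V V"
proof -
  have "inj_on act V" by (simp add: inj_on_def act_inj)
  moreover have "act ` V \<subseteq> V" by (auto simp: act_V)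
  ultimately show ?thesis by (metis bij_betw_def endo_inj_surj finite_V)
qed

lemma form_act: "form (act v) (act u) = (\<Prod>j = 1..n. \<Prod>i = 1..n. swap_coeff q (\<pi> j) (\<pi> i) ^ (v j * u i))"
proof -
  have permute: "(\<Prod>i = 1..n. f i) = (\<Prod>i = 1..n. f (\<pi> i))" for f :: "nat \<Rightarrow> 'k"
    using prod.permute[OF \<pi>_permutes, of f] by (simp only: o_def)
  have "(\<Prod>j = 1..n. \<Prod>i = 1..n. swap_coeff q j i ^ (act v j * act u i))
      = (\<Prod>j = 1..n. \<Prod>i = 1..n. swap_coeff q (\<pi> j) i ^ (v j * act u i))"
    by (subst permute) (simp only: act_\<pi>)
  also have "\<dots> = (\<Prod>j = 1..n. \<Prod>i = 1..n. swap_coeff q (\<pi> j) (\<pi> i) ^ (v j * u i))"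
  proof (rule prod.cong[OF refl])
    show "(\<Prod>i = 1..n. swap_coeff q (\<pi> j) i ^ (v j * act u i)) = (\<Prod>i = 1..n. swap_coeff q (\<pi> j) (\<pi> i) ^ (v j * u i))" for j
      by (subst permute) (simp only: act_\<pi>)
  qed
  finally show ?thesis by (simp add: q_form_swap_coeff)
qed

lemma S_coeff_eq: "S_coeff n q \<pi> c v = (\<Prod>i = 1..n. c i ^ v i) *
     (\<Prod>k = 1..n. \<Prod>j = 1..<k. swap_coeff q (\<pi> k) (\<pi> j) ^ (v j * v k))"
proof -
  have "form (unit (\<pi> k)) (unit (\<pi> j)) = swap_coeff q (\<pi> k) (\<pi> j)" if "k \<in> {1..n}" "j \<in> {1..<k}" for k j
    using that by (intro q_form_unit) (simp_all only: \<pi>_in, simp_all)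
  then show ?thesis unfolding S_coeff_def act_unit by simp
qed

lemma q_perm_eq: "q_perm n q a \<pi> * (\<Prod>i = 1..n. c i ^ (a i - 1)) = S_coeff n q \<pi> c \<tau>"
proof -
  have "q_perm n q a \<pi> = (\<Prod>k = 1..n. \<Prod>j = 1..<k. swap_coeff q (\<pi> k) (\<pi> j) ^ (\<tau> j * \<tau> k))"
  proof -
    have "form (unit (\<pi> k)) (unit (\<pi> j)) = swap_coeff q (\<pi> k) (\<pi> j)" if "k \<in> {1..n}" "j \<in> {1..<k}" for k j
      using that by (intro q_form_unit) (simp_all only: \<pi>_in, simp_all)
    then show ?thesis unfolding q_perm_def act_unit
      by (intro prod.cong refl) (auto simp: top_exponent_def mult.commute)
  qed
  moreover have "(\<Prod>i = 1..n. c i ^ (a i - 1)) = (\<Prod>i = 1..n. c i ^ \<tau> i)"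
    by (intro prod.cong) (auto simp: top_exponent_def)
  ultimately show ?thesis by (simp add: S_coeff_eq)
qed

lemma S_coeff_zero: "S_coeff n q \<pi> c (\<lambda>_. 0) = 1"
  by (simp add: S_coeff_def)

lemma S_coeff_unit:
  assumes "i \<in> {1..n}"
  shows "S_coeff n q \<pi> c (unit i) = c i"
proof -
  have "(\<Prod>k = 1..n. \<Prod>j = 1..<k. swap_coeff q (\<pi> k) (\<pi> j) ^ (unit i j * unit i k)) = 1"
    by (intro prod.neutral ballI) (auto simp: unit_exponent_def)
  moreover have "(\<Prod>k = 1..n. c k ^ unit i k) = c i"
    using assms by (simp add: unit_exponent_def if_distrib cong: if_cong)
  ultimately show ?thesis by (simp add: S_coeff_eq)
qed

text \<open>
  This is what makes the antipode an anti-homomorphism: both sides are the coefficient of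
  \<open>S (x\<^sub>u x\<^sub>v) = S x\<^sub>v S x\<^sub>u\<close>.
\<close>

lemma S_coeff_add:
  "form u v * S_coeff n q \<pi> c (\<lambda>i. u i + v i) = S_coeff n q \<pi> c v * S_coeff n q \<pi> c u * form (act v) (act u)"
proof -
  let ?\<sigma> = "\<lambda>k j. swap_coeff q (\<pi> k) (\<pi> j)"
  \<comment> \<open>compatibility of \<open>\<pi>\<close> with the matrix \<open>q\<close> enters here\<close>
  have pair: "swap_coeff q k j * ?\<sigma> k j = ?\<sigma> j k" if "j < k" "j \<in> {1..n}" "k \<in> {1..n}" for j k
  proof -
    have "?\<sigma> j k = q (\<pi> k) (\<pi> j) * ?\<sigma> k j"
      using that by (intro swap_coeff_swap) (simp_all only: \<pi>_in)
    then show ?thesis using that by (simp add: \<pi>_q swap_coeff_def)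
  qed
  have "form (act v) (act u) =
      (\<Prod>k = 1..n. \<Prod>j = 1..<k. ?\<sigma> k j ^ (v k * u j) * ?\<sigma> j k ^ (v j * u k))"
    unfolding form_act prod_square_split by (simp add: swap_coeff_def)
  also have "\<dots> = (\<Prod>k = 1..n. \<Prod>j = 1..<k. q j k ^ (u k * v j) * ?\<sigma> k j ^ (v j * u k + u j * v k))"
  proof (intro prod.cong refl)
    fix k j assume "k \<in> {1..n}" "j \<in> {1..<k}"
    then have "?\<sigma> j k = q j k * ?\<sigma> k j" using pair[of j k] by (simp add: swap_coeff_def[of q k j])
    then show "?\<sigma> k j ^ (v k * u j) * ?\<sigma> j k ^ (v j * u k) = q j k ^ (u k * v j) * ?\<sigma> k j ^ (v j * u k + u j * v k)"
      by (simp add: power_mult_distrib power_add mult_ac)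
  qed
  also have "\<dots> = form u v * (\<Prod>k = 1..n. \<Prod>j = 1..<k. ?\<sigma> k j ^ (v j * u k + u j * v k))"
    by (simp add: q_form_def prod.distrib)
  finally show ?thesis
    by (simp add: S_coeff_eq power_add algebra_simps prod.distrib)
qed

text \<open>
  An anti-multiplicative family of coefficients is determined by its values on the generators.
  This identifies the coefficients of an arbitrary permutation antipode.
\<close>

lemma S_coeff_unique:
  assumes zero: "s (\<lambda>_. 0) = 1" and unit: "\<And>i. i \<in> {1..n} \<Longrightarrow> s (unit i) = c i"
    and add: "\<And>u v. (\<lambda>i. u i + v i) \<in> V \<Longrightarrow> form u v * s (\<lambda>i. u i + v i) = s v * s u * form (act v) (act u)"
    and v: "v \<in> V"
  shows "s v = S_coeff n q \<pi> c v"
proof -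
  have "v \<in> V \<longrightarrow> s v = S_coeff n q \<pi> c v"
    using V_D(1)[OF v]
  proof (induction v rule: exponent_induct)
    case (add v i)
    show ?case
    proof
      assume V: "(\<lambda>j. v j + unit i j) \<in> V"
      have "form v (unit i) * s (\<lambda>j. v j + unit i j) = form v (unit i) * S_coeff n q \<pi> c (\<lambda>j. v j + unit i j)"
        using assms(3)[OF V] S_coeff_add[of v "unit i" c] add V_add_D(1)[OF V]
        by (simp add: unit S_coeff_unit)
      then show "s (\<lambda>j. v j + unit i j) = S_coeff n q \<pi> c (\<lambda>j. v j + unit i j)"
        by (simp add: form_nonzero)
    qed
  qed (simp add: zero S_coeff_zero)
  then show ?thesis using v by simp
qed

end

locale involution_data = compatible_permutation n q a \<pi>
  for n and q :: "nat \<Rightarrow> nat \<Rightarrow> 'k::field" and a \<pi> +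
  fixes c :: "nat \<Rightarrow> 'k"
  assumes involution: "\<pi> \<circ> \<pi> = id"
    and c_pair: "i \<in> {1..n} \<Longrightarrow> c i * c (\<pi> i) = h_coeff n q a (unit_exponent i)"
    and c_top: "q_perm n q a \<pi> * (\<Prod>i = 1..n. c i ^ (a i - 1)) = 1"
begin

abbreviation s :: "(nat \<Rightarrow> nat) \<Rightarrow> 'k" where "s \<equiv> S_coeff n q \<pi> c"

lemma \<pi>_\<pi>: "\<pi> (\<pi> i) = i"
  using involution by (simp add: fun_eq_iff)

lemma act_act: "act (act v) = v"
proof
  fix i
  have "act (act v) (\<pi> (\<pi> i)) = v i" by (simp only: act_\<pi>)
  then show "act (act v) i = v i" by (simp add: \<pi>_\<pi>)
qed

lemma s_top: "s \<tau> = 1"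
  using c_top unfolding q_perm_eq .

text \<open>
  Both sides are the eigenvalue on \<open>x\<^sub>v\<close> of a diagonal automorphism of the algebra, so it is
  enough to compare them on generators.
\<close>

lemma s_s_act:
  assumes "v \<in> V"
  shows "s v * s (act v) = h_coeff n q a v"
proof -
  have prod: "s (\<lambda>i. u i + v i) * s (act (\<lambda>i. u i + v i)) = s u * s (act u) * (s v * s (act v))" for u v
  proof -
    let ?P = "form u v * form (act v) (act u)"
    have act: "form (act v) (act u) * s (act (\<lambda>i. u i + v i)) = s (act u) * s (act v) * form u v"
      using S_coeff_add[of "act v" "act u" c] by (simp add: act_add act_act add.commute)
    have "?P * (s (\<lambda>i. u i + v i) * s (act (\<lambda>i. u i + v i)))
        = (form u v * s (\<lambda>i. u i + v i)) * (form (act v) (act u) * s (act (\<lambda>i. u i + v i)))"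
      by (simp only: mult_ac)
    also have "\<dots> = ?P * (s u * s (act u) * (s v * s (act v)))"
      unfolding act S_coeff_add by (simp only: mult_ac)
    finally have "?P * (s (\<lambda>i. u i + v i) * s (act (\<lambda>i. u i + v i)))
        = ?P * (s u * s (act u) * (s v * s (act v)))" .
    then show ?thesis by (simp add: form_nonzero)
  qed
  have "s v * s (act v) = form \<tau> v / form v \<tau>"
    using V_D(1)[OF assms]
  proof (induction v rule: exponent_induct)
    case (add v i)
    have "s (unit i) * s (act (unit i)) = form \<tau> (unit i) / form (unit i) \<tau>"
      using c_pair[OF add(1)] h_coeff_eq[OF unit_V[OF add(1)]] S_coeff_unit[OF add(1), of c] S_coeff_unit[of "\<pi> i" c] add(1)
      unfolding act_unit \<pi>_in by simp
    then show ?case by (simp add: prod add.IH q_form_add_left q_form_add_right)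
  qed (simp add: S_coeff_zero act_zero)
  then show ?thesis by (simp add: h_coeff_eq[OF assms])
qed

lemma s_nonzero:
  assumes "v \<in> V"
  shows "s v \<noteq> 0"
proof -
  have "h_coeff n q a v \<noteq> 0" by (simp add: h_coeff_def form_nonzero)
  then show ?thesis using s_s_act[OF assms] by auto
qed

abbreviation g :: "(nat \<Rightarrow> nat) \<Rightarrow> 'k" where "g \<equiv> g_coeff n q a \<pi> c"

lemma g_zero: "g (\<lambda>_. 0) = 1"
  by (simp add: g_coeff_def S_coeff_zero)

lemma g_top: "g \<tau> = 1"
proof -
  have "\<tau> - \<tau> = (\<lambda>_. 0)" by (simp add: fun_eq_iff)
  then show ?thesis by (simp add: g_coeff_def s_top)
qed

lemma g_form: "v \<in> V \<Longrightarrow> g v * form (\<tau> - v) v = s v"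
  by (simp add: g_coeff_def form_nonzero)

lemma g_nonzero: "v \<in> V \<Longrightarrow> g v \<noteq> 0"
  by (simp add: g_coeff_def s_nonzero form_nonzero)

text \<open>The coefficient identity behind the compatibility of the antipode with the comultiplication.\<close>

lemma g_complement:
  assumes "v \<in> V"
  shows "g (\<tau> - v) * s v * s (act (\<tau> - v)) = g v"
proof -
  have c: "\<tau> - (\<tau> - v) = v" by (rule compl_compl[OF assms])
  have "s (\<tau> - v) * s (act (\<tau> - v)) = form v (\<tau> - v) / form (\<tau> - v) v"
    unfolding s_s_act[OF compl_V] h_coeff_def c ..
  then show ?thesis by (simp add: g_coeff_def c form_nonzero field_simps)
qed

end


section \<open>The attached structure is a bi-Frobenius algebra\<close>

context quantum_complete_intersection
begin

abbreviation T2 where "T2 \<equiv> tensor A A"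
abbreviation T3 where "T3 \<equiv> tensor A T2"

sublocale T2: tensor_of_based A V x "qci_dual n q a" A V x "qci_dual n q a"
  by unfold_locales

sublocale T3: tensor_of_based A V x "qci_dual n q a" T2 "V \<times> V" T2.tensor_basis T2.tensor_co
  by unfold_locales

lemma mult_form: "f \<in> dual_space A \<Longrightarrow> (\<lambda>y z. f (y \<cdot> z)) \<in> bilinear_forms A A"
  by (rule bilinear_forms_comp[OF mult_bilinear[OF A_ring A_compatible]])

lemma dual_sweedler:
  assumes f: "f \<in> dual_space A" and Y: "Y \<in> carrier T2"
  shows "f (tensor_lift A (\<lambda>t1 t2. d t1 t2 *\<^sub>A t2) Y) = lift (\<lambda>t1 t2. d t1 t2 * f t2) Y"
    and "f (tensor_lift A (\<lambda>t1 t2. d t1 t2 *\<^sub>A t1) Y) = lift (\<lambda>t1 t2. d t1 t2 * f t1) Y"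
  using T2.dual_tensor_lift[OF A_vs _ Y f, of "\<lambda>t1 t2. d t1 t2 *\<^sub>A t2"]
    T2.lift_cong[OF Y, of "\<lambda>t1 t2. f (d t1 t2 *\<^sub>A t2)" "\<lambda>t1 t2. d t1 t2 * f t2"]
    T2.dual_tensor_lift[OF A_vs _ Y f, of "\<lambda>t1 t2. d t1 t2 *\<^sub>A t1"]
    T2.lift_cong[OF Y, of "\<lambda>t1 t2. f (d t1 t2 *\<^sub>A t1)" "\<lambda>t1 t2. d t1 t2 * f t1"]
  by (simp_all add: smult_closed dual_smult[OF f])

lemma extend_linear: "vectorspace class_ring U \<Longrightarrow> (\<And>v. v \<in> V \<Longrightarrow> f v \<in> carrier U) \<Longrightarrow>
    qci_extend n q a U f \<in> linear_maps A U"
  and extend_mon: "vectorspace class_ring U \<Longrightarrow> (\<And>v. v \<in> V \<Longrightarrow> f v \<in> carrier U) \<Longrightarrow> v \<in> V \<Longrightarrow>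
    qci_extend n q a U f (x v) = f v"
  using B.linear_map_of_values[of U f] by (simp_all add: qci_extend_def[abs_def])

lemma forms_eqI:
  assumes "f \<in> bilinear_forms A A" "g \<in> bilinear_forms A A"
    and "\<And>u v. u \<in> V \<Longrightarrow> v \<in> V \<Longrightarrow> f (x u) (x v) = g (x u) (x v)"
    and "y \<in> carrier A" "z \<in> carrier A"
  shows "f y z = g y z"
proof -
  have "f (x u) z = g (x u) z" if "u \<in> V" for u
    by (rule B.dual_eqI[OF bilinear_form_right[OF assms(1)] bilinear_form_right[OF assms(2)] assms(3)[OF that] assms(5)])
      (simp_all add: mon_closed)
  then show ?thesis
    by (intro B.dual_eqI[OF bilinear_form_left[OF assms(1,5)] bilinear_form_left[OF assms(2,5)] _ assms(4)])
qed

end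

context involution_data
begin

abbreviation \<Delta> where "\<Delta> \<equiv> qci_comult n q a \<pi> c"
abbreviation \<epsilon> where "\<epsilon> \<equiv> qci_counit n q a"
abbreviation S where "S \<equiv> qci_antipode n q a \<pi> c"
abbreviation \<phi> where "\<phi> \<equiv> x\<^sup>* \<tau>"

lemma top_nonzero: "\<tau> \<noteq> (\<lambda>_. 0)"
proof
  assume "\<tau> = (\<lambda>_. 0)"
  then have "\<tau> 1 = 0" by simp
  then show False using top_pos[of 1] n_pos by simp
qed

abbreviation M where "M \<equiv> V - {\<lambda>_. 0, \<tau>}"

lemma \<epsilon>_dual: "\<epsilon> \<in> dual_space A"
  unfolding dual_space_def qci_counit_def
  by (rule extend_linear[OF vectorspace_scalar_module]) (simp add: scalar_module_def)

lemma \<epsilon>_mon: "v \<in> V \<Longrightarrow> \<epsilon> (x v) = (if v = (\<lambda>_. 0) then 1 else 0)"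
  unfolding qci_counit_def
  by (subst extend_mon[OF vectorspace_scalar_module]) (simp_all add: scalar_module_def)

lemma S_linear: "S \<in> linear_maps A A"
  unfolding qci_antipode_def by (rule extend_linear[OF A_vs]) (simp add: mon_closed smult_closed)

lemma S_mon: "v \<in> V \<Longrightarrow> S (x v) = s v *\<^sub>A x (act v)"
  unfolding qci_antipode_def by (rule extend_mon[OF A_vs]) (simp_all add: mon_closed smult_closed)

lemma S_closed: "y \<in> carrier A \<Longrightarrow> S y \<in> carrier A"
  by (rule linear_maps_closed[OF S_linear])

lemma comult_values_closed:
  "(if v = (\<lambda>_. 0) then pure_tensor A A \<one>\<^sub>A \<one>\<^sub>A
     else if v = \<tau> then
       (\<Oplus>\<^bsub>T2\<^esub> u \<in> V. g u \<odot>\<^bsub>T2\<^esub> pure_tensor A A (x (\<tau> - u)) (x (act u)))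
     else pure_tensor A A \<one>\<^sub>A (x v) \<oplus>\<^bsub>T2\<^esub> pure_tensor A A (x v) \<one>\<^sub>A) \<in> carrier T2"
  by (simp add: T2.pure_closed mon_closed vs_add_closed[OF T2.tensor_vs] vs_smult_closed[OF T2.tensor_vs]
      vs_finsum_closed[OF T2.tensor_vs])

lemma \<Delta>_linear: "\<Delta> \<in> linear_maps A T2"
  unfolding qci_comult_def Let_def by (rule extend_linear[OF T2.tensor_vs comult_values_closed])

lemma \<Delta>_closed: "y \<in> carrier A \<Longrightarrow> \<Delta> y \<in> carrier T2"
  by (rule linear_maps_closed[OF \<Delta>_linear])

lemma \<Delta>_mon:
  "v \<in> V \<Longrightarrow> \<Delta> (x v) =
    (if v = (\<lambda>_. 0) then pure_tensor A A \<one>\<^sub>A \<one>\<^sub>A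
     else if v = \<tau> then
       (\<Oplus>\<^bsub>T2\<^esub> u \<in> V. g u \<odot>\<^bsub>T2\<^esub> pure_tensor A A (x (\<tau> - u)) (x (act u)))
     else pure_tensor A A \<one>\<^sub>A (x v) \<oplus>\<^bsub>T2\<^esub> pure_tensor A A (x v) \<one>\<^sub>A)"
  unfolding qci_comult_def Let_def by (rule extend_mon[OF T2.tensor_vs comult_values_closed])

text \<open>
  The comultiplication enters only through the numbers \<open>lift b (\<Delta> a)\<close>, the Sweedler sums of
  \<open>b a\<^sub>1 a\<^sub>2\<close> for a bilinear form \<open>b\<close>.
\<close>

lemma
  assumes b: "b \<in> bilinear_forms A A"
  shows lift_one: "lift b (\<Delta> \<one>\<^sub>A) = b \<one>\<^sub>A \<one>\<^sub>A"
    and lift_top: "lift b (\<Delta> (x \<tau>)) = (\<Sum>u\<in>V. g u * b (x (\<tau> - u)) (x (act u)))"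
    and lift_middle: "v \<in> M \<Longrightarrow> lift b (\<Delta> (x v)) = b \<one>\<^sub>A (x v) + b (x v) \<one>\<^sub>A"
proof -
  note dual = T2.lift_dual[OF b]
  note pure = T2.lift_pure[OF b]
  show "lift b (\<Delta> \<one>\<^sub>A) = b \<one>\<^sub>A \<one>\<^sub>A"
    using \<Delta>_mon[OF zero_V] pure[of "\<one>\<^sub>A" "\<one>\<^sub>A"] by (simp add: mon_zero)
  show "lift b (\<Delta> (x \<tau>)) = (\<Sum>u\<in>V. g u * b (x (\<tau> - u)) (x (act u)))"
    using top_nonzero \<Delta>_mon[OF top_V]
    by (simp add: dual_finsum[OF T2.tensor_vs dual] dual_smult[OF dual] pure mon_closed T2.pure_closed
        vs_smult_closed[OF T2.tensor_vs])
  show "lift b (\<Delta> (x v)) = b \<one>\<^sub>A (x v) + b (x v) \<one>\<^sub>A" if "v \<in> M"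
    using that \<Delta>_mon[of v] by (simp add: dual_add[OF dual] pure mon_closed T2.pure_closed)
qed

lemma act_middle: "v \<in> M \<Longrightarrow> act v \<in> M"
  using act_inj[of v "\<lambda>_. 0"] act_inj[of v \<tau>] by (auto simp: act_V act_zero act_top)

lemma compl_top: "\<tau> - \<tau> = (\<lambda>_. 0)" and compl_zero: "\<tau> - (\<lambda>_. 0) = \<tau>"
  by (simp_all add: fun_eq_iff)

lemma compl_middle:
  assumes "v \<in> M"
  shows "\<tau> - v \<in> M"
proof -
  have "\<tau> - (\<tau> - v) = v" using assms by (simp add: compl_compl)
  then have "\<tau> - v \<noteq> \<tau>" "\<tau> - v \<noteq> (\<lambda>_. 0)"
    using assms compl_top compl_zero by auto
  then show ?thesis by (simp add: compl_V)
qed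

lemma sum_V_split:
  fixes f :: "(nat \<Rightarrow> nat) \<Rightarrow> 'k"
  shows "sum f V = f (\<lambda>_. 0) + f \<tau> + sum f (M)"
  using top_nonzero sum.subset_diff[of "{\<lambda>_. 0, \<tau>}" V f] by (simp add: zero_V top_V finite_V add_ac)

lemma lift_top_split:
  "b \<in> bilinear_forms A A \<Longrightarrow> lift b (\<Delta> (x \<tau>)) = b (x \<tau>) \<one>\<^sub>A + b \<one>\<^sub>A (x \<tau>)
     + (\<Sum>u \<in> M. g u * b (x (\<tau> - u)) (x (act u)))"
  by (simp add: lift_top sum_V_split g_zero g_top compl_top compl_zero act_zero act_top mon_zero)

lemma mon_cases [consumes 1, case_names one top middle]:
  assumes "v \<in> V"
    and "x v = \<one>\<^sub>A \<Longrightarrow> v = (\<lambda>_. 0) \<Longrightarrow> P" "v = \<tau> \<Longrightarrow> P" "v \<in> M \<Longrightarrow> P"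
  shows P
  using assms mon_zero by blast

lemma counit:
  assumes y: "y \<in> carrier A"
  shows "tensor_lift A (\<lambda>a1 a2. \<epsilon> a1 *\<^sub>A a2) (\<Delta> y) = y"
    and "tensor_lift A (\<lambda>a1 a2. \<epsilon> a2 *\<^sub>A a1) (\<Delta> y) = y"
proof -
  have \<epsilon>_one: "\<epsilon> \<one>\<^sub>A = 1" using \<epsilon>_mon[OF zero_V] by (simp add: mon_zero)
  have b: "(\<lambda>a1 a2. \<epsilon> a1 * f a2) \<in> bilinear_forms A A" "(\<lambda>a1 a2. \<epsilon> a2 * f a1) \<in> bilinear_forms A A"
    if "f \<in> dual_space A" for f
    using product_bilinear_form[OF \<epsilon>_dual that] product_bilinear_form[OF that \<epsilon>_dual] by (simp_all add: mult.commute)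
  have mon: "lift (\<lambda>a1 a2. \<epsilon> a1 * f a2) (\<Delta> (x v)) = f (x v)" "lift (\<lambda>a1 a2. \<epsilon> a2 * f a1) (\<Delta> (x v)) = f (x v)"
    if f: "f \<in> dual_space A" and v: "v \<in> V" for f v
  proof -
    have 0: "\<epsilon> (x u) = 0" if "u \<in> M \<or> u = \<tau>" for u
      using that top_nonzero by (auto simp: \<epsilon>_mon top_V)
    have "\<epsilon> (x (\<tau> - u)) = 0" "\<epsilon> (x (act u)) = 0" if "u \<in> M" for u
      using 0 compl_middle[OF that] act_middle[OF that] by blast+
    then have sums: "(\<Sum>u\<in>M. g u * (\<epsilon> (x (\<tau> - u)) * f (x (act u)))) = 0"
      "(\<Sum>u\<in>M. g u * (\<epsilon> (x (act u)) * f (x (\<tau> - u)))) = 0"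
      by (intro sum.neutral ballI; simp)+
    from v have "lift (\<lambda>a1 a2. \<epsilon> a1 * f a2) (\<Delta> (x v)) = f (x v) \<and> lift (\<lambda>a1 a2. \<epsilon> a2 * f a1) (\<Delta> (x v)) = f (x v)"
    proof (cases rule: mon_cases)
      case one
      then show ?thesis by (simp add: lift_one[OF b(1)[OF f]] lift_one[OF b(2)[OF f]] \<epsilon>_one)
    next
      case top
      then show ?thesis
        by (simp add: lift_top_split[OF b(1)[OF f]] lift_top_split[OF b(2)[OF f]] \<epsilon>_one 0 sums)
    next
      case middle
      then show ?thesis by (simp add: lift_middle[OF b(1)[OF f]] lift_middle[OF b(2)[OF f]] \<epsilon>_one 0)
    qed
    then show "lift (\<lambda>a1 a2. \<epsilon> a1 * f a2) (\<Delta> (x v)) = f (x v)" "lift (\<lambda>a1 a2. \<epsilon> a2 * f a1) (\<Delta> (x v)) = f (x v)"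
      by auto
  qed
  have all: "lift (\<lambda>a1 a2. \<epsilon> a1 * f a2) (\<Delta> y) = f y" "lift (\<lambda>a1 a2. \<epsilon> a2 * f a1) (\<Delta> y) = f y"
    if f: "f \<in> dual_space A" for f
    using B.dual_eqI[OF dual_comp[OF \<Delta>_linear T2.lift_dual[OF b(1)[OF f]]] f mon(1)[OF f] y]
      B.dual_eqI[OF dual_comp[OF \<Delta>_linear T2.lift_dual[OF b(2)[OF f]]] f mon(2)[OF f] y]
    by simp_all
  note X = \<Delta>_closed[OF y]
  show "tensor_lift A (\<lambda>a1 a2. \<epsilon> a1 *\<^sub>A a2) (\<Delta> y) = y"
    by (rule B.functionals_eqI[OF T2.tensor_lift_closed[OF A_vs smult_closed X] y],
        assumption, rule trans[OF dual_sweedler(1)[OF _ X] all(1)])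
  show "tensor_lift A (\<lambda>a1 a2. \<epsilon> a2 *\<^sub>A a1) (\<Delta> y) = y"
    by (rule B.functionals_eqI[OF T2.tensor_lift_closed[OF A_vs smult_closed X] y],
        assumption, rule trans[OF dual_sweedler(2)[OF _ X] all(2)])
qed

lemma T3_linear: "\<beta> \<in> bilinear_maps A A T3 \<Longrightarrow> tensor_lift T3 \<beta> \<in> linear_maps T2 T3"
  by (rule T2.tensor_lift_linear[OF T3.T.based_space_axioms])

text \<open>
  The monomials other than \<open>1\<close> and \<open>x\<^sub>\<tau>\<close> are primitive.  So both iterated coproducts of \<open>x\<^sub>\<tau>\<close>
  consist of \<open>x\<^sub>\<tau>\<close> in one of the three tensor factors, and of every middle term
  \<open>g\<^sub>u x\<^sub>\<tau>\<^sub>-\<^sub>u \<otimes> x\<^sub>\<pi>\<^sub>u\<close> of \<open>\<Delta> x\<^sub>\<tau>\<close> with a factor \<open>1\<close> inserted in one of the three places.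
\<close>

lemma coassociative:
  assumes y: "y \<in> carrier A"
  shows "tensor_lift T3 (\<lambda>a1 a2. tensor_lift T3
             (\<lambda>b c. pure_tensor A T2 b (pure_tensor A A c a2)) (\<Delta> a1)) (\<Delta> y)
      = tensor_lift T3 (\<lambda>a1 a2. pure_tensor A T2 a1 (\<Delta> a2)) (\<Delta> y)" (is "?L y = ?R y")
proof -
  let ?p = "\<lambda>b c d. pure_tensor A T2 b (pure_tensor A A c d)"
  let ?l = "\<lambda>a1 a2. tensor_lift T3 (\<lambda>b c. ?p b c a2) (\<Delta> a1)"
  let ?r = "\<lambda>a1 a2. pure_tensor A T2 a1 (\<Delta> a2)"
  note pure2 = T2.pure_bilinear and pure3 = T3.pure_bilinear
  have p1: "(\<lambda>b. ?p b c d) \<in> linear_maps A T3" if "c \<in> carrier A" "d \<in> carrier A" for c d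
    using that by (intro bilinear_left[OF pure3] T2.pure_closed)
  have p2: "(\<lambda>c. ?p b c d) \<in> linear_maps A T3" if "b \<in> carrier A" "d \<in> carrier A" for b d
    using that by (intro linear_maps_comp[OF bilinear_left[OF pure2] bilinear_right[OF pure3]])
  have p3: "(\<lambda>d. ?p b c d) \<in> linear_maps A T3" if "b \<in> carrier A" "c \<in> carrier A" for b c
    using that by (intro linear_maps_comp[OF bilinear_right[OF pure2] bilinear_right[OF pure3]])
  have pc: "?p b c d \<in> carrier T3" if "b \<in> carrier A" "c \<in> carrier A" "d \<in> carrier A" for b c d
    using that by (intro T3.pure_closed T2.pure_closed)
  have p12: "(\<lambda>b c. ?p b c d) \<in> bilinear_maps A A T3" if "d \<in> carrier A" for d
    using that by (intro bilinear_mapsI p1 p2)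
  have p23: "(\<lambda>c d. ?p b c d) \<in> bilinear_maps A A T3" if "b \<in> carrier A" for b
    using that by (intro bilinear_mapsI p2 p3)
  have lc: "?l a1 a2 \<in> carrier T3" if "a1 \<in> carrier A" "a2 \<in> carrier A" for a1 a2
    using that by (intro T2.tensor_lift_closed[OF T3.tensor_vs] pc \<Delta>_closed)
  have leval: "f (?l a1 a2) = lift (\<lambda>b c. f (?p b c a2)) (\<Delta> a1)"
    if "f \<in> dual_space T3" "a1 \<in> carrier A" "a2 \<in> carrier A" for f a1 a2
    using that by (intro T2.dual_tensor_lift[OF T3.tensor_vs] pc \<Delta>_closed)
  have l2: "?l a1 \<in> linear_maps A T3" if a1: "a1 \<in> carrier A" for a1
  proof (rule linear_mapsI)
    note X = \<Delta>_closed[OF a1]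
    show "?l a1 a2 \<in> carrier T3" if "a2 \<in> carrier A" for a2 by (rule lc[OF a1 that])
    show "?l a1 (d \<oplus>\<^bsub>A\<^esub> d') = ?l a1 d \<oplus>\<^bsub>T3\<^esub> ?l a1 d'" if d: "d \<in> carrier A" "d' \<in> carrier A" for d d'
    proof (rule T3.T.functionals_eqI)
      fix f assume f: "f \<in> dual_space T3"
      have "f (?l a1 (d \<oplus>\<^bsub>A\<^esub> d')) = lift (\<lambda>b c. f (?p b c d) + f (?p b c d')) (\<Delta> a1)"
        unfolding leval[OF f a1 vs_add_closed[OF A_vs d]]
        by (rule T2.lift_cong[OF X]) (simp add: linear_maps_add[OF p3] d dual_add[OF f] pc)
      then show "f (?l a1 (d \<oplus>\<^bsub>A\<^esub> d')) = f (?l a1 d \<oplus>\<^bsub>T3\<^esub> ?l a1 d')"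
        by (simp add: T2.lift_add[OF X] dual_add[OF f] lc a1 d leval f)
    qed (use a1 d in \<open>auto intro!: lc vs_add_closed[OF A_vs] vs_add_closed[OF T3.tensor_vs]\<close>)
    show "?l a1 (k *\<^sub>A d) = k \<odot>\<^bsub>T3\<^esub> ?l a1 d" if d: "d \<in> carrier A" for k d
    proof (rule T3.T.functionals_eqI)
      fix f assume f: "f \<in> dual_space T3"
      have "f (?l a1 (k *\<^sub>A d)) = lift (\<lambda>b c. k * f (?p b c d)) (\<Delta> a1)"
        unfolding leval[OF f a1 smult_closed[OF d]]
        by (rule T2.lift_cong[OF X]) (simp add: linear_maps_smult[OF p3] d dual_smult[OF f] pc)
      then show "f (?l a1 (k *\<^sub>A d)) = f (k \<odot>\<^bsub>T3\<^esub> ?l a1 d)"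
        by (simp add: T2.lift_scale[OF X] dual_smult[OF f] lc a1 d leval f)
    qed (use a1 d in \<open>auto intro!: lc smult_closed vs_smult_closed[OF T3.tensor_vs]\<close>)
  qed
  have l: "?l \<in> bilinear_maps A A T3"
    by (intro bilinear_mapsI l2 linear_maps_comp[OF \<Delta>_linear T3_linear[OF p12]])
  have r: "?r \<in> bilinear_maps A A T3"
    by (intro bilinear_mapsI bilinear_left[OF pure3] linear_maps_comp[OF \<Delta>_linear bilinear_right[OF pure3]] \<Delta>_closed)
  have Llin: "?L \<in> linear_maps A T3" and Rlin: "?R \<in> linear_maps A T3"
    by (rule linear_maps_comp[OF \<Delta>_linear T3_linear[OF l]], rule linear_maps_comp[OF \<Delta>_linear T3_linear[OF r]])
  \<comment> \<open>It remains to compare the two sides on a monomial under a functional, that is, for a trilinear form.\<close>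
  have mon: "?L (x v) = ?R (x v)" if v: "v \<in> V" for v
  proof (rule T3.T.functionals_eqI[OF linear_maps_closed[OF Llin mon_closed] linear_maps_closed[OF Rlin mon_closed]])
    fix f assume f: "f \<in> dual_space T3"
    let ?t = "\<lambda>b c d. f (?p b c d)"
    have L: "f (?L (x v)) = lift (\<lambda>a1 a2. f (?l a1 a2)) (\<Delta> (x v))"
      by (rule T2.dual_tensor_lift[OF T3.tensor_vs lc \<Delta>_closed[OF mon_closed] f])
    have R: "f (?R (x v)) = lift (\<lambda>a1 a2. f (?r a1 a2)) (\<Delta> (x v))"
      by (rule T2.dual_tensor_lift[OF T3.tensor_vs bilinear_closed[OF r] \<Delta>_closed[OF mon_closed] f])
    note bl = bilinear_forms_comp[OF l f] and br = bilinear_forms_comp[OF r f]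
    have b12: "(\<lambda>b c. ?t b c d) \<in> bilinear_forms A A" if "d \<in> carrier A" for d
      by (rule bilinear_forms_comp[OF p12[OF that] f])
    have b23: "(\<lambda>c d. ?t b c d) \<in> bilinear_forms A A" if "b \<in> carrier A" for b
      by (rule bilinear_forms_comp[OF p23[OF that] f])
    have reval: "f (?r a1 a2) = lift (\<lambda>c d. ?t a1 c d) (\<Delta> a2)" if a: "a1 \<in> carrier A" "a2 \<in> carrier A" for a1 a2
      by (rule T2.dual_tensor_eq_lift[OF dual_comp[OF bilinear_right[OF pure3 a(1)] f] \<Delta>_closed[OF a(2)]])
    note vals = lift_one[OF b12] lift_one[OF b23] lift_middle[OF b12] lift_middle[OF b23]
      lift_top_split[OF b12] lift_top_split[OF b23]
    from v show "f (?L (x v)) = f (?R (x v))"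
    proof (cases rule: mon_cases)
      case one
      then show ?thesis unfolding L R
        by (simp add: lift_one[OF bl] lift_one[OF br] leval[OF f] reval vals mon_closed)
    next
      case top
      have "(\<Sum>u\<in>M. g u * f (?l (x (\<tau> - u)) (x (act u)))) =
          (\<Sum>u\<in>M. g u * (?t \<one>\<^sub>A (x (\<tau> - u)) (x (act u)) + ?t (x (\<tau> - u)) \<one>\<^sub>A (x (act u))))"
        by (intro sum.cong refl) (simp only: leval[OF f] lift_middle[OF b12] mon_closed compl_middle)
      moreover have "(\<Sum>u\<in>M. g u * f (?r (x (\<tau> - u)) (x (act u)))) =
          (\<Sum>u\<in>M. g u * (?t (x (\<tau> - u)) \<one>\<^sub>A (x (act u)) + ?t (x (\<tau> - u)) (x (act u)) \<one>\<^sub>A))"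
        by (intro sum.cong refl) (simp only: reval lift_middle[OF b23] mon_closed act_middle)
      ultimately show ?thesis unfolding L R unfolding top(1)
        by (simp add: lift_top_split[OF bl] lift_top_split[OF br] leval[OF f] reval vals mon_closed
            algebra_simps sum.distrib)
    next
      case middle
      then show ?thesis unfolding L R
        by (simp add: lift_middle[OF bl] lift_middle[OF br] leval[OF f] reval vals mon_closed)
    qed
  qed
  show ?thesis
    by (rule B.linear_maps_eqI[OF T3.tensor_vs Llin Rlin mon y])
qed

lemma coalgebra: "coalgebra A \<Delta> \<epsilon>"
  unfolding coalgebra_def using A_vs \<Delta>_linear \<epsilon>_dual coassociative counit by blast

lemma \<phi>_mult:
  assumes u: "u \<in> V" and v: "v \<in> V"
  shows "\<phi> (x (\<tau> - u) \<cdot> x v) = (if u = v then form (\<tau> - u) u else 0)"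
proof (cases "(\<lambda>i. (\<tau> - u) i + v i) \<in> V")
  case True
  have "(\<lambda>i. (\<tau> - u) i + v i) = \<tau> \<longleftrightarrow> u = v"
  proof
    assume *: "(\<lambda>i. (\<tau> - u) i + v i) = \<tau>"
    show "u = v"
    proof
      fix i show "u i = v i" using fun_cong[OF *, of i] fun_cong[OF compl_add(1)[OF u], of i] by simp
    qed
  qed (use compl_add(1)[OF u] in simp)
  then show ?thesis using True
    by (auto simp: mon_mult[OF compl_V v] dual_smult[OF B.co_dual[OF top_V]] mon_closed B.co_basis top_V)
next
  case False
  then have "u \<noteq> v" using compl_add(1)[OF u] top_V by auto
  then show ?thesis using False by (simp add: mon_mult[OF compl_V v] dual_zero[OF A_vs B.co_dual[OF top_V]])
qed

lemma sum_V_delta: "u \<in> V \<Longrightarrow> (\<Sum>v\<in>V. if v = u then f v else 0) = (f u :: 'k)"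
  by (simp add: finite_V)

lemma antipode_formula:
  assumes y: "y \<in> carrier A"
  shows "S y = tensor_lift A (\<lambda>t1 t2. \<phi> (t1 \<cdot> y) *\<^sub>A t2) (\<Delta> (x \<tau>))"
proof (rule B.functionals_eqI)
  note X = \<Delta>_closed[OF mon_closed[of \<tau>]]
  show "tensor_lift A (\<lambda>t1 t2. \<phi> (t1 \<cdot> y) *\<^sub>A t2) (\<Delta> (x \<tau>)) \<in> carrier A"
    by (rule T2.tensor_lift_closed[OF A_vs smult_closed X])
  show "S y \<in> carrier A" by (rule S_closed[OF y])
  fix f assume f: "f \<in> dual_space A"
  note \<phi> = B.co_dual[OF top_V]
  have b: "(\<lambda>t1 t2. \<phi> (t1 \<cdot> y) * f t2) \<in> bilinear_forms A A" if "y \<in> carrier A" for y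
    by (rule product_bilinear_form[OF bilinear_form_left[OF mult_form[OF \<phi>] that] f])
  have "f (tensor_lift A (\<lambda>t1 t2. \<phi> (t1 \<cdot> y) *\<^sub>A t2) (\<Delta> (x \<tau>)))
      = lift (\<lambda>t1 t2. \<phi> (t1 \<cdot> y) * f t2) (\<Delta> (x \<tau>))"
    by (rule dual_sweedler(1)[OF f X])
  also have "\<dots> = (\<Sum>u\<in>V. g u * (\<phi> (x (\<tau> - u) \<cdot> y) * f (x (act u))))"
    by (rule lift_top[OF b[OF y]])
  also have "\<dots> = f (S y)"
  proof (rule B.dual_eqI[where f = "\<lambda>y. \<Sum>u\<in>V. g u * (\<phi> (x (\<tau> - u) \<cdot> y) * f (x (act u)))"])
    note r = bilinear_form_right[OF mult_form[OF \<phi>] mon_closed]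
    show "(\<lambda>y. \<Sum>u\<in>V. g u * (\<phi> (x (\<tau> - u) \<cdot> y) * f (x (act u)))) \<in> dual_space A"
      by (rule dual_spaceI) (simp_all add: dual_add[OF r] dual_smult[OF r] algebra_simps sum.distrib sum_distrib_left)
    show "(\<lambda>y. f (S y)) \<in> dual_space A" by (rule dual_comp[OF S_linear f])
    show "(\<Sum>u\<in>V. g u * (\<phi> (x (\<tau> - u) \<cdot> x v) * f (x (act u)))) = f (S (x v))" if v: "v \<in> V" for v
    proof -
      have "(\<Sum>u\<in>V. g u * (\<phi> (x (\<tau> - u) \<cdot> x v) * f (x (act u))))
          = (\<Sum>u\<in>V. if u = v then g u * form (\<tau> - u) u * f (x (act u)) else 0)"
        by (intro sum.cong refl) (simp add: \<phi>_mult v)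
      then show ?thesis
        by (simp only: sum_V_delta[OF v] S_mon[OF v] dual_smult[OF f mon_closed] g_form[OF v])
    qed
  qed (rule y)
  finally show "f (S y) = f (tensor_lift A (\<lambda>t1 t2. \<phi> (t1 \<cdot> y) *\<^sub>A t2) (\<Delta> (x \<tau>)))" by simp
qed

lemma frobenius_algebra: "frobenius_algebra A \<phi>"
  unfolding frobenius_algebra_def
proof (intro conjI ballI)
  show \<phi>: "\<phi> \<in> dual_space A" by (rule B.co_dual[OF top_V])
  fix f assume f: "f \<in> dual_space A"
  \<comment> \<open>only the coefficient of \<open>x\<^sub>\<tau>\<^sub>-\<^sub>v\<close> in \<open>b\<close> contributes to \<open>\<phi> (b x\<^sub>v)\<close>\<close>
  define b where "b = B.comb (\<lambda>v. f (x (\<tau> - v)) / form v (\<tau> - v))"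
  have b: "b \<in> carrier A" unfolding b_def by (rule B.comb_closed)
  have "f y = \<phi> (b \<cdot> y)" if y: "y \<in> carrier A" for y
  proof (rule B.dual_eqI[OF f bilinear_form_right[OF mult_form[OF \<phi>] b] _ y])
    fix v assume v: "v \<in> V"
    have "\<phi> (b \<cdot> x v) = (\<Sum>u\<in>V. f (x (\<tau> - u)) / form u (\<tau> - u) * \<phi> (x u \<cdot> x v))"
      unfolding b_def by (rule B.dual_comb[OF bilinear_form_left[OF mult_form[OF \<phi>] mon_closed]])
    also have "\<dots> = (\<Sum>u\<in>V. if u = \<tau> - v then f (x v) else 0)"
    proof (intro sum.cong refl)
      fix u assume u: "u \<in> V"
      have eq: "u = \<tau> - v \<longleftrightarrow> \<tau> - u = v" using u v compl_compl by metis
      have "\<phi> (x u \<cdot> x v) = (if \<tau> - u = v then form u (\<tau> - u) else 0)"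
        using \<phi>_mult[OF compl_V[of u] v] unfolding compl_compl[OF u] .
      then show "f (x (\<tau> - u)) / form u (\<tau> - u) * \<phi> (x u \<cdot> x v) = (if u = \<tau> - v then f (x v) else 0)"
        unfolding eq by (auto simp: form_nonzero)
    qed
    also have "\<dots> = f (x v)" by (rule sum_V_delta[OF compl_V])
    finally show "f (x v) = \<phi> (b \<cdot> x v)" ..
  qed
  then show "\<exists>b\<in>carrier A. \<forall>y\<in>carrier A. f y = \<phi> (b \<cdot> y)" using b by blast
qed

lemma frobenius_coalgebra: "frobenius_coalgebra A \<Delta> (x \<tau>)"
proof -
  note X = \<Delta>_closed[OF mon_closed[of \<tau>]]
  have closed: "tensor_lift A (\<lambda>t1 t2. f t1 *\<^sub>A t2) (\<Delta> (x \<tau>)) \<in> carrier A" for f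
    by (rule T2.tensor_lift_closed[OF A_vs smult_closed X])
  have "\<exists>f. y = tensor_lift A (\<lambda>t1 t2. f t1 *\<^sub>A t2) (\<Delta> (x \<tau>)) \<and> f \<in> dual_space A" if y: "y \<in> carrier A" for y
  proof (intro exI conjI)
    \<comment> \<open>the functional with value \<open>y\<^sub>\<pi>\<^sub>u / g\<^sub>u\<close> at \<open>x\<^sub>\<tau>\<^sub>-\<^sub>u\<close>\<close>
    let ?f = "\<lambda>z. \<Sum>v\<in>V. x\<^sup>* v z * (x\<^sup>* (act (\<tau> - v)) y / g (\<tau> - v))"
    show f: "?f \<in> dual_space A" by (rule B.dual_of_values)
    have fx: "?f (x (\<tau> - u)) = x\<^sup>* (act u) y / g u" if "u \<in> V" for u
      using B.dual_of_values_basis[OF compl_V[of u], of "\<lambda>v. x\<^sup>* (act (\<tau> - v)) y / g (\<tau> - v)"]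
      by (simp add: compl_compl[OF that])
    show "y = tensor_lift A (\<lambda>t1 t2. ?f t1 *\<^sub>A t2) (\<Delta> (x \<tau>))"
    proof (rule B.functionals_eqI[OF y closed])
      fix h assume h: "h \<in> dual_space A"
      have "h (tensor_lift A (\<lambda>t1 t2. ?f t1 *\<^sub>A t2) (\<Delta> (x \<tau>))) = lift (\<lambda>t1 t2. ?f t1 * h t2) (\<Delta> (x \<tau>))"
        by (rule dual_sweedler(1)[OF h X])
      also have "\<dots> = (\<Sum>u\<in>V. g u * (?f (x (\<tau> - u)) * h (x (act u))))"
        by (rule lift_top[OF product_bilinear_form[OF f h]])
      also have "\<dots> = (\<Sum>u\<in>V. x\<^sup>* (act u) y * h (x (act u)))"
        by (intro sum.cong refl) (simp only: fx, simp add: g_nonzero)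
      also have "\<dots> = (\<Sum>v\<in>V. x\<^sup>* v y * h (x v))"
        by (rule sum.reindex_bij_betw[OF act_bij, of "\<lambda>v. x\<^sup>* v y * h (x v)"])
      also have "\<dots> = h y" by (rule B.dual_expand[OF h y, symmetric])
      finally show "h y = h (tensor_lift A (\<lambda>t1 t2. ?f t1 *\<^sub>A t2) (\<Delta> (x \<tau>)))" ..
    qed
  qed
  then show ?thesis
    unfolding frobenius_coalgebra_def using closed mon_closed by blast
qed

lemma \<epsilon>_mult:
  assumes "y \<in> carrier A" "z \<in> carrier A"
  shows "\<epsilon> (y \<cdot> z) = \<epsilon> y * \<epsilon> z"
proof (rule forms_eqI[OF mult_form[OF \<epsilon>_dual] product_bilinear_form[OF \<epsilon>_dual \<epsilon>_dual] _ assms])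
  fix u v assume u: "u \<in> V" and v: "v \<in> V"
  have "(\<lambda>i. u i + v i) = (\<lambda>_. 0) \<longleftrightarrow> u = (\<lambda>_. 0) \<and> v = (\<lambda>_. 0)" by (auto simp: fun_eq_iff)
  then show "\<epsilon> (x u \<cdot> x v) = \<epsilon> (x u) * \<epsilon> (x v)"
    using u v zero_V by (auto simp: mon_mult dual_smult[OF \<epsilon>_dual] mon_closed \<epsilon>_mon dual_zero[OF A_vs \<epsilon>_dual])
qed

lemma \<epsilon>_one: "\<epsilon> \<one>\<^sub>A = 1"
  using \<epsilon>_mon[OF zero_V] by (simp add: mon_zero)

lemma \<epsilon>_S: "y \<in> carrier A \<Longrightarrow> \<epsilon> (S y) = \<epsilon> y"
proof (rule B.dual_eqI[OF dual_comp[OF S_linear \<epsilon>_dual] \<epsilon>_dual])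
  fix v assume v: "v \<in> V"
  then show "\<epsilon> (S (x v)) = \<epsilon> (x v)"
    using act_inj[of v "\<lambda>_. 0"]
    by (auto simp: S_mon dual_smult[OF \<epsilon>_dual] mon_closed \<epsilon>_mon act_V act_zero S_coeff_zero)
qed

lemma S_one: "S \<one>\<^sub>A = \<one>\<^sub>A"
  using S_mon[OF zero_V] by (simp add: mon_zero act_zero S_coeff_zero vs_smult_one[OF A_vs])

lemma S_mult:
  assumes "y \<in> carrier A" "z \<in> carrier A"
  shows "S (y \<cdot> z) = S z \<cdot> S y"
proof (rule B.functionals_eqI)
  note mult = mult_bilinear[OF A_ring A_compatible]
  fix f assume f: "f \<in> dual_space A"
  have 1: "(\<lambda>y z. f (S (y \<cdot> z))) \<in> bilinear_forms A A"
    by (rule mult_form[OF dual_comp[OF S_linear f]])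
  have 2: "(\<lambda>y z. f (S z \<cdot> S y)) \<in> bilinear_forms A A"
    by (intro bilinear_formsI dual_comp[OF S_linear, of "\<lambda>y. f (_ \<cdot> y)"]
        dual_comp[OF S_linear, of "\<lambda>z. f (z \<cdot> _)"]
        bilinear_form_right[OF mult_form[OF f]] bilinear_form_left[OF mult_form[OF f]] S_closed)
  show "f (S (y \<cdot> z)) = f (S z \<cdot> S y)"
  proof (rule forms_eqI[OF 1 2 _ assms])
    fix u v assume u: "u \<in> V" and v: "v \<in> V"
    have V: "(\<lambda>i. act v i + act u i) \<in> V \<longleftrightarrow> (\<lambda>i. u i + v i) \<in> V"
      using act_V[of "\<lambda>i. u i + v i"] by (simp add: act_add add.commute)
    have "S (x v) \<cdot> S (x u) = (s v * s u) *\<^sub>A (x (act v) \<cdot> x (act u))"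
      using u v by (simp add: S_mon smult_mult_left smult_mult_right A_smult_smult mon_closed smult_closed mult.commute)
    also have "\<dots> = (if (\<lambda>i. u i + v i) \<in> V then (s v * s u * form (act v) (act u)) *\<^sub>A x (act (\<lambda>i. u i + v i)) else \<zero>\<^bsub>A\<^esub>)"
      using u v V smult_zero
      by (simp add: mon_mult act_V A_smult_smult mon_closed act_add add.commute)
    also have "\<dots> = S (x u \<cdot> x v)"
      using u v
      by (auto simp: mon_mult linear_maps_smult[OF S_linear] mon_closed S_mon A_smult_smult S_coeff_add
          linear_maps_zero[OF A_vs A_vs S_linear])
    finally show "f (S (x u \<cdot> x v)) = f (S (x v) \<cdot> S (x u))" by simp
  qed
qed (simp_all add: assms S_closed)

text \<open>
  Flipping the factors of \<open>\<Delta> x\<^sub>\<tau>\<close> and applying \<open>S\<close> to both exchanges the roles of \<open>u\<close> and \<open>\<tau> - u\<close>;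
  the coefficients then agree by \<open>g_complement\<close>.
\<close>

lemma \<Delta>_S:
  assumes y: "y \<in> carrier A"
  shows "\<Delta> (S y) = tensor_lift T2 (\<lambda>a1 a2. pure_tensor A A (S a2) (S a1)) (\<Delta> y)"
proof -
  let ?b = "\<lambda>a1 a2. pure_tensor A A (S a2) (S a1)"
  note pure = T2.pure_bilinear
  have b: "?b \<in> bilinear_maps A A T2"
    by (intro bilinear_mapsI linear_maps_comp[OF S_linear bilinear_right[OF pure]]
        linear_maps_comp[OF S_linear bilinear_left[OF pure]] S_closed)
  have lin: "(\<lambda>y. \<Delta> (S y)) \<in> linear_maps A T2" "(\<lambda>y. tensor_lift T2 ?b (\<Delta> y)) \<in> linear_maps A T2"
    by (rule linear_maps_comp[OF S_linear \<Delta>_linear],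
        rule linear_maps_comp[OF \<Delta>_linear T2.tensor_lift_linear[OF T2.T.based_space_axioms b]])
  show ?thesis
  proof (rule B.linear_maps_eqI[OF T2.tensor_vs lin _ y])
    fix v assume v: "v \<in> V"
    show "\<Delta> (S (x v)) = tensor_lift T2 ?b (\<Delta> (x v))"
    proof (rule T2.T.functionals_eqI[OF linear_maps_closed[OF lin(1) mon_closed] linear_maps_closed[OF lin(2) mon_closed]])
      fix f assume f: "f \<in> dual_space T2"
      let ?p = "\<lambda>u w. f (pure_tensor A A u w)"
      have p: "?p \<in> bilinear_forms A A" by (rule bilinear_forms_comp[OF pure f])
      note bf = bilinear_forms_comp[OF b f]
      have R: "f (tensor_lift T2 ?b (\<Delta> (x v))) = lift (\<lambda>a1 a2. f (?b a1 a2)) (\<Delta> (x v))"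
        by (rule T2.dual_tensor_lift[OF T2.tensor_vs bilinear_closed[OF b] \<Delta>_closed[OF mon_closed] f])
      have "f (\<Delta> (S (x v))) = s v * f (\<Delta> (x (act v)))"
        by (simp add: S_mon[OF v] linear_maps_smult[OF \<Delta>_linear] mon_closed dual_smult[OF f] \<Delta>_closed)
      then have L: "f (\<Delta> (S (x v))) = s v * lift ?p (\<Delta> (x (act v)))"
        unfolding T2.dual_tensor_eq_lift[OF f \<Delta>_closed[OF mon_closed]] .
      have scale: "?p (k *\<^sub>A u) w = k * ?p u w" "?p u (k *\<^sub>A w) = k * ?p u w"
        if "u \<in> carrier A" "w \<in> carrier A" for k u w
        using that dual_smult[OF bilinear_form_left[OF p]] dual_smult[OF bilinear_form_right[OF p]] by auto
      from v show "f (\<Delta> (S (x v))) = f (tensor_lift T2 ?b (\<Delta> (x v)))"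
      proof (cases rule: mon_cases)
        case one
        then show ?thesis unfolding L R
          by (simp add: act_zero mon_zero lift_one[OF p] lift_one[OF bf] S_one S_coeff_zero)
      next
        case top
        have "lift (\<lambda>a1 a2. f (?b a1 a2)) (\<Delta> (x \<tau>)) = (\<Sum>u\<in>V. g u * f (?b (x (\<tau> - u)) (x (act u))))"
          by (rule lift_top[OF bf])
        also have "\<dots> = (\<Sum>u\<in>V. g u * s (act u) * s (\<tau> - u) * ?p (x u) (x (act (\<tau> - u))))"
          by (intro sum.cong refl)
            (simp add: S_mon act_V compl_V act_act scale mon_closed smult_closed mult_ac)
        also have "\<dots> = (\<Sum>w\<in>V. g (\<tau> - w) * s (act (\<tau> - w)) * s (\<tau> - (\<tau> - w)) * ?p (x (\<tau> - w)) (x (act (\<tau> - (\<tau> - w)))))"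
        proof (rule sum.reindex_bij_witness[where i = "\<lambda>u. \<tau> - u" and j = "\<lambda>u. \<tau> - u"])
          fix u assume "u \<in> V"
          show "g (\<tau> - (\<tau> - u)) * s (act (\<tau> - (\<tau> - u))) * s (\<tau> - (\<tau> - (\<tau> - u))) * ?p (x (\<tau> - (\<tau> - u))) (x (act (\<tau> - (\<tau> - (\<tau> - u)))))
              = g u * s (act u) * s (\<tau> - u) * ?p (x u) (x (act (\<tau> - u)))"
            by (simp only: compl_compl[OF \<open>u \<in> V\<close>])
        qed (simp_all only: compl_compl compl_V)
        also have "\<dots> = (\<Sum>w\<in>V. g w * ?p (x (\<tau> - w)) (x (act w)))"
        proof (intro sum.cong refl)
          fix w assume w: "w \<in> V"
          have "g (\<tau> - w) * s (act (\<tau> - w)) * s w = g w"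
            using g_complement[OF w] by (simp add: mult_ac)
          then show "g (\<tau> - w) * s (act (\<tau> - w)) * s (\<tau> - (\<tau> - w)) * ?p (x (\<tau> - w)) (x (act (\<tau> - (\<tau> - w))))
              = g w * ?p (x (\<tau> - w)) (x (act w))"
            by (simp only: compl_compl[OF w])
        qed
        finally show ?thesis unfolding L R unfolding top(1)
          by (simp add: act_top s_top lift_top[OF p])
      next
        case middle
        then show ?thesis unfolding L R
          by (simp add: lift_middle[OF p] lift_middle[OF bf] act_middle[simplified] S_mon[OF v] S_one scale mon_closed algebra_simps)
      qed
    qed
  qed
qed

lemma attached_bi_frobenius: "bi_frobenius A \<Delta> \<epsilon> \<phi> (x \<tau>) S"
proof -
  have "\<epsilon> \<in> Ring.ring_hom A class_ring"
    by (rule ring_hom_memI) (simp_all add: \<epsilon>_mult \<epsilon>_one dual_add[OF \<epsilon>_dual])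
  moreover have "\<Delta> \<one>\<^sub>A = pure_tensor A A \<one>\<^sub>A \<one>\<^sub>A"
    using \<Delta>_mon[OF zero_V] by (simp add: mon_zero)
  ultimately show ?thesis
    unfolding bi_frobenius_def
    by (intro conjI ballI A_fin_dim_algebra coalgebra antipode_formula frobenius_algebra
      frobenius_coalgebra S_one S_mult \<epsilon>_S \<Delta>_S)
qed

lemma attached_permutation_antipode: "permutation_antipode n q a S"
  unfolding permutation_antipode_def using act_bij S_mon by blast

lemma antipode_generator:
  assumes i: "i \<in> {1..n}"
  shows "S (qci_gen n q a i) = c i *\<^sub>A qci_gen n q a (\<pi> i)"
proof -
  have "\<pi> i \<in> {1..n}" using i unfolding \<pi>_in .
  then show ?thesis
    using S_mon[OF unit_V[OF i]] mon_unit[OF i] mon_unit[of "\<pi> i"] S_coeff_unit[OF i, of c] by (simp add: act_unit)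
qed

end


section \<open>A permutation antipode comes from such data\<close>

lemma square_left_inverse_imp_right_inverse:
  fixes B G :: "'i \<Rightarrow> 'i \<Rightarrow> 'k::field"
  assumes fin: "finite I"
    and BG: "\<And>i j. i \<in> I \<Longrightarrow> j \<in> I \<Longrightarrow> (\<Sum>k\<in>I. B i k * G k j) = (if i = j then 1 else 0)"
    and i: "i \<in> I" and j: "j \<in> I"
  shows "(\<Sum>k\<in>I. G i k * B k j) = (if i = j then 1 else 0)"
proof -
  let ?n = "card I"
  obtain h where h: "bij_betw h {0..<?n} I" using ex_bij_betw_nat_finite[OF fin] by blast
  have hI: "h r \<in> I" if "r < ?n" for r using bij_betwE[OF h] that by simp
  have hinj: "h r = h r' \<longleftrightarrow> r = r'" if "r < ?n" "r' < ?n" for r r'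
    using bij_betw_imp_inj_on[OF h] that by (auto simp: inj_on_def)
  define MB where "MB = mat ?n ?n (\<lambda>(r, s). B (h r) (h s))"
  define MG where "MG = mat ?n ?n (\<lambda>(r, s). G (h r) (h s))"
  have car: "MB \<in> carrier_mat ?n ?n" "MG \<in> carrier_mat ?n ?n" by (simp_all add: MB_def MG_def)
  have sum: "(\<Sum>l = 0..<?n. F (h l)) = (\<Sum>k\<in>I. F k)" for F :: "'i \<Rightarrow> 'k"
    by (rule sum.reindex_bij_betw[OF h])
  have "MB * MG = 1\<^sub>m ?n"
  proof (rule eq_matI)
    fix r s assume "r < dim_row (1\<^sub>m ?n :: 'k mat)" "s < dim_col (1\<^sub>m ?n :: 'k mat)"
    then have rs: "r < ?n" "s < ?n" by simp_all
    have "(MB * MG) $$ (r, s) = (\<Sum>l = 0..<?n. B (h r) (h l) * G (h l) (h s))"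
      using rs by (simp add: MB_def MG_def scalar_prod_def)
    also have "\<dots> = (\<Sum>k\<in>I. B (h r) k * G k (h s))"
      by (rule sum)
    finally show "(MB * MG) $$ (r, s) = 1\<^sub>m ?n $$ (r, s)"
      using rs by (simp add: BG hI hinj)
  qed (simp_all add: MB_def MG_def)
  then have GB: "MG * MB = 1\<^sub>m ?n" by (rule mat_mult_left_right_inverse[OF car])
  obtain r s where rs: "r < ?n" "s < ?n" "i = h r" "j = h s"
    using i j bij_betw_imp_surj_on[OF h] by (metis (no_types, lifting) atLeastLessThan_iff image_iff)
  have "(\<Sum>k\<in>I. G i k * B k j) = (\<Sum>l = 0..<?n. G (h r) (h l) * B (h l) (h s))"
    unfolding rs(3,4) by (rule sum[symmetric])
  also have "\<dots> = (MG * MB) $$ (r, s)"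
    using rs by (simp add: MB_def MG_def scalar_prod_def)
  finally show ?thesis using rs by (simp add: GB hinj)
qed

locale permutation_antipode_structure = quantum_complete_intersection n q a
  for n and q :: "nat \<Rightarrow> nat \<Rightarrow> 'k::field" and a +
  fixes \<Delta> \<epsilon> \<phi> t S p and k :: "(nat \<Rightarrow> nat) \<Rightarrow> 'k"
  assumes bi_frob: "bi_frobenius A \<Delta> \<epsilon> \<phi> t S"
    and p_bij: "bij_betw p V V"
    and S_mon: "v \<in> V \<Longrightarrow> S (x v) = k v *\<^sub>A x (p v)"
begin

lemma \<Delta>_linear: "\<Delta> \<in> linear_maps A T2"
  and \<epsilon>_dual: "\<epsilon> \<in> dual_space A"
  and counit: "y \<in> carrier A \<Longrightarrow> tensor_lift A (\<lambda>a1 a2. \<epsilon> a2 *\<^sub>A a1) (\<Delta> y) = y"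
  using bi_frob unfolding bi_frobenius_def coalgebra_def by blast+

lemma S_formula: "y \<in> carrier A \<Longrightarrow> S y = tensor_lift A (\<lambda>t1 t2. \<phi> (t1 \<cdot> y) *\<^sub>A t2) (\<Delta> t)"
  and \<phi>_dual: "\<phi> \<in> dual_space A"
  and t_closed: "t \<in> carrier A"
  and frobenius: "f \<in> dual_space A \<Longrightarrow> \<exists>b\<in>carrier A. \<forall>y\<in>carrier A. f y = \<phi> (b \<cdot> y)"
  and cofrobenius: "y \<in> carrier A \<Longrightarrow> \<exists>f\<in>dual_space A. y = tensor_lift A (\<lambda>t1 t2. f t1 *\<^sub>A t2) (\<Delta> t)"
proof -
  have A: "frobenius_algebra A \<phi>" and C: "frobenius_coalgebra A \<Delta> t"
    using bi_frob unfolding bi_frobenius_def by simp_all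
  show "S y = tensor_lift A (\<lambda>t1 t2. \<phi> (t1 \<cdot> y) *\<^sub>A t2) (\<Delta> t)" if "y \<in> carrier A"
    using bi_frob that unfolding bi_frobenius_def by simp
  show "\<phi> \<in> dual_space A" "f \<in> dual_space A \<Longrightarrow> \<exists>b\<in>carrier A. \<forall>y\<in>carrier A. f y = \<phi> (b \<cdot> y)"
    using A unfolding frobenius_algebra_def by simp_all
  show "t \<in> carrier A" using C unfolding frobenius_coalgebra_def by (rule conjunct1)
  have "carrier A = {tensor_lift A (\<lambda>t1 t2. f t1 *\<^sub>A t2) (\<Delta> t) | f. f \<in> dual_space A}"
    using C unfolding frobenius_coalgebra_def by (rule conjunct2)
  then show "\<exists>f\<in>dual_space A. y = tensor_lift A (\<lambda>t1 t2. f t1 *\<^sub>A t2) (\<Delta> t)" if "y \<in> carrier A"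
    using eqset_imp_iff[THEN iffD1, OF _ that] by blast
qed

lemma \<epsilon>_mult: "y \<in> carrier A \<Longrightarrow> z \<in> carrier A \<Longrightarrow> \<epsilon> (y \<cdot> z) = \<epsilon> y * \<epsilon> z"
  and \<epsilon>_one: "\<epsilon> \<one>\<^sub>A = 1"
proof -
  have h: "\<epsilon> \<in> Ring.ring_hom A class_ring" using bi_frob by (simp add: bi_frobenius_def)
  show "\<epsilon> (y \<cdot> z) = \<epsilon> y * \<epsilon> z" if "y \<in> carrier A" "z \<in> carrier A"
    using ring_hom_mult[OF h that] by simp
  show "\<epsilon> \<one>\<^sub>A = 1" using ring_hom_one[OF h] by simp
qed

lemma S_one: "S \<one>\<^sub>A = \<one>\<^sub>A"
  and S_mult: "y \<in> carrier A \<Longrightarrow> z \<in> carrier A \<Longrightarrow> S (y \<cdot> z) = S z \<cdot> S y"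
  and \<epsilon>_S: "y \<in> carrier A \<Longrightarrow> \<epsilon> (S y) = \<epsilon> y"
  and \<Delta>_S: "y \<in> carrier A \<Longrightarrow> \<Delta> (S y) = tensor_lift T2 (\<lambda>a1 a2. pure_tensor A A (S a2) (S a1)) (\<Delta> y)"
  using bi_frob unfolding bi_frobenius_def by blast+

abbreviation \<Theta> where "\<Theta> \<equiv> \<Delta> t"

lemma \<Theta>_closed: "\<Theta> \<in> carrier T2"
  by (rule linear_maps_closed[OF \<Delta>_linear t_closed])

lemma S_eval: "f \<in> dual_space A \<Longrightarrow> y \<in> carrier A \<Longrightarrow> f (S y) = lift (\<lambda>t1 t2. \<phi> (t1 \<cdot> y) * f t2) \<Theta>"
  by (subst S_formula) (simp, rule dual_sweedler(1)[OF _ \<Theta>_closed])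

lemma S_closed: "y \<in> carrier A \<Longrightarrow> S y \<in> carrier A"
  unfolding S_formula by (rule T2.tensor_lift_closed[OF A_vs smult_closed \<Theta>_closed])

lemma \<phi>_mult_left: "b \<in> carrier A \<Longrightarrow> (\<lambda>y. \<phi> (b \<cdot> y)) \<in> dual_space A"
  and \<phi>_mult_right: "b \<in> carrier A \<Longrightarrow> (\<lambda>y. \<phi> (y \<cdot> b)) \<in> dual_space A"
  using bilinear_form_right[OF mult_form[OF \<phi>_dual]] bilinear_form_left[OF mult_form[OF \<phi>_dual]] by auto

lemma S_linear: "S \<in> linear_maps A A"
proof (rule linear_mapsI)
  show "S (y \<oplus>\<^bsub>A\<^esub> z) = S y \<oplus>\<^bsub>A\<^esub> S z" if y: "y \<in> carrier A" and z: "z \<in> carrier A" for y z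
  proof (rule B.functionals_eqI)
    fix f assume f: "f \<in> dual_space A"
    have "f (S (y \<oplus>\<^bsub>A\<^esub> z)) = lift (\<lambda>t1 t2. \<phi> (t1 \<cdot> y) * f t2 + \<phi> (t1 \<cdot> z) * f t2) \<Theta>"
      unfolding S_eval[OF f vs_add_closed[OF A_vs y z]]
      by (rule T2.lift_cong[OF \<Theta>_closed]) (simp add: dual_add[OF \<phi>_mult_left] y z algebra_simps)
    then show "f (S (y \<oplus>\<^bsub>A\<^esub> z)) = f (S y \<oplus>\<^bsub>A\<^esub> S z)"
      by (simp add: T2.lift_add[OF \<Theta>_closed] dual_add[OF f] S_closed y z S_eval[OF f])
  qed (simp_all add: S_closed vs_add_closed[OF A_vs] y z)
  show "S (d *\<^sub>A y) = d *\<^sub>A S y" if y: "y \<in> carrier A" for d y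
  proof (rule B.functionals_eqI)
    fix f assume f: "f \<in> dual_space A"
    have "f (S (d *\<^sub>A y)) = lift (\<lambda>t1 t2. d * (\<phi> (t1 \<cdot> y) * f t2)) \<Theta>"
      unfolding S_eval[OF f smult_closed[OF y]]
      by (rule T2.lift_cong[OF \<Theta>_closed]) (simp add: dual_smult[OF \<phi>_mult_left] y algebra_simps)
    then show "f (S (d *\<^sub>A y)) = f (d *\<^sub>A S y)"
      by (simp add: T2.lift_scale[OF \<Theta>_closed] dual_smult[OF f] S_closed y S_eval[OF f])
  qed (simp_all add: S_closed smult_closed y)
qed (rule S_closed)

text \<open>The counit of \<open>t\<close> against \<open>\<epsilon> \<circ> S = \<epsilon>\<close> says that \<open>t\<close> represents \<open>\<epsilon>\<close>.\<close>

lemma \<phi>_t: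
  assumes y: "y \<in> carrier A"
  shows "\<phi> (t \<cdot> y) = \<epsilon> y"
proof -
  have "\<phi> (t \<cdot> y) = \<phi> (tensor_lift A (\<lambda>a1 a2. \<epsilon> a2 *\<^sub>A a1) \<Theta> \<cdot> y)"
    by (simp add: counit[OF t_closed])
  also have "\<dots> = lift (\<lambda>t1 t2. \<epsilon> t2 * \<phi> (t1 \<cdot> y)) \<Theta>"
    by (rule dual_sweedler(2)[OF \<phi>_mult_right[OF y] \<Theta>_closed])
  also have "\<dots> = \<epsilon> (S y)" by (simp add: S_eval[OF \<epsilon>_dual y] mult.commute)
  finally show ?thesis by (simp add: \<epsilon>_S[OF y])
qed

text \<open>
  Every functional is of the form \<open>\<phi> (b \<cdot>)\<close>, so the Gram matrix of \<open>\<phi>\<close> has a left inverse.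
  It is then also a right inverse.
\<close>

lemma gram_inverse:
  obtains R where "\<And>u v. u \<in> V \<Longrightarrow> v \<in> V \<Longrightarrow> (\<Sum>w\<in>V. \<phi> (x u \<cdot> x w) * R w v) = (if u = v then 1 else 0)"
proof -
  have "\<forall>w\<in>V. \<exists>b\<in>carrier A. \<forall>y\<in>carrier A. x\<^sup>* w y = \<phi> (b \<cdot> y)"
    using frobenius B.co_dual by blast
  then obtain b where b: "\<And>w. w \<in> V \<Longrightarrow> b w \<in> carrier A"
    "\<And>w y. w \<in> V \<Longrightarrow> y \<in> carrier A \<Longrightarrow> x\<^sup>* w y = \<phi> (b w \<cdot> y)"
    by metis
  let ?R = "\<lambda>w u. x\<^sup>* u (b w)"
  have "(\<Sum>u\<in>V. ?R w u * \<phi> (x u \<cdot> x v)) = (if w = v then 1 else 0)" if w: "w \<in> V" and v: "v \<in> V" for w v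
    using B.dual_expand[OF \<phi>_mult_right[OF mon_closed] b(1)[OF w], of v] b(2)[OF w mon_closed, of v]
    by (simp add: B.co_basis w v)
  from that[OF square_left_inverse_imp_right_inverse[OF finite_V this]] show ?thesis .
qed

lemma left_nondegenerate:
  assumes y: "y \<in> carrier A" and 0: "\<And>b. b \<in> carrier A \<Longrightarrow> \<phi> (y \<cdot> b) = 0"
  shows "y = \<zero>\<^bsub>A\<^esub>"
proof (rule B.separate[OF y])
  fix v assume v: "v \<in> V"
  obtain R where R: "\<And>u v. u \<in> V \<Longrightarrow> v \<in> V \<Longrightarrow> (\<Sum>w\<in>V. \<phi> (x u \<cdot> x w) * R w v) = (if u = v then 1 else 0)"
    using gram_inverse by blast
  let ?y = "\<lambda>u. x\<^sup>* u y"
  have "?y v = (\<Sum>u\<in>V. ?y u * (\<Sum>w\<in>V. \<phi> (x u \<cdot> x w) * R w v))"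
    using v by (simp add: R finite_V if_distrib cong: if_cong)
  also have "\<dots> = (\<Sum>w\<in>V. (\<Sum>u\<in>V. ?y u * \<phi> (x u \<cdot> x w)) * R w v)"
    unfolding sum_distrib_left sum_distrib_right by (subst sum.swap) (simp add: mult.assoc)
  also have "\<dots> = 0"
    using B.dual_expand[OF \<phi>_mult_right[OF mon_closed] y] 0[OF mon_closed] by simp
  finally show "?y v = 0" .
qed

lemma right_frobenius:
  assumes f: "f \<in> dual_space A"
  obtains b where "b \<in> carrier A" "\<And>y. y \<in> carrier A \<Longrightarrow> f y = \<phi> (y \<cdot> b)"
proof -
  obtain R where R: "\<And>u v. u \<in> V \<Longrightarrow> v \<in> V \<Longrightarrow> (\<Sum>w\<in>V. \<phi> (x u \<cdot> x w) * R w v) = (if u = v then 1 else 0)"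
    using gram_inverse by blast
  let ?b = "B.comb (\<lambda>w. \<Sum>v\<in>V. R w v * f (x v))"
  have "f (x u) = \<phi> (x u \<cdot> ?b)" if u: "u \<in> V" for u
  proof -
    have "\<phi> (x u \<cdot> ?b) = (\<Sum>w\<in>V. (\<Sum>v\<in>V. R w v * f (x v)) * \<phi> (x u \<cdot> x w))"
      by (rule B.dual_comb[OF \<phi>_mult_left[OF mon_closed]])
    also have "\<dots> = (\<Sum>v\<in>V. (\<Sum>w\<in>V. \<phi> (x u \<cdot> x w) * R w v) * f (x v))"
      unfolding sum_distrib_left sum_distrib_right by (subst sum.swap) (simp add: mult_ac)
    also have "\<dots> = f (x u)"
      using u by (simp add: R finite_V if_distrib[of "\<lambda>z. z * _"] cong: if_cong)
    finally show ?thesis ..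
  qed
  then show ?thesis
    using B.dual_eqI[OF f \<phi>_mult_right[OF B.comb_closed]] that[OF B.comb_closed] by blast
qed

text \<open>
  Both Frobenius conditions enter: elements are Sweedler sums \<open>\<Sum> f t\<^sub>1 t\<^sub>2\<close> because \<open>t\<close> is a Frobenius
  element, and \<open>f\<close> has the form \<open>\<phi> (\<cdot> b)\<close> because \<open>\<phi>\<close> is a Frobenius form.  Since \<open>S\<close> permutes the
  monomials up to scalars, surjectivity forces these scalars to be nonzero, and \<open>S\<close> is bijective.
\<close>

lemma S_surjective:
  assumes y: "y \<in> carrier A"
  obtains b where "b \<in> carrier A" "y = S b"
proof -
  obtain f where f: "f \<in> dual_space A" "y = tensor_lift A (\<lambda>t1 t2. f t1 *\<^sub>A t2) \<Theta>"
    using cofrobenius[OF y] by blast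
  obtain b where b: "b \<in> carrier A" "\<And>y. y \<in> carrier A \<Longrightarrow> f y = \<phi> (y \<cdot> b)"
    using right_frobenius[OF f(1)] by blast
  have "y = S b"
  proof (rule B.functionals_eqI[OF y S_closed[OF b(1)]])
    fix h assume h: "h \<in> dual_space A"
    have "h y = lift (\<lambda>t1 t2. f t1 * h t2) \<Theta>"
      unfolding f(2) by (rule dual_sweedler(1)[OF h \<Theta>_closed])
    also have "\<dots> = h (S b)"
      unfolding S_eval[OF h b(1)] by (rule T2.lift_cong[OF \<Theta>_closed]) (simp add: b(2))
    finally show "h y = h (S b)" .
  qed
  then show ?thesis using that b(1) by blast
qed

lemma p_V: "v \<in> V \<Longrightarrow> p v \<in> V"
  using bij_betwE[OF p_bij] by blast

lemma p_inj: "u \<in> V \<Longrightarrow> v \<in> V \<Longrightarrow> p u = p v \<longleftrightarrow> u = v"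
  using bij_betw_imp_inj_on[OF p_bij] by (auto simp: inj_on_def)

lemma S_coordinate:
  assumes v: "v \<in> V" and y: "y \<in> carrier A"
  shows "x\<^sup>* (p v) (S y) = k v * x\<^sup>* v y"
proof (rule B.dual_eqI[OF dual_comp[OF S_linear B.co_dual[OF p_V[OF v]]] _ _ y])
  show "(\<lambda>y. k v * x\<^sup>* v y) \<in> dual_space A"
    by (rule dual_scale[OF B.co_dual[OF v]])
  show "x\<^sup>* (p v) (S (x w)) = k v * x\<^sup>* v (x w)" if w: "w \<in> V" for w
    by (simp add: S_mon[OF w] dual_smult[OF B.co_dual[OF p_V[OF v]]] mon_closed B.co_basis v w p_V p_inj)
qed

lemma k_nonzero:
  assumes v: "v \<in> V"
  shows "k v \<noteq> 0"
proof
  assume "k v = 0"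
  obtain b where "b \<in> carrier A" "x (p v) = S b" using S_surjective[OF mon_closed] by blast
  then have "x\<^sup>* (p v) (x (p v)) = 0" using S_coordinate[OF v] \<open>k v = 0\<close> by simp
  then show False by (simp add: B.co_basis p_V v)
qed

lemma S_injective:
  assumes y: "y \<in> carrier A" and z: "z \<in> carrier A" and eq: "S y = S z"
  shows "y = z"
proof (rule B.coords_eqI[OF y z])
  fix v assume v: "v \<in> V"
  have "k v * x\<^sup>* v y = k v * x\<^sup>* v z"
    unfolding S_coordinate[OF v y, symmetric] S_coordinate[OF v z, symmetric] eq ..
  then show "x\<^sup>* v y = x\<^sup>* v z"
    unfolding mult_cancel_left using k_nonzero[OF v] by blast
qed

lemma \<epsilon>_generator:
  assumes i: "i \<in> {1..n}"
  shows "\<epsilon> (x (unit i)) = 0"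
proof (rule ccontr)
  assume nz: "\<epsilon> (x (unit i)) \<noteq> 0"
  \<comment> \<open>otherwise no power of \<open>x\<^sub>i\<close> could vanish\<close>
  have "(\<lambda>j. m * unit i j) \<in> V \<and> \<epsilon> (x (\<lambda>j. m * unit i j)) \<noteq> 0" for m
  proof (induction m)
    case 0
    then show ?case by (simp add: zero_V mon_zero \<epsilon>_one)
  next
    case (Suc m)
    let ?u = "\<lambda>j. m * unit i j"
    have sum: "(\<lambda>j. ?u j + unit i j) = (\<lambda>j. Suc m * unit i j)" by (simp add: fun_eq_iff)
    have "\<epsilon> (x ?u \<cdot> x (unit i)) \<noteq> 0"
      using Suc nz by (simp add: \<epsilon>_mult mon_closed)
    then show ?case
      using mon_mult[of ?u "unit i"] Suc unit_V[OF i] unfolding sum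
      by (auto simp: dual_zero[OF A_vs \<epsilon>_dual] dual_smult[OF \<epsilon>_dual mon_closed] split: if_splits)
  qed
  from this[of "Suc (\<tau> i)"] show False using V_D(2)[of "\<lambda>j. Suc (\<tau> i) * unit i j" i]
    by (simp add: unit_exponent_def)
qed

text \<open>
  As \<open>\<phi> (t x\<^sub>i b) = \<epsilon> (x\<^sub>i b) = 0\<close> for all \<open>b\<close>, the generators annihilate \<open>t\<close>.  Hence \<open>t\<close> lies in the
  socle, which is spanned by \<open>x\<^sub>\<tau>\<close>.
\<close>

lemma t_generator:
  assumes i: "i \<in> {1..n}"
  shows "t \<cdot> x (unit i) = \<zero>\<^bsub>A\<^esub>"
proof (rule left_nondegenerate)
  fix b assume b: "b \<in> carrier A"
  have "\<phi> (t \<cdot> x (unit i) \<cdot> b) = \<epsilon> (x (unit i) \<cdot> b)"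
    using b by (simp add: A.m_assoc t_closed mon_closed \<phi>_t)
  then show "\<phi> (t \<cdot> x (unit i) \<cdot> b) = 0"
    using b by (simp add: \<epsilon>_mult mon_closed \<epsilon>_generator[OF i])
qed (simp add: t_closed mon_closed)

lemma t_eq: "t = x\<^sup>* \<tau> t *\<^sub>A x \<tau>"
proof (rule B.coords_eqI)
  fix v assume v: "v \<in> V"
  show "x\<^sup>* v t = x\<^sup>* v (x\<^sup>* \<tau> t *\<^sub>A x \<tau>)"
  proof (cases "v = \<tau>")
    case True
    then show ?thesis by (simp add: dual_smult[OF B.co_dual] top_V mon_closed B.co_basis)
  next
    case False
    then obtain i where "v i \<noteq> \<tau> i" by (auto simp: fun_eq_iff)
    then have lt: "v i < \<tau> i" using V_D(2)[OF v, of i] by simp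
    then have i: "i \<in> {1..n}" by (auto simp: top_exponent_def split: if_splits)
    let ?w = "\<lambda>j. v j + unit i j"
    have w: "?w \<in> V" using v lt by (auto simp: V_iff unit_exponent_def)
    have "x\<^sup>* ?w (t \<cdot> x (unit i)) = form v (unit i) * x\<^sup>* v t"
    proof (rule B.dual_eqI[OF bilinear_form_left[OF mult_form[OF B.co_dual[OF w]] mon_closed] _ _ t_closed])
      show "(\<lambda>y. form v (unit i) * x\<^sup>* v y) \<in> dual_space A"
        by (rule dual_scale[OF B.co_dual[OF v]])
      fix u assume u: "u \<in> V"
      have "(\<lambda>j. u j + unit i j) = ?w \<longleftrightarrow> u = v" by (auto simp: fun_eq_iff)
      then show "x\<^sup>* ?w (x u \<cdot> x (unit i)) = form v (unit i) * x\<^sup>* v (x u)"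
        using w u v by (auto simp: mon_mult unit_V[OF i] dual_smult[OF B.co_dual[OF w]] mon_closed B.co_basis
            dual_zero[OF A_vs B.co_dual[OF w]])
    qed
    then have "x\<^sup>* v t = 0"
      by (simp add: t_generator[OF i] dual_zero[OF A_vs B.co_dual[OF w]] form_nonzero)
    then show ?thesis using False v by (simp add: dual_smult[OF B.co_dual[OF v]] mon_closed B.co_basis top_V)
  qed
qed (simp_all add: t_closed smult_closed mon_closed)

lemma \<phi>_t_one: "\<phi> t = 1"
  using \<phi>_t[of "\<one>\<^sub>A"] by (simp add: \<epsilon>_one t_closed)

lemma \<phi>_top_nonzero: "\<phi> (x \<tau>) \<noteq> 0"
proof
  assume "\<phi> (x \<tau>) = 0"
  then have "\<phi> (x\<^sup>* \<tau> t *\<^sub>A x \<tau>) = 0" by (simp add: dual_smult[OF \<phi>_dual mon_closed])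
  then show False unfolding t_eq[symmetric] by (simp add: \<phi>_t_one)
qed

text \<open>Comparing coefficients in \<open>S (x\<^sub>u x\<^sub>v) = S x\<^sub>v S x\<^sub>u\<close> shows that \<open>p\<close> is additive.\<close>

lemma
  assumes u: "u \<in> V" and v: "v \<in> V"
  shows p_add_V: "(\<lambda>i. p u i + p v i) \<in> V \<longleftrightarrow> (\<lambda>i. u i + v i) \<in> V"
    and p_add: "(\<lambda>i. u i + v i) \<in> V \<Longrightarrow> p (\<lambda>i. u i + v i) = (\<lambda>i. p u i + p v i)"
    and k_add: "(\<lambda>i. u i + v i) \<in> V \<Longrightarrow> form u v * k (\<lambda>i. u i + v i) = k v * k u * form (p v) (p u)"
proof -
  let ?s = "\<lambda>i. u i + v i" and ?r = "\<lambda>i. p u i + p v i"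
  have "S (x u \<cdot> x v) = (k v * k u) *\<^sub>A (x (p v) \<cdot> x (p u))"
    by (simp add: S_mult S_mon u v mon_closed smult_mult_left smult_mult_right A_smult_smult smult_closed mult.commute)
  also have "\<dots> = (if ?r \<in> V then (k v * k u * form (p v) (p u)) *\<^sub>A x ?r else \<zero>\<^bsub>A\<^esub>)"
    using smult_zero
    by (simp add: mon_mult p_V u v A_smult_smult mon_closed add.commute)
  finally have R: "S (x u \<cdot> x v) = (if ?r \<in> V then (k v * k u * form (p v) (p u)) *\<^sub>A x ?r else \<zero>\<^bsub>A\<^esub>)" .
  have L: "S (x u \<cdot> x v) = (if ?s \<in> V then (form u v * k ?s) *\<^sub>A x (p ?s) else \<zero>\<^bsub>A\<^esub>)"
    by (simp add: mon_mult u v linear_maps_smult[OF S_linear] mon_closed S_mon A_smult_smult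
        linear_maps_zero[OF A_vs A_vs S_linear])
  have co: "x\<^sup>* w (d *\<^sub>A x w') = (if w = w' then d else 0)" if "w \<in> V" "w' \<in> V" for w w' d
    using that by (simp add: dual_smult[OF B.co_dual] mon_closed B.co_basis)
  have nz: "d *\<^sub>A x w \<noteq> \<zero>\<^bsub>A\<^esub>" if "d \<noteq> 0" "w \<in> V" for d w
    using that co[of w w d] dual_zero[OF A_vs B.co_dual[of w]] by auto
  have k: "k v * k u * form (p v) (p u) \<noteq> 0" by (simp add: k_nonzero u v form_nonzero)
  have ks: "form u v * k ?s \<noteq> 0" if "?s \<in> V" using that by (simp add: k_nonzero form_nonzero)
  show V: "?r \<in> V \<longleftrightarrow> ?s \<in> V"
    using L R nz[OF k] nz[OF ks p_V] by (auto split: if_splits)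
  assume s: "?s \<in> V"
  have eq: "(form u v * k ?s) *\<^sub>A x (p ?s) = (k v * k u * form (p v) (p u)) *\<^sub>A x ?r"
    using L R s V by simp
  have c: "form u v * k ?s = (if p ?s = ?r then k v * k u * form (p v) (p u) else 0)"
    using arg_cong[OF eq, of "x\<^sup>* (p ?s)"] s V by (simp add: co p_V)
  then show "p ?s = ?r" "form u v * k ?s = k v * k u * form (p v) (p u)"
    using ks[OF s] by (auto split: if_splits)
qed

lemma p_zero: "p (\<lambda>_. 0) = (\<lambda>_. 0)"
  and k_zero: "k (\<lambda>_. 0) = 1"
proof -
  have "x (\<lambda>_. 0) = k (\<lambda>_. 0) *\<^sub>A x (p (\<lambda>_. 0))"
    using S_mon[OF zero_V] S_one by (simp add: mon_zero)
  from arg_cong[OF this, of "x\<^sup>* (\<lambda>_. 0)"]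
  have "k (\<lambda>_. 0) * (if (\<lambda>_. 0) = p (\<lambda>_. 0) then 1 else 0) = 1"
    by (simp add: dual_smult[OF B.co_dual] mon_closed B.co_basis zero_V p_V)
  then show "p (\<lambda>_. 0) = (\<lambda>_. 0)" "k (\<lambda>_. 0) = 1"
    by (cases "(\<lambda>_. 0) = p (\<lambda>_. 0)"; simp)+
qed

text \<open>A unit vector is indecomposable, hence so is its image.\<close>

lemma p_unit:
  assumes i: "i \<in> {1..n}"
  shows "\<exists>j\<in>{1..n}. p (unit i) = unit j"
proof -
  let ?u = "p (unit i)"
  have uV: "?u \<in> V" by (rule p_V[OF unit_V[OF i]])
  have "unit i \<noteq> (\<lambda>_. 0)" by (auto simp: unit_exponent_def fun_eq_iff)
  then have "?u \<noteq> (\<lambda>_. 0)" using p_inj[OF unit_V[OF i] zero_V] by (simp add: p_zero)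
  then obtain j where j: "?u j > 0" by (auto simp: fun_eq_iff)
  then have jn: "j \<in> {1..n}" using V_D(1)[OF uV] by fastforce
  define w where "w = (\<lambda>l. ?u l - unit j l)"
  have sum: "(\<lambda>l. unit j l + w l) = ?u" using j by (auto simp: w_def unit_exponent_def fun_eq_iff)
  have wV: "w \<in> V" using V_add_D(2)[of "unit j" w] uV unfolding sum by blast
  obtain v v' where v: "v \<in> V" "p v = unit j" and v': "v' \<in> V" "p v' = w"
    using bij_betw_imp_surj_on[OF p_bij] unit_V[OF jn] wV by (metis imageE)
  have V: "(\<lambda>l. v l + v' l) \<in> V" using p_add_V[OF v(1) v'(1)] uV v v' sum by simp
  have "p (\<lambda>l. v l + v' l) = ?u" using p_add[OF v(1) v'(1) V] v v' sum by simp
  then have vv: "(\<lambda>l. v l + v' l) = unit i" using p_inj[OF V unit_V[OF i]] by simp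
  have "v \<noteq> (\<lambda>_. 0)"
  proof
    assume "v = (\<lambda>_. 0)"
    then have "unit j = (\<lambda>_. 0)" using v(2) p_zero by simp
    from fun_cong[OF this, of j] show False by (simp add: unit_exponent_def)
  qed
  then obtain l where "v l \<noteq> 0" by (auto simp: fun_eq_iff)
  then have "v i \<noteq> 0" using fun_cong[OF vv, of l] by (auto simp: unit_exponent_def split: if_splits)
  have "v' = (\<lambda>_. 0)"
  proof
    fix l show "v' l = 0" using fun_cong[OF vv, of l] \<open>v i \<noteq> 0\<close> by (auto simp: unit_exponent_def split: if_splits)
  qed
  then have "w = (\<lambda>_. 0)" using v'(2) p_zero by simp
  then have "p (unit i) = unit j" using sum by simp
  then show ?thesis using jn by blast
qed

lemma unit_inj: "unit i = unit j \<longleftrightarrow> i = j"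
  by (auto simp: unit_exponent_def fun_eq_iff split: if_splits)

text \<open>Extended by the identity, so that it is a permutation of the naturals.\<close>

definition \<pi> :: "nat \<Rightarrow> nat" where
  "\<pi> i = (if i \<in> {1..n} then SOME j. j \<in> {1..n} \<and> p (unit i) = unit j else i)"

lemma
  assumes i: "i \<in> {1..n}"
  shows \<pi>_in: "\<pi> i \<in> {1..n}" and p_unit_\<pi>: "p (unit i) = unit (\<pi> i)"
proof -
  have "\<exists>j. j \<in> {1..n} \<and> p (unit i) = unit j" using p_unit[OF i] by blast
  from someI_ex[OF this] show "\<pi> i \<in> {1..n}" "p (unit i) = unit (\<pi> i)"
    using i unfolding \<pi>_def by simp_all
qed

lemma \<pi>_permutes: "\<pi> permutes {1..n}"
proof (rule bij_imp_permutes)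
  have "inj_on \<pi> {1..n}"
  proof (rule inj_onI)
    fix i j assume i: "i \<in> {1..n}" and j: "j \<in> {1..n}" and "\<pi> i = \<pi> j"
    then have "p (unit i) = p (unit j)" by (simp only: p_unit_\<pi>)
    then show "i = j" by (simp add: p_inj unit_V[OF i] unit_V[OF j] unit_inj)
  qed
  moreover have "\<pi> ` {1..n} \<subseteq> {1..n}" using \<pi>_in by blast
  ultimately show "bij_betw \<pi> {1..n} {1..n}"
    by (metis bij_betw_def endo_inj_surj finite_atLeastAtMost)
qed (auto simp: \<pi>_def)

lemma multiple_unit_V: "i \<in> {1..n} \<Longrightarrow> (\<lambda>j. m * unit i j) \<in> V \<longleftrightarrow> m \<le> \<tau> i"
  by (auto simp: V_iff unit_exponent_def)

text \<open>
  The exponent \<open>a\<^sub>i\<close> is recovered from the largest multiple of the unit vector at \<open>i\<close> in \<open>V\<close>, and \<open>p\<close>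
  is additive.
\<close>

lemma \<pi>_\<tau>:
  assumes i: "i \<in> {1..n}"
  shows "\<tau> (\<pi> i) = \<tau> i"
proof -
  have "(m \<le> \<tau> i \<longleftrightarrow> m \<le> \<tau> (\<pi> i)) \<and> (m \<le> \<tau> i \<longrightarrow> p (\<lambda>j. m * unit i j) = (\<lambda>j. m * unit (\<pi> i) j))" for m
  proof (induction m)
    case 0
    then show ?case by (simp add: p_zero)
  next
    case (Suc m)
    show ?case
    proof (cases "m \<le> \<tau> i")
      case True
      let ?u = "\<lambda>j. m * unit i j"
      have u: "?u \<in> V" using True by (simp add: multiple_unit_V[OF i])
      have sum: "(\<lambda>j. ?u j + unit i j) = (\<lambda>j. Suc m * unit i j)"
        "(\<lambda>j. p ?u j + p (unit i) j) = (\<lambda>j. Suc m * unit (\<pi> i) j)"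
        using Suc True by (simp_all add: fun_eq_iff p_unit_\<pi>[OF i])
      show ?thesis
        using p_add_V[OF u unit_V[OF i]] p_add[OF u unit_V[OF i]] unfolding sum
        by (simp only: multiple_unit_V[OF i] multiple_unit_V[OF \<pi>_in[OF i]]) simp
    next
      case False
      then show ?thesis using Suc by simp
    qed
  qed
  then show ?thesis by (meson dual_order.antisym order_refl)
qed

lemma \<pi>_compatible: "compatible n q a \<pi>"
  unfolding compatible_def
proof (intro conjI ballI)
  show "\<pi> permutes {1..n}" by (rule \<pi>_permutes)
  fix i assume i: "i \<in> {1..n}"
  note \<pi>i = \<pi>_in[OF i]
  show "a (\<pi> i) = a i"
    using \<pi>_\<tau>[OF i] i \<pi>i a_ge_2[OF i] a_ge_2[OF \<pi>i] by (simp add: top_exponent_def)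
  fix j assume j: "j \<in> {1..n}"
  note \<pi>j = \<pi>_in[OF j]
  show "q (\<pi> i) (\<pi> j) = q j i"
  proof (cases "i = j")
    case True
    then show ?thesis using q_diag[OF i] q_diag[OF \<pi>i] by simp
  next
    case False
    then have V: "(\<lambda>l. unit i l + unit j l) \<in> V" "(\<lambda>l. unit j l + unit i l) \<in> V"
      using top_pos[OF i] top_pos[OF j] by (auto simp: V_iff unit_exponent_def)
    have comm: "(\<lambda>l. unit j l + unit i l) = (\<lambda>l. unit i l + unit j l)" by (simp add: add.commute)
    let ?k = "k (unit i) * k (unit j)" and ?K = "k (\<lambda>l. unit i l + unit j l)"
    have 1: "swap_coeff q i j * ?K = ?k * swap_coeff q (\<pi> j) (\<pi> i)"
      using k_add[OF unit_V[OF i] unit_V[OF j] V(1)]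
      by (simp only: p_unit_\<pi>[OF i] p_unit_\<pi>[OF j] q_form_unit[OF i j] q_form_unit[OF \<pi>j \<pi>i] mult.commute)
    have 2: "swap_coeff q j i * ?K = ?k * swap_coeff q (\<pi> i) (\<pi> j)"
      using k_add[OF unit_V[OF j] unit_V[OF i] V(2)] unfolding comm
      by (simp only: p_unit_\<pi>[OF i] p_unit_\<pi>[OF j] q_form_unit[OF j i] q_form_unit[OF \<pi>i \<pi>j])
    let ?\<sigma> = "swap_coeff q (\<pi> i) (\<pi> j)"
    have "q j i * (?k * ?\<sigma>) = q j i * (swap_coeff q j i * ?K)" by (simp only: 2)
    also have "\<dots> = swap_coeff q i j * ?K" by (simp only: swap_coeff_swap[OF j i] mult.assoc)
    also have "\<dots> = q (\<pi> i) (\<pi> j) * (?k * ?\<sigma>)"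
      unfolding 1 swap_coeff_swap[OF \<pi>i \<pi>j] by (simp only: mult_ac)
    finally show ?thesis
      using swap_coeff_nonzero[OF \<pi>j \<pi>i] k_nonzero[OF unit_V[OF i]] k_nonzero[OF unit_V[OF j]] by simp
  qed
qed

sublocale P: compatible_permutation n q a \<pi>
  by unfold_locales (rule \<pi>_compatible)

lemma p_eq_act:
  assumes "v \<in> V"
  shows "p v = P.act v"
proof -
  have "v \<in> V \<longrightarrow> p v = P.act v"
    using V_D(1)[OF assms]
  proof (induction v rule: exponent_induct)
    case (add v i)
    then show ?case
      using p_add[of v "unit i"] V_add_D[of v "unit i"] by (simp add: P.act_add P.act_unit p_unit_\<pi>)
  qed (simp add: p_zero P.act_zero)
  then show ?thesis using assms by simp
qed

abbreviation d :: "nat \<Rightarrow> 'k" where "d \<equiv> \<lambda>i. k (unit i)"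

lemma k_eq_S_coeff: "v \<in> V \<Longrightarrow> k v = S_coeff n q \<pi> d v"
proof (rule P.S_coeff_unique)
  fix u v :: "nat \<Rightarrow> nat" assume V: "(\<lambda>i. u i + v i) \<in> V"
  then have "u \<in> V" "v \<in> V" using V_add_D by blast+
  then show "form u v * k (\<lambda>i. u i + v i) = k v * k u * form (P.act v) (P.act u)"
    using k_add[OF _ _ V] by (simp add: p_eq_act)
qed (simp_all add: k_zero)

lemma S_top: "S (x \<tau>) = k \<tau> *\<^sub>A x \<tau>"
  using S_mon[OF top_V] by (simp add: p_eq_act[OF top_V] P.act_top)

lemma S_t: "S t = k \<tau> *\<^sub>A t"
proof -
  let ?l = "x\<^sup>* \<tau> t"
  have "S t = S (?l *\<^sub>A x \<tau>)" by (subst t_eq) (rule refl)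
  also have "\<dots> = k \<tau> *\<^sub>A (?l *\<^sub>A x \<tau>)"
    by (simp add: linear_maps_smult[OF S_linear] mon_closed S_top A_smult_smult mult.commute)
  also have "?l *\<^sub>A x \<tau> = t" by (rule t_eq[symmetric])
  finally show ?thesis .
qed

text \<open>
  Up to a scalar, the square of the antipode is the Nakayama automorphism of \<open>\<phi>\<close>: apply \<open>\<phi> (\<cdot> y)\<close>
  and then \<open>\<phi> (\<cdot> z)\<close> to the two sides of \<open>\<Delta> (S t) = \<Sum> S t\<^sub>2 \<otimes> S t\<^sub>1\<close>.
\<close>

lemma nakayama:
  assumes y: "y \<in> carrier A" and z: "z \<in> carrier A"
  shows "k \<tau> * \<phi> (y \<cdot> z) = \<phi> (S (S z) \<cdot> y)"
proof -
  define L where "L = tensor_lift A (\<lambda>t1 t2. \<phi> (S t2 \<cdot> y) *\<^sub>A t1) \<Theta>"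
  have L: "L \<in> carrier A" unfolding L_def by (rule T2.tensor_lift_closed[OF A_vs smult_closed \<Theta>_closed])
  have \<Theta>_eq: "k \<tau> \<odot>\<^bsub>T2\<^esub> \<Theta> = tensor_lift T2 (\<lambda>a1 a2. pure_tensor A A (S a2) (S a1)) \<Theta>"
    using \<Delta>_S[OF t_closed] by (simp add: S_t linear_maps_smult[OF \<Delta>_linear] t_closed)
  have "S L = S (k \<tau> *\<^sub>A y)"
  proof (rule B.functionals_eqI)
    fix f assume f: "f \<in> dual_space A"
    let ?b = "\<lambda>t1 t2. \<phi> (t1 \<cdot> y) * f t2"
    have b: "?b \<in> bilinear_forms A A" by (rule product_bilinear_form[OF \<phi>_mult_right[OF y] f])
    have "f (S (k \<tau> *\<^sub>A y)) = k \<tau> * lift ?b \<Theta>"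
      by (simp add: linear_maps_smult[OF S_linear] y dual_smult[OF f] S_closed S_eval[OF f])
    also have "\<dots> = lift ?b (k \<tau> \<odot>\<^bsub>T2\<^esub> \<Theta>)"
      by (rule dual_smult[OF T2.lift_dual[OF b] \<Theta>_closed, symmetric])
    also have "\<dots> = lift (\<lambda>a1 a2. lift ?b (pure_tensor A A (S a2) (S a1))) \<Theta>"
      unfolding \<Theta>_eq
      by (rule T2.dual_tensor_lift[OF T2.tensor_vs _ \<Theta>_closed T2.lift_dual[OF b]])
        (simp add: T2.pure_closed S_closed)
    also have "\<dots> = lift (\<lambda>a1 a2. \<phi> (S a2 \<cdot> y) * f (S a1)) \<Theta>"
      by (rule T2.lift_cong[OF \<Theta>_closed]) (simp add: T2.lift_pure[OF b] S_closed)
    also have "\<dots> = f (S L)"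
      unfolding L_def by (rule dual_sweedler(2)[OF dual_comp[OF S_linear f] \<Theta>_closed, symmetric])
    finally show "f (S L) = f (S (k \<tau> *\<^sub>A y))" ..
  qed (simp_all add: S_closed L smult_closed y)
  then have "L = k \<tau> *\<^sub>A y" by (rule S_injective[OF L smult_closed[OF y]])
  then have "k \<tau> * \<phi> (y \<cdot> z) = \<phi> (L \<cdot> z)"
    by (simp add: dual_smult[OF \<phi>_mult_right[OF z] y])
  also have "\<dots> = lift (\<lambda>t1 t2. \<phi> (S t2 \<cdot> y) * \<phi> (t1 \<cdot> z)) \<Theta>"
    unfolding L_def by (rule dual_sweedler(2)[OF \<phi>_mult_right[OF z] \<Theta>_closed])
  also have "\<dots> = lift (\<lambda>t1 t2. \<phi> (t1 \<cdot> z) * \<phi> (S t2 \<cdot> y)) \<Theta>"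
    by (simp only: mult.commute)
  also have "\<dots> = \<phi> (S (S z) \<cdot> y)"
    by (rule S_eval[OF dual_comp[OF S_linear \<phi>_mult_right[OF y]] z, symmetric])
  finally show ?thesis .
qed

text \<open>
  Evaluating \<open>nakayama\<close> at \<open>1\<close> and \<open>t\<close> shows that the eigenvalue of \<open>S\<close> at \<open>t\<close> is idempotent.
\<close>

lemma k_top: "k \<tau> = 1"
proof -
  have "k \<tau> * \<phi> (\<one>\<^sub>A \<cdot> t) = \<phi> (S (S t) \<cdot> \<one>\<^sub>A)"
    by (rule nakayama) (simp_all add: t_closed)
  then have "k \<tau> = k \<tau> * k \<tau>"
    by (simp add: t_closed S_t linear_maps_smult[OF S_linear] A_smult_smult smult_closed dual_smult[OF \<phi>_dual] \<phi>_t_one)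
  then show ?thesis using k_nonzero[OF top_V] by simp
qed

text \<open>
  On \<open>x\<^sub>i\<close> the Nakayama automorphism is multiplication by the ratio of the two coefficients with
  which \<open>x\<^sub>i\<close> and its complementary monomial multiply to \<open>x\<^sub>\<tau>\<close>.
\<close>

lemma
  assumes i: "i \<in> {1..n}"
  shows \<pi>_\<pi>: "\<pi> (\<pi> i) = i"
    and d_pair: "d i * d (\<pi> i) = h_coeff n q a (unit i)"
proof -
  let ?j = "\<pi> (\<pi> i)" and ?w = "\<tau> - unit i"
  note \<pi>i = \<pi>_in[OF i]
  have j: "?j \<in> {1..n}" by (rule \<pi>_in[OF \<pi>i])
  have "S (S (x (unit i))) = (d i * d (\<pi> i)) *\<^sub>A x (unit ?j)"
    by (simp only: S_mon[OF unit_V[OF i]] p_unit_\<pi>[OF i] linear_maps_smult[OF S_linear mon_closed]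
        S_mon[OF unit_V[OF \<pi>i]] p_unit_\<pi>[OF \<pi>i] A_smult_smult[OF mon_closed])
  moreover have "\<phi> (x ?w \<cdot> x (unit i)) = form ?w (unit i) * \<phi> (x \<tau>)"
    by (simp only: mon_mult[OF compl_V unit_V[OF i]] compl_add(1)[OF unit_V[OF i]] top_V if_True
        dual_smult[OF \<phi>_dual mon_closed])
  ultimately have main: "form ?w (unit i) * \<phi> (x \<tau>) = d i * d (\<pi> i) * \<phi> (x (unit ?j) \<cdot> x ?w)"
    using nakayama[OF mon_closed[of ?w] mon_closed[of "unit i"]]
    by (simp add: k_top smult_mult_left mon_closed dual_smult[OF \<phi>_dual])
  show eq: "?j = i"
  proof (rule ccontr)
    assume ne: "?j \<noteq> i"
    have "(\<lambda>l. unit ?j l + ?w l) \<notin> V"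
    proof
      assume "(\<lambda>l. unit ?j l + ?w l) \<in> V"
      from V_D(2)[OF this, of ?j] show False using ne by (simp add: unit_exponent_def)
    qed
    then have "x (unit ?j) \<cdot> x ?w = \<zero>\<^bsub>A\<^esub>" by (simp only: mon_mult[OF unit_V[OF j] compl_V] if_False)
    then show False using main by (simp add: dual_zero[OF A_vs \<phi>_dual] form_nonzero \<phi>_top_nonzero)
  qed
  have "\<phi> (x (unit i) \<cdot> x ?w) = form (unit i) ?w * \<phi> (x \<tau>)"
    by (simp only: mon_mult[OF unit_V[OF i] compl_V] compl_add(2)[OF unit_V[OF i]] top_V if_True
        dual_smult[OF \<phi>_dual mon_closed])
  then have "form ?w (unit i) * \<phi> (x \<tau>) = d i * d (\<pi> i) * form (unit i) ?w * \<phi> (x \<tau>)"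
    using main unfolding eq by (simp only: mult.assoc)
  then show "d i * d (\<pi> i) = h_coeff n q a (unit i)"
    by (simp add: \<phi>_top_nonzero h_coeff_def form_nonzero field_simps)
qed

lemma \<pi>_involution: "\<pi> \<circ> \<pi> = id"
proof
  fix i show "(\<pi> \<circ> \<pi>) i = id i"
  proof (cases "i \<in> {1..n}")
    case False
    then have "\<pi> i = i" by (simp only: \<pi>_def if_False)
    then show ?thesis by simp
  qed (simp add: \<pi>_\<pi>)
qed

lemma d_top: "q_perm n q a \<pi> * (\<Prod>i = 1..n. d i ^ (a i - 1)) = 1"
  unfolding P.q_perm_eq using k_eq_S_coeff[OF top_V] k_top by simp

end


section \<open>The characterization\<close>

theorem theorem6p1:
  fixes n :: nat and q :: "nat \<Rightarrow> nat \<Rightarrow> 'k::field" and a :: "nat \<Rightarrow> nat"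
  assumes "n \<ge> 2"
    and "\<forall>i\<in>{1..n}. a i \<ge> 2"
    and "\<forall>i\<in>{1..n}. q i i = 1"
    and "\<forall>i\<in>{1..n}. \<forall>j\<in>{1..n}. q i j * q j i = 1"
  shows "((\<exists>\<Delta> \<epsilon> \<phi> t S. bi_frobenius (qci n q a) \<Delta> \<epsilon> \<phi> t S \<and> permutation_antipode n q a S)
      \<longleftrightarrow> (\<exists>\<pi> c. compatible n q a \<pi> \<and> \<pi> \<circ> \<pi> = id \<and>
            (\<forall>i\<in>{1..n}. c i * c (\<pi> i) = h_coeff n q a (unit_exponent i)) \<and>
            q_perm n q a \<pi> * (\<Prod>i = 1..n. c i ^ (a i - 1)) = 1))
    \<and> (\<forall>\<pi> c. compatible n q a \<pi> \<longrightarrow> \<pi> \<circ> \<pi> = id \<longrightarrow>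
            (\<forall>i\<in>{1..n}. c i * c (\<pi> i) = h_coeff n q a (unit_exponent i)) \<longrightarrow>
            q_perm n q a \<pi> * (\<Prod>i = 1..n. c i ^ (a i - 1)) = 1 \<longrightarrow>
            bi_frobenius (qci n q a) (qci_comult n q a \<pi> c) (qci_counit n q a)
              (qci_dual n q a (top_exponent n a)) (qci_mon n q a (top_exponent n a))
              (qci_antipode n q a \<pi> c) \<and>
            (\<forall>i\<in>{1..n}. qci_antipode n q a \<pi> c (qci_gen n q a i)
                          = c i \<odot>\<^bsub>qci n q a\<^esub> qci_gen n q a (\<pi> i)))"
proof -
  have Q: "quantum_complete_intersection n q a"
    using assms by unfold_locales auto
  have data: "involution_data n q a \<pi> c"
    if "compatible n q a \<pi>" "\<pi> \<circ> \<pi> = id"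
      "\<forall>i\<in>{1..n}. c i * c (\<pi> i) = h_coeff n q a (unit_exponent i)"
      "q_perm n q a \<pi> * (\<Prod>i = 1..n. c i ^ (a i - 1)) = 1" for \<pi> c
    by (intro involution_data.intro compatible_permutation.intro compatible_permutation_axioms.intro
        involution_data_axioms.intro Q) (use that in blast)+
  show ?thesis
  proof (intro conjI iffI allI impI)
    assume "\<exists>\<Delta> \<epsilon> \<phi> t S. bi_frobenius (qci n q a) \<Delta> \<epsilon> \<phi> t S \<and> permutation_antipode n q a S"
    then obtain \<Delta> \<epsilon> \<phi> t S where b: "bi_frobenius (qci n q a) \<Delta> \<epsilon> \<phi> t S" "permutation_antipode n q a S"
      by blast
    obtain p k where p: "bij_betw p (exponents n a) (exponents n a)"
      "\<forall>v\<in>exponents n a. S (qci_mon n q a v) = k v \<odot>\<^bsub>qci n q a\<^esub> qci_mon n q a (p v)"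
      using b(2) unfolding permutation_antipode_def by (elim exE conjE)
    interpret permutation_antipode_structure n q a \<Delta> \<epsilon> \<phi> t S p k
      by (intro permutation_antipode_structure.intro permutation_antipode_structure_axioms.intro Q b(1) p(1) p(2)[rule_format])
    show "\<exists>\<pi> c. compatible n q a \<pi> \<and> \<pi> \<circ> \<pi> = id \<and>
            (\<forall>i\<in>{1..n}. c i * c (\<pi> i) = h_coeff n q a (unit_exponent i)) \<and>
            q_perm n q a \<pi> * (\<Prod>i = 1..n. c i ^ (a i - 1)) = 1"
      by (rule exI[of _ \<pi>], rule exI[of _ d], intro conjI ballI \<pi>_compatible \<pi>_involution d_pair d_top)
  next
    assume "\<exists>\<pi> c. compatible n q a \<pi> \<and> \<pi> \<circ> \<pi> = id \<and>
            (\<forall>i\<in>{1..n}. c i * c (\<pi> i) = h_coeff n q a (unit_exponent i)) \<and>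
            q_perm n q a \<pi> * (\<Prod>i = 1..n. c i ^ (a i - 1)) = 1"
    then obtain \<pi> c where "involution_data n q a \<pi> c" using data by blast
    then interpret involution_data n q a \<pi> c .
    show "\<exists>\<Delta> \<epsilon> \<phi> t S. bi_frobenius (qci n q a) \<Delta> \<epsilon> \<phi> t S \<and> permutation_antipode n q a S"
      by (intro exI conjI) (rule attached_bi_frobenius, rule attached_permutation_antipode)
  next
    fix \<pi> c
    assume "compatible n q a \<pi>" "\<pi> \<circ> \<pi> = id"
      "\<forall>i\<in>{1..n}. c i * c (\<pi> i) = h_coeff n q a (unit_exponent i)"
      "q_perm n q a \<pi> * (\<Prod>i = 1..n. c i ^ (a i - 1)) = 1"
    then interpret involution_data n q a \<pi> c by (rule data)
    show "bi_frobenius (qci n q a) (qci_comult n q a \<pi> c) (qci_counit n q a)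
        (qci_dual n q a (top_exponent n a)) (qci_mon n q a (top_exponent n a)) (qci_antipode n q a \<pi> c)"
      by (rule attached_bi_frobenius)
    show "\<forall>i\<in>{1..n}. qci_antipode n q a \<pi> c (qci_gen n q a i) = c i \<odot>\<^bsub>qci n q a\<^esub> qci_gen n q a (\<pi> i)"
      by (intro ballI antipode_generator)
  qed
qed

end
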